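(* Let $\mathbf{y}^{(j)} = \mathcal{L}^\star({X^{(j)}}^\star)$, $j=1,\dots,n$, where $\mathcal{L}^\star : \mathbb{R}^{q\times q}\to\mathbb{R}^d$ is a linear map and $\mathfrak{X}^\star := \{{X^{(j)}}^\star\}_{j=1}^n \subset \mathbb{R}^{q\times q}$. Suppose the collection $\mathfrak{X}^\star$ satisfies: (1) there exist $r<q$ and $s>0$ such that $\mathrm{rank}({X^{(j)}}^\star)=r$ and $s \ge \sigma_1({X^{(j)}}^\star) \ge \sigma_r({X^{(j)}}^\star) \ge s/2$ for each $j=1,\dots,n$; (2) $\frac{\Omega(\mathfrak{X}^\star)}{\Lambda(\mathfrak{X}^\star)} \le \frac{d}{40q^2}$; (3) $\frac{\Delta(\mathfrak{X}^\star)}{\Lambda(\mathfrak{X}^\star)} \le \frac{\sqrt d}{100q^3}$. Suppose the linear map $\mathcal{L}^\star$ satisfies: (1) the restricted isometry condition $\delta_{4r}(\mathcal{L}^\star)\le \frac1{20}$, where $r$ is the rank of each ${X^{(j)}}^\star$; (2) $\mathcal{L}^\star$ is normalized and surjective; (3) $\|\mathcal{L}^\star\|_2^2 \le \frac{5q^2}{d}$. Suppose the alternating update algorithm (described in the context) is applied to the data $\{\mathbf{y}^{(j)}\}_{j=1}^n$ with target dimension $q$ and target rank $r$, and is supplied with a normalized initial guess $\mathcal{L}^{(0)}:\mathbb{R}^{q\times q}\to\mathbb{R}^d$ with $$\xi_{\mathcal{L}^\star}(\mathcal{L}^{(0)}) < \frac{1}{20000\, q^{7/2} r^2 \|\mathcal{L}^\star\|_2^2}.$$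 Then the sequence $\{\mathcal{L}^{(t)}\}$ produced by the algorithm satisfies $$\limsup_{t\to\infty} \frac{\xi_{\mathcal{L}^\star}(\mathcal{L}^{(t+1)})}{\xi_{\mathcal{L}^\star}(\mathcal{L}^{(t)})} \le 2\|\mathcal{L}^\star\|_2^2 \frac{\Omega(\mathfrak{X}^\star)}{\Lambda(\mathfrak{X}^\star)} + 10 q^2 \|\mathcal{L}^\star\|_2 \frac{\Delta(\mathfrak{X}^\star)}{\Lambda(\mathfrak{X}^\star)} < 1.$$ In other words, $\xi_{\mathcal{L}^\star}(\mathcal{L}^{(t)})\to 0$ with the rate of convergence bounded above by $2\|\mathcal{L}^\star\|_2^2 \frac{\Omega(\mathfrak{X}^\star)}{\Lambda(\mathfrak{X}^\star)} + 10 q^2 \|\mathcal{L}^\star\|_2 \frac{\Delta(\mathfrak{X}^\star)}{\Lambda(\mathfrak{X}^\star)}$.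
   Context: Norms. $\mathbb{R}^{q\times q}$ carries the trace inner product $\langle A,B\rangle=\mathrm{trace}(A'B)$; $\mathrm{End}(V)$ is the space of linear operators $V\to V$. $\|\cdot\|_{\ell_2}$ is the Euclidean (Frobenius / Hilbert--Schmidt) norm of a vector, matrix, or linear operator; $\|\cdot\|_2$ is the spectral norm of a matrix, or the operator norm (induced by Euclidean norms) of a linear map. $\sigma_k$ is the $k$-th largest singular value. $\mathcal{P}_V$ is the orthogonal projection onto $V$. $\mathsf{I}$ is the identity on $\mathbb{R}^{q\times q}$. Covariance quantities. For matrices $A,B$, $A\boxtimes B\in \mathrm{End}(\mathbb{R}^{q\times q})$ is $X\mapsto \langle B,X\rangle A$. For $\mathfrak{X}=\{X^{(j)}\}_{j=1}^n$, $\mathsf{\Sigma}(\mathfrak{X})=\frac1n\sum_j X^{(j)}\boxtimes X^{(j)}$, $\Lambda(\mathfrak{X})=\frac12(\lambda_{\max}(\mathsf{\Sigma}(\mathfrak{X}))+\lambda_{\min}(\mathsf{\Sigma}(\mathfrak{X})))$, $\Delta(\mathfrak{X})=\frac12(\lambda_{\max}(\mathsf{\Sigma}(\mathfrak{X}))-\lambda_{\min}(\mathsf{\Sigma}(\mathfrak{X})))$. Tangent spaces and $\Omega$. For a matrix $X\in\mathbb{R}^{q\times q}$, $\mathcal{T}(X)=\{XA+BX : A,B\in\mathbb{R}^{q\times q}\}$. Let $\mathcal{W}\subset \mathrm{End}(\mathbb{R}^{q\times q})$ be the subspace $\mathrm{span}\{I\otimes W_1 + W_2\otimes I : W_1,W_2\in\mathbb{R}^{q\times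 q}\}$, i.e. all operators of the form $X\mapsto AX+XB$. For $\mathsf{A},\mathsf{B}\in\mathrm{End}(\mathbb{R}^{q\times q})$ the Kronecker product $\mathsf{A}\otimes\mathsf{B}\in\mathrm{End}(\mathrm{End}(\mathbb{R}^{q\times q}))$ is $\mathsf{E}\mapsto \mathsf{B}\circ\mathsf{E}\circ\mathsf{A}'$. Then $$\Omega(\mathfrak{X})=\Big\|\mathcal{P}_{\mathcal{W}^\perp}\circ\Big[\tfrac1n\sum_{j=1}^n (X^{(j)}\boxtimes X^{(j)})\otimes \mathcal{P}_{\mathcal{T}(X^{(j)})}\Big]\Big\|_2 .$$ Restricted isometry. For a linear map $\mathcal{L}:\mathbb{R}^{q\times q}\to\mathbb{R}^d$, $\delta_k(\mathcal{L})$ is the smallest $\delta$ with $1-\delta\le \|\mathcal{L}(X)\|_{\ell_2}^2/\|X\|_{\ell_2}^2\le 1+\delta$ for all nonzero $X$ of rank at most $k$. Normalization. $\mathcal{L}$ has component matrices $\mathcal{L}_i\in\mathbb{R}^{q\times q}$, with $\mathcal{L}(X)_i=\langle \mathcal{L}_i,X\rangle$; $\mathcal{L}$ is normalized if $\sum_{i=1}^d\mathcal{L}_i\mathcal{L}_i'=qI$ and $\sum_{i=1}^d\mathcal{L}_i'\mathcal{L}_i=qI$. A rank-preserver is a linear $\mathsf{M}\in\mathrm{End}(\mathbb{R}^{q\times q})$ with $\mathrm{rank}(\mathsf{M}(X))=\mathrm{rank}(X)$ for all $X$; it is a positive-definite rank-preserver if $\mathsf{M}(X)=P_1XP_2$ with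 $P_1,P_2$ symmetric positive definite. Distance. For surjective $\mathcal{L}^\star$, $\xi_{\mathcal{L}^\star}(\mathcal{L})=\inf\{\|\mathsf{E}\|_{\ell_2} : \mathsf{E}\in\mathrm{End}(\mathbb{R}^{q\times q}),\ \exists \text{ a rank-preserver } \mathsf{M} \text{ with } \mathcal{L}=\mathcal{L}^\star\circ(\mathsf{I}+\mathsf{E})\circ\mathsf{M}\}$. Alternating update algorithm. Given data $\mathbf{y}^{(1)},\dots,\mathbf{y}^{(n)}\in\mathbb{R}^d$, target dimension $q$, target rank $r<q$, and a normalized $\mathcal{L}^{(0)}$, iteration $t\mapsto t+1$ is: Step 1: for each $j$, compute $\hat X^{(j)}$ as a solution of $\min_X \|\mathbf{y}^{(j)}-\mathcal{L}^{(t)}(X)\|_{\ell_2}^2$ subject to $\mathrm{rank}(X)\le r$. This is computed by the singular value projection procedure: starting from $X=0$, repeat $X\leftarrow X+\nu\,\mathcal{L}^{(t)\prime}(\mathbf{y}^{(j)}-\mathcal{L}^{(t)}(X))$ with a damping parameter $\nu\in(0,1]$ followed by replacing $X$ by its rank-$r$ truncated singular value decomposition, until convergence; its required output is a minimizer of the stated rank-constrained problem. Step 2: $\tilde{\mathcal{L}}^{(t+1)}=\arg\min_{\bar{\mathcal{L}}}\sum_{j=1}^n\|\mathbf{y}^{(j)}-\bar{\mathcal{L}}(\hat X^{(j)})\|_{\ell_2}^2$ over linear maps $\bar{\mathcal{L}}:\mathbb{R}^{q\times q}\to\mathbb{R}^d$ (computed by a pseudoinverse). Step 3: $\mathcal{L}^{(t+1)}$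 is the normalized map $\tilde{\mathcal{L}}^{(t+1)}\circ\mathsf{N}$, where $\mathsf{N}$ is the positive-definite rank-preserver making it normalized. It is computed as the limit of the Operator Sinkhorn iteration, which alternates $\mathcal{L}_i\leftarrow\sqrt q\,R^{-1/2}\mathcal{L}_i$ with $R=\sum_i\mathcal{L}_i\mathcal{L}_i'$, and $\mathcal{L}_i\leftarrow\sqrt q\,\mathcal{L}_iC^{-1/2}$ with $C=\sum_i\mathcal{L}_i'\mathcal{L}_i$. *)

theory Defs
  imports "HOL-Analysis.Analysis"
begin

text \<open>
  Linear maps between Euclidean spaces, with the Hilbert--Schmidt inner product. The library type
  of bounded linear functions carries the operator norm instead, so it cannot serve as the
  inner product space of operators in which orthogonal complements and Hilbert--Schmidt norms
  are taken.
\<close>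

typedef (overloaded) ('a::euclidean_space, 'b::euclidean_space) linop = "{f :: 'a \<Rightarrow> 'b. linear f}"
  morphisms app Linop
  by (auto intro: linear_zero)

setup_lifting type_definition_linop

lemma linear_app: "linear (app E)"
  using app by auto

lemma linop_eqI: "(\<And>x. app E x = app F x) \<Longrightarrow> E = F"
  by (metis app_inject ext)

instantiation linop :: (euclidean_space, euclidean_space) real_vector
begin

lift_definition zero_linop :: "('a, 'b) linop" is "\<lambda>x. 0" by (rule linear_zero)
lift_definition plus_linop :: "('a, 'b) linop \<Rightarrow> ('a, 'b) linop \<Rightarrow> ('a, 'b) linop"
  is "\<lambda>f g x. f x + g x" by (rule linear_compose_add)
lift_definition uminus_linop :: "('a, 'b) linop \<Rightarrow> ('a, 'b) linop"
  is "\<lambda>f x. - f x" by (rule linear_compose_neg)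
lift_definition minus_linop :: "('a, 'b) linop \<Rightarrow> ('a, 'b) linop \<Rightarrow> ('a, 'b) linop"
  is "\<lambda>f g x. f x - g x" by (rule linear_compose_sub)
lift_definition scaleR_linop :: "real \<Rightarrow> ('a, 'b) linop \<Rightarrow> ('a, 'b) linop"
  is "\<lambda>c f x. c *\<^sub>R f x" by (rule linear_compose_scale_right)

instance
  by standard (transfer; auto simp: algebra_simps)+

end

lemmas app_simps [simp] =
  zero_linop.rep_eq plus_linop.rep_eq uminus_linop.rep_eq minus_linop.rep_eq scaleR_linop.rep_eq

instantiation linop :: (euclidean_space, euclidean_space) real_inner
begin

definition inner_linop :: "('a, 'b) linop \<Rightarrow> ('a, 'b) linop \<Rightarrow> real"
  where "inner_linop E F = (\<Sum>b\<in>Basis. app E b \<bullet> app F b)"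
definition norm_linop :: "('a, 'b) linop \<Rightarrow> real"
  where "norm_linop E = sqrt (E \<bullet> E)"
definition sgn_linop :: "('a, 'b) linop \<Rightarrow> ('a, 'b) linop"
  where "sgn_linop E = E /\<^sub>R norm E"
definition dist_linop :: "('a, 'b) linop \<Rightarrow> ('a, 'b) linop \<Rightarrow> real"
  where "dist_linop E F = norm (E - F)"
definition uniformity_linop :: "(('a, 'b) linop \<times> ('a, 'b) linop) filter"
  where "uniformity_linop = (INF e\<in>{0<..}. principal {(E, F). dist E F < e})"
definition open_linop :: "('a, 'b) linop set \<Rightarrow> bool"
  where "open_linop U \<longleftrightarrow> (\<forall>E\<in>U. \<forall>\<^sub>F (E', F) in uniformity. E' = E \<longrightarrow> F \<in> U)"

instance
proof
  fix r :: real and E F G :: "('a, 'b) linop"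
  show "E \<bullet> F = F \<bullet> E"
    by (simp add: inner_linop_def inner_commute)
  show "(E + F) \<bullet> G = E \<bullet> G + F \<bullet> G"
    by (simp add: inner_linop_def inner_add_left sum.distrib)
  show "(r *\<^sub>R E) \<bullet> F = r * (E \<bullet> F)"
    by (simp add: inner_linop_def sum_distrib_left)
  show "0 \<le> E \<bullet> E"
    by (simp add: inner_linop_def sum_nonneg)
  have "E = 0" if "\<And>b. b \<in> Basis \<Longrightarrow> app E b = 0"
    using linear_eq_stdbasis[OF linear_app linear_zero, of E] that by (intro linop_eqI) auto
  then show "E \<bullet> E = 0 \<longleftrightarrow> E = 0"
    by (auto simp: inner_linop_def sum_nonneg_eq_0_iff)
qed (simp_all add: norm_linop_def sgn_linop_def dist_linop_def uniformity_linop_def open_linop_def)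

end

lift_definition elem_linop :: "'a::euclidean_space \<Rightarrow> 'b::euclidean_space \<Rightarrow> ('a, 'b) linop"
  is "\<lambda>a b x. (x \<bullet> a) *\<^sub>R b"
  by (rule linearI) (simp_all add: inner_add_left scaleR_add_left)

lemma inner_elem_linop:
  assumes "a \<in> Basis"
  shows "E \<bullet> elem_linop a b = app E a \<bullet> b"
proof -
  have "E \<bullet> elem_linop a b = (\<Sum>c\<in>Basis. if c = a then app E a \<bullet> b else 0)"
    unfolding inner_linop_def elem_linop.rep_eq
    using assms by (intro sum.cong) (auto simp: inner_Basis)
  then show ?thesis
    using assms by simp
qed

instantiation linop :: (euclidean_space, euclidean_space) euclidean_space
begin

definition Basis_linop :: "('a, 'b) linop set"
  where "Basis_linop = (\<lambda>(a, b). elem_linop a b) ` (Basis \<times> Basis)"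

instance
proof
  show "(Basis :: ('a, 'b) linop set) \<noteq> {}"
    by (simp add: Basis_linop_def)
  show "finite (Basis :: ('a, 'b) linop set)"
    by (simp add: Basis_linop_def)
next
  fix u v :: "('a, 'b) linop"
  assume "u \<in> Basis" "v \<in> Basis"
  then obtain a b c d where ab: "u = elem_linop a b" "a \<in> Basis" "b \<in> Basis"
    and cd: "v = elem_linop c d" "c \<in> Basis" "d \<in> Basis"
    by (auto simp: Basis_linop_def)
  have uv: "u \<bullet> v = (if a = c \<and> b = d then 1 else 0)"
    using ab cd by (auto simp: inner_elem_linop elem_linop.rep_eq inner_Basis)
  have vv: "v \<bullet> v = 1"
    using cd by (simp add: inner_elem_linop elem_linop.rep_eq)
  show "u \<bullet> v = (if u = v then 1 else 0)"
    using uv vv ab cd by auto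
next
  fix E :: "('a, 'b) linop"
  have "E = 0" if "\<forall>u\<in>Basis. E \<bullet> u = 0"
  proof -
    have "app E a \<bullet> b = 0" if "a \<in> Basis" "b \<in> Basis" for a b
      using \<open>\<forall>u\<in>Basis. E \<bullet> u = 0\<close> that by (force simp: Basis_linop_def inner_elem_linop)
    then have "app E a = 0" if "a \<in> Basis" for a
      using that euclidean_all_zero_iff by blast
    then show ?thesis
      using linear_eq_stdbasis[OF linear_app linear_zero, of E] by (intro linop_eqI) auto
  qed
  then show "(\<forall>u\<in>Basis. E \<bullet> u = 0) \<longleftrightarrow> E = 0"
    by auto
qed

end

text \<open>
  \<^term>\<open>Linop f\<close> packages a linear function \<^term>\<open>f\<close> as an element of this space; it is unspecified
  on nonlinear functions and is only applied to linear ones below.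
\<close>

lemma app_Linop: "linear f \<Longrightarrow> app (Linop f) = f"
  by (simp add: Linop_inverse)

type_synonym 'q mat = "real^'q^'q"

definition proj :: "'a::euclidean_space set \<Rightarrow> 'a \<Rightarrow> 'a"
  where "proj V x = (THE p. p \<in> V \<and> x - p \<in> V\<^sup>\<bottom>)"

lemma proj_unique:
  assumes "subspace V" "p \<in> V" "x - p \<in> V\<^sup>\<bottom>"
  shows "proj V x = p"
  unfolding proj_def
proof (rule the_equality)
  fix p' assume p': "p' \<in> V \<and> x - p' \<in> V\<^sup>\<bottom>"
  then have "p' - p \<in> V"
    using assms subspace_diff by blast
  moreover have "(x - p) - (x - p') \<in> V\<^sup>\<bottom>"
    using assms p' subspace_orthogonal_comp subspace_diff by blast
  ultimately have "(p' - p) \<bullet> (p' - p) = 0"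
    by (simp add: orthogonal_comp_def orthogonal_def)
  then show "p' = p"
    by simp
qed (use assms in blast)

lemma
  assumes "subspace V"
  shows proj_in: "proj V x \<in> V" and proj_orthogonal: "x - proj V x \<in> V\<^sup>\<bottom>"
proof -
  have V: "span V = V"
    using assms by (simp add: span_eq_iff)
  obtain y z where "y \<in> span V" "\<And>w. w \<in> span V \<Longrightarrow> orthogonal z w" "x = y + z"
    using orthogonal_subspace_decomp_exists by blast
  then have "y \<in> V" "x - y \<in> V\<^sup>\<bottom>"
    unfolding V by (auto simp: orthogonal_comp_def orthogonal_def inner_commute)
  then show "proj V x \<in> V" "x - proj V x \<in> V\<^sup>\<bottom>"
    using proj_unique[OF assms] by auto
qed

definition eigenvalues :: "('a::real_vector \<Rightarrow> 'a) \<Rightarrow> real set"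
  where "eigenvalues f = {c. \<exists>v. v \<noteq> 0 \<and> f v = c *\<^sub>R v}"

text \<open>
  Singular values are the square roots of the eigenvalues of $A'A$, repeated according to the
  dimension of the eigenspace. \<^term>\<open>k\<close> is counted from 1.
\<close>

definition sv_mult :: "('q::finite) mat \<Rightarrow> real \<Rightarrow> nat"
  where "sv_mult A s = dim {v. (transpose A ** A) *v v = s\<^sup>2 *\<^sub>R v}"

definition singular_values :: "('q::finite) mat \<Rightarrow> real multiset"
  where "singular_values A = (\<Sum>s\<in>{s. 0 \<le> s \<and> 0 < sv_mult A s}. replicate_mset (sv_mult A s) s)"

definition sing_val :: "nat \<Rightarrow> ('q::finite) mat \<Rightarrow> real"
  where "sing_val k A = rev (sorted_list_of_multiset (singular_values A)) ! (k - 1)"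

definition pos_def :: "('q::finite) mat \<Rightarrow> bool"
  where "pos_def P \<longleftrightarrow> transpose P = P \<and> (\<forall>x. x \<noteq> 0 \<longrightarrow> 0 < x \<bullet> (P *v x))"

text \<open>
  On \<^typ>\<open>'q mat\<close> the library inner product is the trace inner product and the library norm is
  the Frobenius norm.
\<close>

lemma inner_eq_trace: "A \<bullet> B = trace (transpose A ** B)" for A B :: "('q::finite) mat"
proof -
  have "A \<bullet> B = (\<Sum>i\<in>UNIV. \<Sum>j\<in>UNIV. A $ i $ j * B $ i $ j)"
    by (simp add: inner_vec_def)
  also have "\<dots> = (\<Sum>j\<in>UNIV. \<Sum>i\<in>UNIV. A $ i $ j * B $ i $ j)"
    by (rule sum.swap)
  finally show ?thesis
    by (simp add: trace_def matrix_matrix_mult_def transpose_def)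
qed

definition boxtimes :: "'a::euclidean_space \<Rightarrow> 'a \<Rightarrow> 'a \<Rightarrow> 'a"
  where "boxtimes A B = (\<lambda>X. (B \<bullet> X) *\<^sub>R A)"

text \<open>A collection of $n$ matrices is given by the values of a sequence at $1, \dots, n$.\<close>

definition covariance :: "nat \<Rightarrow> (nat \<Rightarrow> ('q::finite) mat) \<Rightarrow> 'q mat \<Rightarrow> 'q mat"
  where "covariance n X = (\<lambda>Y. (1 / real n) *\<^sub>R (\<Sum>j=1..n. boxtimes (X j) (X j) Y))"

definition Lambda :: "nat \<Rightarrow> (nat \<Rightarrow> ('q::finite) mat) \<Rightarrow> real"
  where "Lambda n X = (Max (eigenvalues (covariance n X)) + Min (eigenvalues (covariance n X))) / 2"

definition Delta :: "nat \<Rightarrow> (nat \<Rightarrow> ('q::finite) mat) \<Rightarrow> real"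
  where "Delta n X = (Max (eigenvalues (covariance n X)) - Min (eigenvalues (covariance n X))) / 2"

definition tangent_space :: "('q::finite) mat \<Rightarrow> 'q mat set"
  where "tangent_space X = {X ** A + B ** X | A B. True}"

text \<open>
  Kronecker products act as $(A \otimes B)(X) = B X A'$, both for matrices acting on matrices
  and for linear operators acting on operators.
\<close>

definition mat_kron :: "('q::finite) mat \<Rightarrow> 'q mat \<Rightarrow> 'q mat \<Rightarrow> 'q mat"
  where "mat_kron A B = (\<lambda>X. B ** X ** transpose A)"

definition op_kron ::
    "('a::euclidean_space \<Rightarrow> 'a) \<Rightarrow> ('a \<Rightarrow> 'a) \<Rightarrow> ('a, 'a) linop \<Rightarrow> ('a, 'a) linop"
  where "op_kron A B = (\<lambda>E. Linop (B \<circ> app E \<circ> adjoint A))"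

definition W_space :: "(('q::finite) mat, 'q mat) linop set"
  where "W_space =
    span {Linop (\<lambda>X. mat_kron (mat 1) W\<^sub>1 X + mat_kron W\<^sub>2 (mat 1) X) | W\<^sub>1 W\<^sub>2. True}"

definition Omega :: "nat \<Rightarrow> (nat \<Rightarrow> ('q::finite) mat) \<Rightarrow> real"
  where "Omega n X = onorm (proj (W_space\<^sup>\<bottom>) \<circ>
    (\<lambda>E. (1 / real n) *\<^sub>R (\<Sum>j=1..n. op_kron (boxtimes (X j) (X j)) (proj (tangent_space (X j))) E)))"

text \<open>The smallest restricted isometry constant; the infimum is attained for \<open>k \<ge> 1\<close>.\<close>

definition rip_const :: "nat \<Rightarrow> (('q::finite) mat \<Rightarrow> real^'d::finite) \<Rightarrow> real"
  where "rip_const k L = Inf {\<delta>. \<forall>X. X \<noteq> 0 \<and> rank X \<le> k \<longrightarrow>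
    1 - \<delta> \<le> (norm (L X))\<^sup>2 / (norm X)\<^sup>2 \<and> (norm (L X))\<^sup>2 / (norm X)\<^sup>2 \<le> 1 + \<delta>}"

definition component :: "(('q::finite) mat \<Rightarrow> real^'d::finite) \<Rightarrow> 'd \<Rightarrow> 'q mat"
  where "component L i = (THE A. \<forall>X. L X $ i = A \<bullet> X)"

lemma component_eq_adjoint:
  assumes "linear L"
  shows "component L i = adjoint L (axis i 1)"
  unfolding component_def
proof (rule the_equality)
  show *: "\<forall>X. L X $ i = adjoint L (axis i 1) \<bullet> X"
    using adjoint_clauses(2)[OF assms] by (simp add: inner_axis')
  show "A = adjoint L (axis i 1)" if "\<forall>X. L X $ i = A \<bullet> X" for A
    using that * by (metis vector_eq_rdot inner_commute)
qed

lemma component_inner: "linear L \<Longrightarrow> L X $ i = component L i \<bullet> X"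
  by (simp add: component_eq_adjoint adjoint_clauses(2) inner_axis')

definition normalized :: "(('q::finite) mat \<Rightarrow> real^'d::finite) \<Rightarrow> bool"
  where "normalized L \<longleftrightarrow>
    (\<Sum>i\<in>UNIV. component L i ** transpose (component L i)) = real CARD('q) *\<^sub>R mat 1 \<and>
    (\<Sum>i\<in>UNIV. transpose (component L i) ** component L i) = real CARD('q) *\<^sub>R mat 1"

definition rank_preserver :: "(('q::finite) mat \<Rightarrow> 'q mat) \<Rightarrow> bool"
  where "rank_preserver M \<longleftrightarrow> linear M \<and> (\<forall>X. rank (M X) = rank X)"

definition pd_rank_preserver :: "(('q::finite) mat \<Rightarrow> 'q mat) \<Rightarrow> bool"
  where "pd_rank_preserver M \<longleftrightarrow> rank_preserver M \<and>
    (\<exists>P\<^sub>1 P\<^sub>2. pos_def P\<^sub>1 \<and> pos_def P\<^sub>2 \<and> M = (\<lambda>X. P\<^sub>1 ** X ** P\<^sub>2))"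

text \<open>
  For surjective \<open>Lstar\<close> and linear \<open>L\<close> the infimum is over a nonempty set: take \<open>M\<close> to be the
  identity.
\<close>

definition xi ::
    "(('q::finite) mat \<Rightarrow> real^'d::finite) \<Rightarrow> ('q mat \<Rightarrow> real^'d) \<Rightarrow> real"
  where "xi Lstar L = Inf {norm E | E :: ('q mat, 'q mat) linop.
    \<exists>M. rank_preserver M \<and> L = Lstar \<circ> (\<lambda>X. X + app E X) \<circ> M}"

text \<open>
  The three steps are specified by the outputs they are required to deliver, so one iteration is
  a relation between successive linear maps: any minimizers and any normalizing positive-definite
  rank-preserver are admitted.
\<close>

definition low_rank_fit ::
    "nat \<Rightarrow> (('q::finite) mat \<Rightarrow> real^'d::finite) \<Rightarrow> real^'d \<Rightarrow> 'q mat \<Rightarrow> bool"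
  where "low_rank_fit r L y Xhat \<longleftrightarrow> rank Xhat \<le> r \<and>
    (\<forall>X. rank X \<le> r \<longrightarrow> (norm (y - L Xhat))\<^sup>2 \<le> (norm (y - L X))\<^sup>2)"

definition least_squares_fit ::
    "nat \<Rightarrow> (nat \<Rightarrow> real^'d::finite) \<Rightarrow> (nat \<Rightarrow> ('q::finite) mat) \<Rightarrow> ('q mat \<Rightarrow> real^'d) \<Rightarrow> bool"
  where "least_squares_fit n y Xhat L \<longleftrightarrow> linear L \<and>
    (\<forall>L'. linear L' \<longrightarrow>
      (\<Sum>j=1..n. (norm (y j - L (Xhat j)))\<^sup>2) \<le> (\<Sum>j=1..n. (norm (y j - L' (Xhat j)))\<^sup>2))"

definition alternating_update_step ::
    "nat \<Rightarrow> nat \<Rightarrow> (nat \<Rightarrow> real^'d::finite) \<Rightarrow>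
     (('q::finite) mat \<Rightarrow> real^'d) \<Rightarrow> ('q mat \<Rightarrow> real^'d) \<Rightarrow> bool"
  where "alternating_update_step n r y L L_next \<longleftrightarrow>
    (\<exists>Xhat Ltilde N.
      (\<forall>j\<in>{1..n}. low_rank_fit r L (y j) (Xhat j)) \<and>
      least_squares_fit n y Xhat Ltilde \<and>
      pd_rank_preserver N \<and> normalized (Ltilde \<circ> N) \<and>
      L_next = Ltilde \<circ> N)"

end

theory Submission
  imports Defs
begin

text \<open>
  Write \<open>L\<close> for the true map. If the current map is \<open>(L + G) \<circ> M\<close> with a rank preserver \<open>M\<close>, then
  \<open>M\<close> can be moved into the fitted matrices: both minimization problems become those for \<open>L + G\<close>,
  and the next map is \<open>(L + G') \<circ> M'\<close> with another rank preserver \<open>M'\<close>. So the state of the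
  algorithm is the operator \<open>G\<close>, measured in the Hilbert--Schmidt norm.

  To first order a fit moves away from \<open>X j\<close> by the tangent vector whose image under \<open>L\<close> cancels
  \<open>\<Pi> j (G (X j))\<close>, where \<open>\<Pi> j\<close> projects onto the image under \<open>L\<close> of the tangent space at \<open>X j\<close>
  (\<open>fit_first_order\<close>). The normal equations of the least squares problem then give
  \<open>G' = T G + O(\<bar>G\<bar>\<^sup>2)\<close> (\<open>least_squares_first_order\<close>), where \<open>T\<close> is defined by
  \<open>B (T G) H = mean of (\<Pi> j (G (X j)) \<bullet> H (X j))\<close> and \<open>B G H = mean of (G (X j) \<bullet> H (X j))\<close>.
  For the form \<open>B\<close> this \<open>T\<close> is self-adjoint and positive semidefinite. It fixes the directions
  \<open>L \<circ> w\<close> with \<open>w\<close> in \<open>W_space\<close>, but those are tangent to the orbit of \<open>L\<close> under rank preservers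
  and are removed, up to second order, by changing \<open>M'\<close> (\<open>absorb_W_space\<close>). On the \<open>B\<close>-orthogonal
  complement of these directions the Rayleigh quotient of \<open>T\<close> is at most the rate in the theorem
  (\<open>energy_le_rate\<close>): there \<open>L' \<circ> G\<close> is nearly orthogonal to \<open>W_space\<close>, the restricted isometry
  compares \<open>\<Pi> j\<close> with the projection onto the tangent space, and what is left is the quadratic form
  that \<open>Omega\<close> bounds. This gives a contraction of \<open>G\<close> from the initial ball on
  (\<open>step_contraction\<close>), hence convergence.

  The limit of the ratios needs more, since \<open>xi\<close> is measured in a norm for which \<open>T\<close> need not
  contract at that rate. But the iteration is a perturbed power iteration with a self-adjoint
  operator: the Rayleigh quotients increase up to an error tending to zero, cannot descend through a
  value that is not an eigenvalue, and therefore converge to an eigenvalue \<open>\<rho>\<close>; consecutive iterates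
  differ asymptotically by the factor \<open>\<rho>\<close>, in every norm at once (\<open>power_iteration\<close>). To apply this,
  one takes nearly optimal representatives of the iterates in the definition of \<open>xi\<close>. Two
  representatives of the same map agree modulo \<open>L \<circ> W_space\<close> up to second order
  (\<open>equivalent_maps_agree_mod_W_space\<close>), because the \<open>2 \<times> 2\<close> minors of images of rank-one matrices
  force a rank preserver near the identity to be \<open>1 + w\<close> with \<open>w\<close> close to \<open>W_space\<close>.
\<close>

section \<open>Orthogonal projections and Hilbert--Schmidt norms\<close>

lemma proj_inner:
  assumes "subspace V" "v \<in> V"
  shows "proj V x \<bullet> v = x \<bullet> v"
  using proj_orthogonal[OF assms(1), of x] assms(2)
  by (auto simp: orthogonal_comp_def orthogonal_def inner_diff_left inner_diff_right inner_commute)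

lemma proj_of_mem: "subspace V \<Longrightarrow> v \<in> V \<Longrightarrow> proj V v = v"
  by (intro proj_unique) (auto intro: subspace_0[OF subspace_orthogonal_comp])

lemma linear_proj:
  assumes "subspace V" shows "linear (proj V)"
proof (rule linearI)
  note m = proj_in[OF assms] proj_orthogonal[OF assms]
  fix x y :: 'a and c :: real
  have "(x - proj V x) + (y - proj V y) \<in> V\<^sup>\<bottom>"
    by (intro subspace_add subspace_orthogonal_comp m)
  then show "proj V (x + y) = proj V x + proj V y"
    by (intro proj_unique assms subspace_add m) (simp add: algebra_simps)
  have "c *\<^sub>R (x - proj V x) \<in> V\<^sup>\<bottom>"
    by (intro subspace_scale subspace_orthogonal_comp m)
  then show "proj V (c *\<^sub>R x) = c *\<^sub>R proj V x"
    by (intro proj_unique assms subspace_scale m) (simp add: algebra_simps)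
qed

lemma proj_inner_proj: "subspace V \<Longrightarrow> proj V x \<bullet> proj V y = x \<bullet> proj V y"
  by (simp add: proj_inner proj_in)

lemma proj_inner_commute: "subspace V \<Longrightarrow> proj V x \<bullet> y = x \<bullet> proj V y"
  by (metis proj_inner_proj inner_commute)

lemma norm_proj_pythagoras:
  assumes "subspace V"
  shows "(norm x)\<^sup>2 = (norm (proj V x))\<^sup>2 + (norm (x - proj V x))\<^sup>2"
proof -
  have "proj V x \<bullet> (x - proj V x) = 0"
    using proj_inner_proj[OF assms, of x x] by (simp add: inner_diff_right inner_commute)
  then have "(norm (proj V x + (x - proj V x)))\<^sup>2 = (norm (proj V x))\<^sup>2 + (norm (x - proj V x))\<^sup>2"
    by (simp only: power2_norm_eq_inner inner_add_left inner_add_right) (simp add: inner_commute)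
  then show ?thesis by simp
qed

lemma norm_proj_le: "subspace V \<Longrightarrow> norm (proj V x) \<le> norm x"
  by (rule power2_le_imp_le) (auto simp: norm_proj_pythagoras[of V x])

lemma norm_diff_proj_le: "subspace V \<Longrightarrow> norm (x - proj V x) \<le> norm x"
  by (rule power2_le_imp_le) (auto simp: norm_proj_pythagoras[of V x])

lemma norm_linop_square: "(norm E)\<^sup>2 = (\<Sum>b\<in>Basis. (norm (app E b))\<^sup>2)"
  by (simp add: power2_norm_eq_inner inner_linop_def)

lemma app_expansion: "app E x = (\<Sum>b\<in>Basis. (x \<bullet> b) *\<^sub>R app E b)"
proof -
  have "app E x = app E (\<Sum>b\<in>Basis. (x \<bullet> b) *\<^sub>R b)" by (simp add: euclidean_representation)
  then show ?thesis by (simp only: linear_sum[OF linear_app] linear_cmul[OF linear_app])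
qed

lemma norm_square_Basis: "(norm v)\<^sup>2 = (\<Sum>b\<in>Basis. (v \<bullet> b)\<^sup>2)"
  unfolding power2_norm_eq_inner by (subst euclidean_inner) (simp add: power2_eq_square)

lemma norm_app_le: "norm (app E x) \<le> norm E * norm x"
proof -
  have "norm (app E x) \<le> (\<Sum>b\<in>Basis. \<bar>x \<bullet> b\<bar> * norm (app E b))"
    unfolding app_expansion[of E x] by (rule order_trans[OF norm_sum]) simp
  also have "\<dots> \<le> sqrt ((\<Sum>b\<in>Basis. \<bar>x \<bullet> b\<bar>\<^sup>2) * (\<Sum>b\<in>Basis. (norm (app E b))\<^sup>2))"
    by (intro real_le_rsqrt Cauchy_Schwarz_ineq_sum)
  also have "(\<Sum>b\<in>Basis. \<bar>x \<bullet> b\<bar>\<^sup>2) = (norm x)\<^sup>2"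
    by (simp add: norm_square_Basis[of x])
  finally show ?thesis
    unfolding norm_linop_square[symmetric] by (simp add: real_sqrt_mult mult.commute)
qed

lemma bounded_linear_app: "bounded_linear (app E)"
  using linear_app linear_conv_bounded_linear by blast

definition lcomp :: "('b::euclidean_space, 'c::euclidean_space) linop \<Rightarrow> ('a::euclidean_space, 'b) linop \<Rightarrow> ('a, 'c) linop"
  where "lcomp A B = Linop (app A \<circ> app B)"

lemma app_lcomp [simp]: "app (lcomp A B) x = app A (app B x)"
  unfolding lcomp_def by (subst app_Linop) (auto intro: linear_compose linear_app)

lemma app_diff_arg: "app E (x - y) = app E x - app E y"
  and app_add_arg: "app E (x + y) = app E x + app E y"
  and app_scale_arg: "app E (c *\<^sub>R x) = c *\<^sub>R app E x"
  and app_zero_arg [simp]: "app E 0 = 0"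
  by (simp_all add: linear_diff linear_add linear_cmul linear_0 linear_app)

lemma linear_lcomp_right: "linear (lcomp A)"
  by (rule linearI; rule linop_eqI) (simp_all add: app_add_arg app_scale_arg)

lemma norm_linop_le:
  assumes "0 \<le> c" "\<And>b. b \<in> Basis \<Longrightarrow> norm (app E b) \<le> c * norm (app F b)"
  shows "norm E \<le> c * norm F"
proof (rule power2_le_imp_le)
  have "(norm E)\<^sup>2 \<le> (\<Sum>b\<in>Basis. (c * norm (app F b))\<^sup>2)"
    unfolding norm_linop_square by (intro sum_mono power_mono assms) auto
  then show "(norm E)\<^sup>2 \<le> (c * norm F)\<^sup>2"
    by (simp add: power_mult_distrib norm_linop_square sum_distrib_left)
qed (use assms in auto)

lemma norm_lcomp_onorm: "norm (lcomp A B) \<le> onorm (app A) * norm B"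
  by (rule norm_linop_le) (auto simp: onorm_pos_le bounded_linear_app intro: onorm)

lemma norm_lcomp_le: "norm (lcomp A B) \<le> norm A * norm B"
  by (rule norm_linop_le) (auto simp: norm_app_le)

lemma norm_linop_le_basis:
  assumes "\<And>b. b \<in> Basis \<Longrightarrow> norm (app E b) \<le> c"
  shows "(norm (E :: ('a::euclidean_space, 'b::euclidean_space) linop))\<^sup>2 \<le> real DIM('a) * (c::real)\<^sup>2"
  unfolding norm_linop_square using assms by (intro sum_bounded_above power_mono) auto

lemma inner_elem_linop_general: "E \<bullet> elem_linop a b = app E a \<bullet> b"
  unfolding inner_linop_def app_expansion[of E a]
  by (simp add: elem_linop.rep_eq inner_sum_left) (simp add: inner_commute)

lemma norm_linop_square_adjoint:
  "(norm (E :: ('a::euclidean_space, 'b::euclidean_space) linop))\<^sup>2 = (\<Sum>c\<in>Basis. (norm (adjoint (app E) c))\<^sup>2)"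
proof -
  have "(norm E)\<^sup>2 = (\<Sum>b\<in>Basis. \<Sum>c\<in>Basis. (app E b \<bullet> c)\<^sup>2)"
    unfolding norm_linop_square by (simp only: norm_square_Basis)
  also have "\<dots> = (\<Sum>c\<in>Basis. \<Sum>b\<in>Basis. (app E b \<bullet> c)\<^sup>2)" by (rule sum.swap)
  also have "\<dots> = (\<Sum>c\<in>Basis. (norm (adjoint (app E) c))\<^sup>2)"
    unfolding norm_square_Basis
    by (intro sum.cong refl) (simp add: adjoint_clauses[OF linear_app] inner_commute)
  finally show ?thesis .
qed

section \<open>Definite bilinear forms\<close>

text \<open>
  The Gram operator of a definite form is injective, hence invertible. Representers and projections
  with respect to the form come from it, so no adapted orthonormal basis is needed.
\<close>

lemma form_isomorphism:
  fixes B :: "'a::euclidean_space \<Rightarrow> 'a \<Rightarrow> real"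
  assumes "bilinear B" "\<And>x. x \<noteq> 0 \<Longrightarrow> B x x > 0"
  obtains S S' where "linear S" "linear S'" "\<And>x y. S x \<bullet> y = B x y" "\<And>x. S (S' x) = x"
proof -
  define S where "S = (\<lambda>x. \<Sum>b\<in>Basis. B x b *\<^sub>R b)"
  have lin: "linear (\<lambda>x. B x y)" "linear (B x)" for x y
    using assms(1) by (auto simp: bilinear_def)
  have "linear S" unfolding S_def
    by (rule linearI) (simp_all add: linear_add[OF lin(1)] linear_cmul[OF lin(1)] sum.distrib
        scaleR_add_left scaleR_sum_right)
  have S: "S x \<bullet> y = B x y" for x y
  proof -
    have "B x y = B x (\<Sum>b\<in>Basis. (y \<bullet> b) *\<^sub>R b)" by (simp add: euclidean_representation)
    then show ?thesis
      by (simp only: linear_sum[OF lin(2)] linear_cmul[OF lin(2)] S_def inner_sum_left)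
        (simp add: inner_commute mult.commute)
  qed
  have "inj S"
    unfolding linear_injective_0[OF \<open>linear S\<close>]
      using S assms(2) by (metis inner_zero_left less_irrefl)
  then obtain S' where S': "linear S'" "S' \<circ> S = id"
    using linear_injective_left_inverse \<open>linear S\<close> by blast
  then have "S \<circ> S' = id" using linear_inverse_left[OF \<open>linear S'\<close> \<open>linear S\<close>] by blast
  then show thesis using that[OF \<open>linear S\<close> \<open>linear S'\<close> S] by (metis comp_apply id_apply)
qed

lemma form_representer:
  fixes B q :: "'a::euclidean_space \<Rightarrow> 'a \<Rightarrow> real"
  assumes "bilinear B" "\<And>x. x \<noteq> 0 \<Longrightarrow> B x x > 0" "bilinear q"
  obtains T where "linear T" "\<And>x y. B (T x) y = q x y"
proof -
  obtain S S' where S: "linear S" "linear S'" "\<And>x y. S x \<bullet> y = B x y" "\<And>x. S (S' x) = x"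
    using form_isomorphism assms by metis
  have lin: "linear (\<lambda>x. q x y)" "linear (q x)" for x y
    using assms(3) by (auto simp: bilinear_def)
  define Q where "Q = (\<lambda>x. \<Sum>b\<in>Basis. q x b *\<^sub>R b)"
  have "linear Q" unfolding Q_def
    by (rule linearI) (simp_all add: linear_add[OF lin(1)] linear_cmul[OF lin(1)] sum.distrib
        scaleR_add_left scaleR_sum_right)
  have Q: "Q x \<bullet> y = q x y" for x y
  proof -
    have "q x y = q x (\<Sum>b\<in>Basis. (y \<bullet> b) *\<^sub>R b)" by (simp add: euclidean_representation)
    then show ?thesis
      by (simp only: linear_sum[OF lin(2)] linear_cmul[OF lin(2)] Q_def inner_sum_left)
        (simp add: inner_commute mult.commute)
  qed
  show thesis
    by (rule that[of "S' \<circ> Q"]) (use S Q linear_compose \<open>linear Q\<close> in \<open>auto simp: S(3)[symmetric]\<close>)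
qed

text \<open>
  The map \<open>g\<close> below is the compression of the Gram operator on \<open>V\<close> and the identity on the orthogonal
  complement; definiteness of the form makes it injective, and solving \<open>g p = proj V (S x)\<close> gives the
  projection.
\<close>

lemma form_projection:
  fixes B :: "'a::euclidean_space \<Rightarrow> 'a \<Rightarrow> real"
  assumes B: "bilinear B" "\<And>x. x \<noteq> 0 \<Longrightarrow> B x x > 0" and V: "subspace V"
  obtains P where "linear P" "\<And>x. P x \<in> V" "\<And>x v. v \<in> V \<Longrightarrow> B (x - P x) v = 0"
proof -
  obtain S S' where S: "linear S" "linear S'" "\<And>x y. S x \<bullet> y = B x y" "\<And>x. S (S' x) = x"
    using form_isomorphism B by metis
  note lp = linear_proj[OF V]
  define g where "g x = proj V (S (proj V x)) + (x - proj V x)" for x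
  have "linear g" unfolding g_def
    by (intro linear_compose_add linear_compose_sub lp linear_ident
        linear_compose[OF lp linear_compose[OF S(1) lp], unfolded o_def])
  have pg: "proj V (g x) = proj V (S (proj V x))" for x
    unfolding g_def by (simp add: linear_add[OF lp] linear_diff[OF lp] proj_of_mem V proj_in)
  have "x = 0" if "g x = 0" for x
  proof -
    have 1: "proj V (S (proj V x)) = 0" using pg[of x] that linear_0[OF lp] by simp
    then have x: "proj V x = x" using that by (simp add: g_def)
    then have "B x x = 0"
      using 1 S(3)[of x x] proj_inner[OF V, of x "S x"] x proj_in[OF V, of x] by simp
    then show "x = 0" using B(2) less_irrefl by metis
  qed
  then have "inj g" using linear_injective_0[OF \<open>linear g\<close>] by blast
  then obtain h where h: "linear h" "h \<circ> g = id"
    using linear_injective_left_inverse \<open>linear g\<close> by blast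
  then have "g \<circ> h = id" using linear_inverse_left[OF \<open>linear h\<close> \<open>linear g\<close>] by blast
  then have gh: "g (h x) = x" for x by (metis comp_apply id_apply)
  define P where "P x = h (proj V (S x))" for x
  have "linear P" unfolding P_def
    by (rule linear_compose[OF linear_compose[OF S(1) lp] h(1), unfolded o_def])
  moreover have PV: "P x \<in> V" for x
  proof -
    have gP: "g (P x) = proj V (S x)" by (simp add: P_def gh)
    then have "proj V (g (P x)) = g (P x)" by (simp add: proj_of_mem V proj_in)
    then have "P x = proj V (P x)" using pg[of "P x"] unfolding g_def by simp
    then show ?thesis using proj_in[OF V] by metis
  qed
  moreover have "B (x - P x) v = 0" if "v \<in> V" for x v
  proof -
    have "proj V (S (P x)) = proj V (S x)"
      using pg[of "P x"] PV[of x] by (simp add: proj_of_mem V proj_in P_def gh)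
    then have "S (P x) \<bullet> v = S x \<bullet> v" using proj_inner[OF V that] by metis
    then show ?thesis by (simp add: S(3)[symmetric] linear_diff[OF S(1)] inner_diff_left)
  qed
  ultimately show thesis using that by blast
qed

text \<open>
  Eigenvectors for different eigenvalues are orthogonal for the form, hence linearly independent.
\<close>

lemma finite_form_eigenvalues:
  fixes B :: "'a::euclidean_space \<Rightarrow> 'a \<Rightarrow> real"
  assumes B: "bilinear B" "\<And>x. x \<noteq> 0 \<Longrightarrow> B x x > 0" and sym: "\<And>x y. B (f x) y = B x (f y)"
  shows "finite (eigenvalues f)"
proof -
  have "\<forall>c\<in>eigenvalues f. \<exists>v. v \<noteq> 0 \<and> f v = c *\<^sub>R v"
    by (simp add: eigenvalues_def)
  then obtain v where v: "\<And>c. c \<in> eigenvalues f \<Longrightarrow> v c \<noteq> 0 \<and> f (v c) = c *\<^sub>R v c"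
    by metis
  have orth: "B (v c) (v d) = 0" if "c \<in> eigenvalues f" "d \<in> eigenvalues f" "c \<noteq> d" for c d
  proof -
    have "c * B (v c) (v d) = d * B (v c) (v d)"
      using sym[of "v c" "v d"] v[OF that(1)] v[OF that(2)]
      by (simp add: bilinear_lmul[OF B(1)] bilinear_rmul[OF B(1)])
    then show ?thesis using that by simp
  qed
  have inj: "inj_on v (eigenvalues f)"
    using orth v B(2) by (metis inj_onI less_irrefl)
  have "independent (v ` eigenvalues f)"
    unfolding real_vector.dependent_explicit
  proof (clarify)
    fix t u w
    assume t: "finite t" "t \<subseteq> v ` eigenvalues f" "(\<Sum>v\<in>t. u v *\<^sub>R v) = 0" "w \<in> t" "u w \<noteq> 0"
    have "linear (\<lambda>x. B x w)" using B(1) by (simp add: bilinear_def)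
    then have "(\<Sum>x\<in>t. u x * B x w) = 0"
      using t(3) linear_sum[of "\<lambda>x. B x w" "\<lambda>x. u x *\<^sub>R x" t] bilinear_lmul[OF B(1)] bilinear_lzero[OF B(1)]
      by simp
    moreover have "(\<Sum>x\<in>t. u x * B x w) = (\<Sum>x\<in>t. if x = w then u w * B w w else 0)"
    proof (intro sum.cong refl)
      fix x assume "x \<in> t"
      then have "x \<in> v ` eigenvalues f" "w \<in> v ` eigenvalues f" using t(2,4) by auto
      then obtain c d where "c \<in> eigenvalues f" "x = v c" "d \<in> eigenvalues f" "w = v d"
        by blast
      then show "u x * B x w = (if x = w then u w * B w w else 0)" using orth[of c d] by auto
    qed
    ultimately have "u w * B w w = 0" using t by simp
    moreover have "w \<noteq> 0" using t v by auto
    ultimately show False using B(2) t(5) by (metis less_irrefl mult_eq_0_iff)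
  qed
  then have "finite (v ` eigenvalues f)" by (rule independent_imp_finite)
  then show ?thesis using inj finite_image_iff by blast
qed

section \<open>Symmetric operators\<close>

lemma bilinear_inner: "bilinear (\<bullet>)"
  by (auto simp: bilinear_def linear_iff inner_add_left inner_add_right)

text \<open>
  The first-order condition behind all stationarity arguments below.
\<close>

lemma quadratic_minimum_zero:
  fixes b c :: real
  assumes "\<And>t. 0 \<le> t * b + t\<^sup>2 * c"
  shows "b = 0"
proof (rule ccontr)
  assume "b \<noteq> 0"
  define m where "m = \<bar>c\<bar> + 1"
  have m: "m > 0" "c \<le> m" by (auto simp: m_def)
  define t where "t = - b / (2 * m)"
  have "t * b + t\<^sup>2 * c \<le> t * b + t\<^sup>2 * m"
    using m by (simp add: mult_left_mono)
  also have "\<dots> = - (b\<^sup>2 / (4 * m))"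
    unfolding t_def using m by (simp add: field_simps power2_eq_square)
  also have "\<dots> < 0" using \<open>b \<noteq> 0\<close> m by (simp add: zero_less_divide_iff)
  finally show False using assms[of t] by simp
qed

text \<open>
  First-order optimality of the Rayleigh quotient within an invariant subspace. The subspace is a
  parameter because the spectral theorem and the smallest positive singular value need proper ones.
\<close>

lemma rayleigh_minimizer:
  fixes f :: "'a::euclidean_space \<Rightarrow> 'a"
  assumes U: "subspace U" "U \<noteq> {0}" and f: "linear f" "f ` U \<subseteq> U" and sym: "\<And>x y. f x \<bullet> y = x \<bullet> f y"
  obtains x c where "x \<in> U" "x \<noteq> 0" "f x = c *\<^sub>R x" "\<And>y. y \<in> U \<Longrightarrow> c * (norm y)\<^sup>2 \<le> f y \<bullet> y"
proof -
  let ?S = "sphere 0 1 \<inter> U"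
  obtain u where u: "u \<in> U" "u \<noteq> 0" using U subspace_0 by blast
  then have ne: "(1 / norm u) *\<^sub>R u \<in> ?S" using U(1) by (auto simp: subspace_scale)
  have "continuous_on ?S (\<lambda>x. f x \<bullet> x)"
    by (intro continuous_intros linear_continuous_on_compose[OF _ f(1)])
  moreover have "compact ?S" by (intro compact_Int_closed closed_subspace U) auto
  ultimately obtain x where x: "x \<in> ?S" "\<And>y. y \<in> ?S \<Longrightarrow> f x \<bullet> x \<le> f y \<bullet> y"
    using continuous_attains_inf[of ?S "\<lambda>x. f x \<bullet> x"] ne by blast
  define c where "c = f x \<bullet> x"
  have low: "c * (norm y)\<^sup>2 \<le> f y \<bullet> y" if "y \<in> U" for y
  proof (cases "y = 0")
    case False
    then have "(1 / norm y) *\<^sub>R y \<in> ?S" using U(1) that by (auto simp: subspace_scale)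
    from x(2)[OF this] False show ?thesis
      by (simp add: c_def linear_cmul[OF f(1)] field_simps power2_eq_square)
  qed (simp add: linear_0[OF f(1)])
  have "(f x - c *\<^sub>R x) \<bullet> y = 0" if "y \<in> U" for y
  proof -
    have "0 \<le> t * (2 * ((f x - c *\<^sub>R x) \<bullet> y)) + t\<^sup>2 * (f y \<bullet> y - c * (y \<bullet> y))" for t
    proof -
      have "x + t *\<^sub>R y \<in> U" using x that U(1) by (simp add: subspace_add subspace_scale)
      from low[OF this] have "0 \<le> f (x + t *\<^sub>R y) \<bullet> (x + t *\<^sub>R y) - c * ((x + t *\<^sub>R y) \<bullet> (x + t *\<^sub>R y))"
        by (simp add: power2_norm_eq_inner)
      also have "\<dots> = (f x \<bullet> x - c * (x \<bullet> x)) + t * (2 * ((f x - c *\<^sub>R x) \<bullet> y)) + t\<^sup>2 * (f y \<bullet> y - c * (y \<bullet> y))"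
        using sym[of y x]
        by (simp add: linear_add[OF f(1)] linear_cmul[OF f(1)] inner_commute algebra_simps power2_eq_square)
      also have "f x \<bullet> x - c * (x \<bullet> x) = 0" using x(1) by (simp add: c_def norm_eq_1)
      finally show ?thesis by simp
    qed
    from quadratic_minimum_zero[OF this] show ?thesis by simp
  qed
  moreover have "f x - c *\<^sub>R x \<in> U" using x f U(1) by (auto simp: subspace_diff subspace_scale)
  ultimately have "f x = c *\<^sub>R x" by (metis inner_eq_zero_iff eq_iff_diff_eq_0)
  moreover have "x \<noteq> 0" using x(1) by auto
  ultimately show thesis using that[of x c] x(1) low by blast
qed

lemma finite_eigenvalues_symmetric:
  assumes "\<And>x y. f x \<bullet> y = x \<bullet> f y"
  shows "finite (eigenvalues (f :: 'a::euclidean_space \<Rightarrow> 'a))"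
  by (rule finite_form_eigenvalues[OF bilinear_inner]) (use assms in auto)

lemma Min_eigenvalues_le:
  fixes f :: "'a::euclidean_space \<Rightarrow> 'a"
  assumes f: "linear f" and sym: "\<And>x y. f x \<bullet> y = x \<bullet> f y"
  shows "Min (eigenvalues f) * (norm y)\<^sup>2 \<le> f y \<bullet> y"
proof -
  have "(UNIV::'a set) \<noteq> {0}" by (rule UNIV_not_singleton)
  then obtain x c where x: "x \<noteq> 0" "f x = c *\<^sub>R x" "\<And>y. c * (norm y)\<^sup>2 \<le> f y \<bullet> y"
    using rayleigh_minimizer[of UNIV f] f sym by (metis UNIV_I subspace_UNIV top_greatest)
  then have "Min (eigenvalues f) \<le> c"
    by (intro Min_le finite_eigenvalues_symmetric sym) (auto simp: eigenvalues_def)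
  then show ?thesis using x(3)[of y] by (meson mult_right_mono order_trans zero_le_power2)
qed

lemma Max_eigenvalues_ge:
  fixes f :: "'a::euclidean_space \<Rightarrow> 'a"
  assumes f: "linear f" and sym: "\<And>x y. f x \<bullet> y = x \<bullet> f y"
  shows "f y \<bullet> y \<le> Max (eigenvalues f) * (norm y)\<^sup>2"
proof -
  have "(UNIV::'a set) \<noteq> {0}" by (rule UNIV_not_singleton)
  moreover have "linear (\<lambda>x. - f x)" "\<And>x y. (- f x) \<bullet> y = x \<bullet> (- f y)"
    using f sym linear_compose_neg by auto
  ultimately obtain x c where x: "x \<noteq> 0" "- f x = c *\<^sub>R x" "\<And>y. c * (norm y)\<^sup>2 \<le> (- f y) \<bullet> y"
    using rayleigh_minimizer[of UNIV "\<lambda>x. - f x"] by (metis UNIV_I subspace_UNIV top_greatest)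
  then have "f x = (- c) *\<^sub>R x" by (metis minus_equation_iff scaleR_minus_left)
  then have "- c \<le> Max (eigenvalues f)"
    using x(1) by (intro Max_ge finite_eigenvalues_symmetric sym) (auto simp: eigenvalues_def)
  moreover have "f y \<bullet> y \<le> (- c) * (norm y)\<^sup>2" using x(3)[of y] by simp
  ultimately show ?thesis by (meson mult_right_mono order_trans zero_le_power2)
qed

text \<open>
  Otherwise the orthogonal complement of all eigenvectors would be a nonzero invariant subspace and
  contain one more eigenvector.
\<close>

lemma span_eigenvectors:
  fixes f :: "'a::euclidean_space \<Rightarrow> 'a"
  assumes f: "linear f" and sym: "\<And>x y. f x \<bullet> y = x \<bullet> f y"
  shows "span (\<Union>c\<in>eigenvalues f. {v. f v = c *\<^sub>R v}) = UNIV"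
proof (rule ccontr)
  let ?E = "\<Union>c\<in>eigenvalues f. {v. f v = c *\<^sub>R v}"
  let ?U = "(span ?E)\<^sup>\<bottom>"
  assume "span ?E \<noteq> UNIV"
  then obtain y where "y \<notin> span ?E" by blast
  moreover have "proj (span ?E) y \<in> span ?E" by (intro proj_in subspace_span)
  ultimately have "y - proj (span ?E) y \<noteq> 0" by (metis eq_iff_diff_eq_0)
  then have ne: "?U \<noteq> {0}" using proj_orthogonal[OF subspace_span, of y ?E] by (metis singletonD)
  have inv: "f ` ?U \<subseteq> ?U"
  proof safe
    fix u assume u: "u \<in> ?U"
    have "w \<bullet> f u = 0" if "w \<in> span ?E" for w
      using that
    proof (induction rule: span_induct)
      case base
      show ?case by (simp add: subspace_def inner_add_left)
    next
      case (step w)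
      then obtain c where "f w = c *\<^sub>R w" by auto
      moreover have "w \<bullet> u = 0" using u step
        by (auto simp: orthogonal_comp_def orthogonal_def span_base)
      ultimately show ?case using sym[of w u] by simp
    qed
    then show "f u \<in> ?U" by (auto simp: orthogonal_comp_def orthogonal_def)
  qed
  obtain x c where x: "x \<in> ?U" "x \<noteq> 0" "f x = c *\<^sub>R x"
    by (rule rayleigh_minimizer[OF subspace_orthogonal_comp ne f inv sym])
  then have "x \<in> ?E" by (auto simp: eigenvalues_def)
  then have "x \<bullet> x = 0" using x(1) by (auto simp: orthogonal_comp_def orthogonal_def span_base)
  with x show False by simp
qed

lemma dim_Union_eigenspaces:
  fixes f :: "'a::euclidean_space \<Rightarrow> 'a"
  assumes sym: "\<And>x y. f x \<bullet> y = x \<bullet> f y" and "finite C"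
  shows "dim (\<Union>c\<in>C. {v. f v = c *\<^sub>R v}) = (\<Sum>c\<in>C. dim {v. f v = c *\<^sub>R v})"
  using \<open>finite C\<close>
proof induction
  case (insert d C)
  have "x \<bullet> y = 0" if "x \<in> {v. f v = d *\<^sub>R v}" "y \<in> (\<Union>c\<in>C. {v. f v = c *\<^sub>R v})" for x y
  proof -
    from that(2) obtain c where c: "c \<in> C" "f y = c *\<^sub>R y" by blast
    then have "d * (x \<bullet> y) = c * (x \<bullet> y)" using sym[of x y] that by simp
    then show ?thesis using c insert by auto
  qed
  then show ?case
    using insert dim_orthogonal_sum[of "{v. f v = d *\<^sub>R v}" "\<Union>c\<in>C. {v. f v = c *\<^sub>R v}"]
    by simp
qed simp

lemma sum_dim_eigenspaces:
  fixes f :: "'a::euclidean_space \<Rightarrow> 'a"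
  assumes f: "linear f" and sym: "\<And>x y. f x \<bullet> y = x \<bullet> f y"
  shows "(\<Sum>c\<in>eigenvalues f. dim {v. f v = c *\<^sub>R v}) = DIM('a)"
proof -
  have "dim (span (\<Union>c\<in>eigenvalues f. {v. f v = c *\<^sub>R v})) = DIM('a)"
    unfolding span_eigenvectors[OF f sym] by (rule dim_UNIV)
  then show ?thesis
    using dim_Union_eigenspaces[OF sym finite_eigenvalues_symmetric[OF sym]] by simp
qed

section \<open>Matrices: rank, Frobenius norm, singular values\<close>

lemma norm_matrix_square: "(norm A)\<^sup>2 = (\<Sum>i\<in>UNIV. \<Sum>j\<in>UNIV. (A $ i $ j)\<^sup>2)"
  for A :: "real^'n^'m"
  unfolding power2_norm_eq_inner inner_vec_def by (simp add: power2_eq_square)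

lemma norm_transpose_matrix [simp]: "norm (transpose A) = norm A" for A :: "real^'n^'m"
proof -
  have "(norm (transpose A))\<^sup>2 = (norm A)\<^sup>2"
    unfolding norm_matrix_square transpose_def by (subst sum.swap) simp
  then show ?thesis by simp
qed

lemma norm_matrix_square_columns: "(norm A)\<^sup>2 = (\<Sum>k\<in>UNIV. (norm (A *v axis k 1))\<^sup>2)"
  for A :: "real^'n^'m"
  unfolding norm_matrix_square matrix_vector_mult_basis
  unfolding power2_norm_eq_inner inner_vec_def
  by (subst sum.swap) (simp add: column_def power2_eq_square)

lemma norm_matrix_vector_le: "norm (A *v x) \<le> norm A * norm x" for A :: "real^'n^'m"
proof (rule power2_le_imp_le)
  have "(norm (A *v x))\<^sup>2 = (\<Sum>i\<in>UNIV. (A $ i \<bullet> x)\<^sup>2)"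
    unfolding power2_norm_eq_inner inner_vec_def[of "A *v x"]
    by (simp add: matrix_vector_mul_component power2_eq_square)
  also have "\<dots> \<le> (\<Sum>i\<in>UNIV. (norm (A $ i))\<^sup>2 * (norm x)\<^sup>2)"
    by (intro sum_mono) (metis Cauchy_Schwarz_ineq2 abs_ge_zero power2_abs power_mono power_mult_distrib)
  also have "\<dots> = (norm A * norm x)\<^sup>2"
    by (simp add: power2_norm_eq_inner[of A] inner_vec_def[of A] power_mult_distrib
        sum_distrib_right[symmetric] power2_norm_eq_inner)
  finally show "(norm (A *v x))\<^sup>2 \<le> (norm A * norm x)\<^sup>2" .
qed simp

lemma norm_matrix_mult_le_left:
  fixes A :: "real^'n^'m" and B :: "real^'k^'n"
  assumes "0 \<le> c" "\<And>x. norm (A *v x) \<le> c * norm x"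
  shows "norm (A ** B) \<le> c * norm B"
proof (rule power2_le_imp_le)
  have "(norm (A ** B))\<^sup>2 = (\<Sum>k\<in>UNIV. (norm (A *v (B *v axis k 1)))\<^sup>2)"
    by (simp add: norm_matrix_square_columns matrix_vector_mul_assoc)
  also have "\<dots> \<le> (\<Sum>k\<in>UNIV. c\<^sup>2 * (norm (B *v axis k 1))\<^sup>2)"
    by (intro sum_mono) (metis assms norm_ge_zero power_mono power_mult_distrib)
  also have "\<dots> = (c * norm B)\<^sup>2"
    by (simp add: power_mult_distrib norm_matrix_square_columns[of B] sum_distrib_left)
  finally show "(norm (A ** B))\<^sup>2 \<le> (c * norm B)\<^sup>2" .
qed (use assms in auto)

lemma norm_matrix_mult_le: "norm (A ** B) \<le> norm A * norm B"
  for A :: "real^'n^'m" and B :: "real^'k^'n"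
  by (rule norm_matrix_mult_le_left) (auto simp: norm_matrix_vector_le)

lemma rank_nullity: "dim {x. A *v x = 0} + rank A = CARD('n)" for A :: "real^'n^'m"
proof -
  have "{y \<in> UNIV. \<forall>x\<in>span (rows A). orthogonal x y} = {x. A *v x = 0}"
  proof (safe)
    fix x assume x: "\<forall>y\<in>span (rows A). orthogonal y x"
    have "row i A \<bullet> x = 0" for i
      using x span_base[of "row i A" "rows A"] by (auto simp: rows_def orthogonal_def)
    then show "A *v x = 0"
      by (simp add: vec_eq_iff matrix_vector_mul_component row_def vec_lambda_eta)
  next
    fix x y assume "A *v x = 0" "y \<in> span (rows A)"
    then show "orthogonal y x" using orthogonal_nullspace_rowspace orthogonal_commute by blast
  qed simp
  then show ?thesis
    using dim_subspace_orthogonal_to_vectors[of "span (rows A)" "UNIV :: (real^'n) set"]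
    by (simp add: row_rank_def)
qed

lemma rank_add_le: "rank (A + B) \<le> rank A + rank B" for A B :: "real^'n^'m"
proof -
  let ?S = "{x + y | x y. x \<in> range ((*v) A) \<and> y \<in> range ((*v) B)}"
  have "range ((*v) (A + B)) \<subseteq> ?S"
    by (auto simp: matrix_vector_mult_add_rdistrib)
  then have "rank (A + B) \<le> dim ?S" by (simp add: rank_dim_range dim_subset)
  also have "\<dots> \<le> rank A + rank B"
    using dim_sums_Int[of "range ((*v) A)" "range ((*v) B)"]
    by (simp add: rank_dim_range linear_subspace_image matrix_vector_mul_linear)
  finally show ?thesis .
qed

lemma rank_minus: "rank (- A) = rank A" for A :: "real^'n^'m"
proof -
  have "{x. (- A) *v x = 0} = {x. A *v x = 0}"
    using matrix_vector_mult_diff_rdistrib[of 0 A] by (auto simp: matrix_vector_mult_0)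
  then show ?thesis using rank_nullity[of A] rank_nullity[of "- A"] by simp
qed

lemma rank_diff_le: "rank (A - B) \<le> rank A + rank B" for A B :: "real^'n^'m"
  using rank_add_le[of A "- B"] rank_minus[of B] by simp

definition outer :: "real^'m \<Rightarrow> real^'n \<Rightarrow> real^'n^'m"
  where "outer u v = (\<chi> i j. u $ i * v $ j)"

lemma outer_mult_vector: "outer u v *v x = (v \<bullet> x) *\<^sub>R u"
  by (simp add: outer_def vec_eq_iff matrix_vector_mult_def inner_vec_def sum_distrib_left mult_ac)

lemma rank_outer_le: "rank (outer u v) \<le> 1"
proof -
  have "range ((*v) (outer u v)) \<subseteq> span {u}"
    by (auto simp: outer_mult_vector span_breakdown_eq)
  then have "dim (range ((*v) (outer u v))) \<le> dim (span {u})" by (rule dim_subset)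
  also have "\<dots> \<le> 1" using dim_le_card'[of "{u}"] by simp
  finally show ?thesis by (simp add: rank_dim_range)
qed

lemma Basis_matrix_outer:
  assumes "b \<in> (Basis :: (real^'n^'m) set)"
  obtains i j where "b = outer (axis i 1) (axis j 1)"
proof -
  obtain i j where "b = axis i (axis j 1)" using assms by (auto simp: Basis_vec_def)
  then have "b = outer (axis i 1) (axis j 1)"
    by (simp add: outer_def vec_eq_iff axis_def)
  then show thesis using that by blast
qed

lemma gram_inner: "((transpose X ** X) *v x) \<bullet> y = (X *v x) \<bullet> (X *v y)" for X :: "real^'n^'m"
  by (simp add: matrix_vector_mul_assoc[symmetric] dot_lmul_matrix[symmetric] vector_transpose_matrix)

lemma filter_mset_sum: "filter_mset P (\<Sum>a\<in>A. f a) = (\<Sum>a\<in>A. filter_mset P (f a))"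
  by (induction A rule: infinite_finite_induct) auto

lemma filter_replicate_mset:
  "filter_mset P (replicate_mset k x) = (if P x then replicate_mset k x else {#})"
  by (induction k) auto

text \<open>
  The eigenspaces of \<open>X'X\<close> fill the whole space and its kernel is the kernel of \<open>X\<close>. This fixes the
  length of the list of singular values and the number of its positive entries, which is what makes
  the positions 1 and \<open>rank X\<close> of the list meaningful.
\<close>

lemma singular_values_facts:
  fixes X :: "'q::finite mat"
  defines "f \<equiv> (\<lambda>v. (transpose X ** X) *v v)"
  shows size_singular_values: "size (singular_values X) = CARD('q)"
    and size_positive_singular_values: "size (filter_mset (\<lambda>s. 0 < s) (singular_values X)) = rank X"
    and sqrt_eigenvalue_singular: "\<And>c. c \<in> eigenvalues f \<Longrightarrow> 0 \<le> c \<and> sqrt c \<in># singular_values X"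
proof -
  let ?C = "{s. 0 \<le> s \<and> 0 < sv_mult X s}"
  have lin: "linear f" unfolding f_def by (rule matrix_vector_mul_linear)
  have sym: "f x \<bullet> y = x \<bullet> f y" for x y
    unfolding f_def gram_inner by (metis gram_inner inner_commute)
  note fin = finite_eigenvalues_symmetric[OF sym]
  have mult: "sv_mult X s = dim {v. f v = s\<^sup>2 *\<^sub>R v}" for s
    by (simp add: sv_mult_def f_def)
  have pos: "0 \<le> c" if "c \<in> eigenvalues f" for c
  proof -
    from that obtain v where "v \<noteq> 0" "f v = c *\<^sub>R v" by (auto simp: eigenvalues_def)
    then have "c * (v \<bullet> v) = (X *v v) \<bullet> (X *v v)" by (metis f_def gram_inner inner_scaleR_left)
    then show ?thesis
      using \<open>v \<noteq> 0\<close> by (metis inner_gt_zero_iff inner_ge_zero zero_le_mult_iff not_less)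
  qed
  have ev: "0 < sv_mult X s \<longleftrightarrow> s\<^sup>2 \<in> eigenvalues f" for s
  proof -
    have "sv_mult X s = 0 \<longleftrightarrow> {v. f v = s\<^sup>2 *\<^sub>R v} \<subseteq> {0}" unfolding mult by (rule dim_eq_0)
    then show ?thesis by (auto simp: eigenvalues_def)
  qed
  have bij: "bij_betw (\<lambda>s. s\<^sup>2) ?C (eigenvalues f)"
  proof (rule bij_betwI[where g = sqrt])
    show "sqrt \<in> eigenvalues f \<rightarrow> ?C" using pos by (auto simp: ev)
  qed (use pos in \<open>auto simp: ev\<close>)
  have finC: "finite ?C" using bij fin bij_betw_finite by blast
  show "0 \<le> c \<and> sqrt c \<in># singular_values X" if "c \<in> eigenvalues f" for c
    using that pos[OF that] finC
      by (auto simp: singular_values_def set_mset_sum in_replicate_mset ev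
        intro!: bexI[of _ "sqrt c"] exI[of _ "sqrt c"])
  have total: "(\<Sum>s\<in>?C. sv_mult X s) = CARD('q)"
    using sum.reindex_bij_betw[OF bij, of "\<lambda>c. dim {v. f v = c *\<^sub>R v}"] sum_dim_eigenspaces[OF lin sym]
    by (simp add: mult)
  show "size (singular_values X) = CARD('q)"
    unfolding singular_values_def by (simp add: total)
  have "filter_mset (\<lambda>s. 0 < s) (singular_values X) = (\<Sum>s\<in>?C. if 0 < s then replicate_mset (sv_mult X s) s else {#})"
    unfolding singular_values_def filter_mset_sum filter_replicate_mset ..
  then have "size (filter_mset (\<lambda>s. 0 < s) (singular_values X)) = (\<Sum>s\<in>?C. if 0 < s then sv_mult X s else 0)"
    by (simp add: if_distrib cong: if_cong)
  also have "\<dots> = (\<Sum>s\<in>?C. (if s = 0 then 0 else sv_mult X s))"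
    by (intro sum.cong) auto
  also have "\<dots> + sv_mult X 0 = (\<Sum>s\<in>?C. sv_mult X s)"
  proof (cases "0 \<in> ?C")
    case True
    then show ?thesis using finC by (simp add: sum.remove[of ?C 0])
  next
    case False
    then have "(\<Sum>s\<in>?C. (if s = 0 then 0 else sv_mult X s)) = (\<Sum>s\<in>?C. sv_mult X s)"
      by (intro sum.cong) auto
    then show ?thesis using False by simp
  qed
  also have "\<dots> = CARD('q)" by (rule total)
  also have "sv_mult X 0 = dim {x. X *v x = 0}"
  proof -
    have "f x = 0 \<longleftrightarrow> X *v x = 0" for x
      using gram_inner[of X x x] by (auto simp: f_def matrix_vector_mul_assoc[symmetric])
    then show ?thesis by (simp add: mult)
  qed
  finally show "size (filter_mset (\<lambda>s. 0 < s) (singular_values X)) = rank X"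
    using rank_nullity[of X] by simp
qed

lemma sing_val_1_ge_norm:
  fixes X :: "'q::finite mat"
  shows "norm (X *v v) \<le> sing_val 1 X * norm v"
proof -
  define f where "f = (\<lambda>v. (transpose X ** X) *v v)"
  define xs where "xs = rev (sorted_list_of_multiset (singular_values X))"
  have lin: "linear f" unfolding f_def by (rule matrix_vector_mul_linear)
  have sym: "f x \<bullet> y = x \<bullet> f y" for x y
    unfolding f_def gram_inner by (metis gram_inner inner_commute)
  have desc: "sorted_wrt (\<ge>) xs" by (simp add: xs_def sorted_wrt_rev)
  have set_xs: "set xs = set_mset (singular_values X)" by (simp add: xs_def)
  have "(UNIV :: (real^'q) set) \<noteq> {0}" by (rule UNIV_not_singleton)
  then obtain x where x: "x \<noteq> 0" "f x = Max (eigenvalues f) *\<^sub>R x"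
  proof -
    have "eigenvalues f \<noteq> {}"
      using span_eigenvectors[OF lin sym] \<open>(UNIV :: (real^'q) set) \<noteq> {0}\<close> by auto
    then show thesis using Max_in[OF finite_eigenvalues_symmetric[OF sym]] that
      by (auto simp: eigenvalues_def)
  qed
  let ?m = "Max (eigenvalues f)"
  have "?m \<in> eigenvalues f" using x by (auto simp: eigenvalues_def)
  then have m: "0 \<le> ?m" "sqrt ?m \<in> set xs"
    using sqrt_eigenvalue_singular[of ?m X] by (auto simp: f_def set_xs)
  then have "sqrt ?m \<le> sing_val 1 X"
    using desc unfolding sing_val_def xs_def[symmetric] by (cases xs) auto
  moreover have "norm (X *v v) \<le> sqrt ?m * norm v"
  proof (rule power2_le_imp_le)
    show "(norm (X *v v))\<^sup>2 \<le> (sqrt ?m * norm v)\<^sup>2"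
      using Max_eigenvalues_ge[OF lin sym, of v] m(1)
      by (simp add: f_def gram_inner power2_norm_eq_inner[of "X *v v"] power_mult_distrib)
  qed (use m in auto)
  ultimately show ?thesis by (meson mult_right_mono norm_ge_zero order_trans)
qed

text \<open>
  On the orthogonal complement of the kernel the least stretching factor is attained at an
  eigenvector of \<open>X'X\<close>, so it is a positive singular value; exactly \<open>rank X\<close> entries of the descending
  list are positive, so it occurs among the first \<open>rank X\<close>.
\<close>

lemma sing_val_rank_le_norm:
  fixes X :: "'q::finite mat"
  assumes r: "rank X = r" and v: "\<And>k. X *v k = 0 \<Longrightarrow> k \<bullet> v = 0"
  shows "sing_val r X * norm v \<le> norm (X *v v)"
proof (cases "v = 0")
  case False
  define f where "f = (\<lambda>v. (transpose X ** X) *v v)"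
  define xs where "xs = rev (sorted_list_of_multiset (singular_values X))"
  have lin: "linear f" unfolding f_def by (rule matrix_vector_mul_linear)
  have sym: "f x \<bullet> y = x \<bullet> f y" for x y
    unfolding f_def gram_inner by (metis gram_inner inner_commute)
  have desc: "sorted_wrt (\<ge>) xs" by (simp add: xs_def sorted_wrt_rev)
  have set_xs: "set xs = set_mset (singular_values X)" by (simp add: xs_def)
  have mset_xs: "mset xs = singular_values X" by (simp add: xs_def)
  have len: "length xs = CARD('q)" using size_singular_values[of X] mset_xs by (metis size_mset)
  have pos: "length (filter (\<lambda>s. 0 < s) xs) = r"
    using size_positive_singular_values[of X] mset_xs r by (metis mset_filter size_mset)
  let ?U = "{v. \<forall>k. X *v k = 0 \<longrightarrow> k \<bullet> v = 0}"
  have U: "subspace ?U" by (auto simp: subspace_def inner_add_right)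
  have ne: "?U \<noteq> {0}" using v False by auto
  have inv: "f ` ?U \<subseteq> ?U"
  proof safe
    fix u k assume "X *v k = 0"
    then show "k \<bullet> f u = 0" unfolding f_def using gram_inner[of X u k] by (simp add: inner_commute)
  qed
  obtain x c where x: "x \<in> ?U" "x \<noteq> 0" "f x = c *\<^sub>R x" "\<And>y. y \<in> ?U \<Longrightarrow> c * (norm y)\<^sup>2 \<le> f y \<bullet> y"
  proof (rule rayleigh_minimizer[OF U ne lin inv sym])
    fix x c assume "x \<in> ?U" "x \<noteq> 0" "f x = c *\<^sub>R x" "\<And>y. y \<in> ?U \<Longrightarrow> c * (norm y)\<^sup>2 \<le> f y \<bullet> y"
    then show thesis by (rule that)
  qed
  have ev: "c \<in> eigenvalues f" using x by (auto simp: eigenvalues_def)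
  then have c: "0 \<le> c" "sqrt c \<in> set xs"
    using sqrt_eigenvalue_singular[of c X] by (auto simp: f_def set_xs)
  have "X *v x \<noteq> 0" using x(1,2) by auto
  then have "0 < c" using x(2,3) c(1) gram_inner[of X x x] by (cases "c = 0") (auto simp: f_def)
  obtain i where i: "i < length xs" "xs ! i = sqrt c" using c(2) by (auto simp: in_set_conv_nth)
  \<comment> \<open>The first \<open>i + 1\<close> entries are positive, and only \<open>r\<close> entries are.\<close>
  have "filter (\<lambda>s. 0 < s) (take (Suc i) xs) = take (Suc i) xs"
  proof (rule filter_True, rule ballI)
    fix s assume "s \<in> set (take (Suc i) xs)"
    then obtain k where k: "k \<le> i" "s = xs ! k"
      using i by (auto simp: in_set_conv_nth less_Suc_eq_le)
    have "xs ! i \<le> s"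
    proof (cases "k = i")
      case False
      then show ?thesis using sorted_wrt_nth_less[OF desc, of k i] i k by simp
    qed (use k in simp)
    then show "0 < s" using i \<open>0 < c\<close> by (metis less_le_trans real_sqrt_gt_zero)
  qed
  moreover have "filter (\<lambda>s. 0 < s) xs
      = filter (\<lambda>s. 0 < s) (take (Suc i) xs) @ filter (\<lambda>s. 0 < s) (drop (Suc i) xs)"
    unfolding filter_append[symmetric] by simp
  ultimately have "Suc i \<le> length (filter (\<lambda>s. 0 < s) xs)"
    using i by simp
  then have "i < r" using pos by simp
  moreover have "r \<le> length xs" using rank_bound[of X] r len by simp
  ultimately have "sing_val r X \<le> sqrt c"
    using sorted_wrt_nth_less[OF desc, of i "r - 1"] i unfolding sing_val_def xs_def[symmetric]
    by (cases "i = r - 1") auto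
  moreover have "sqrt c * norm v \<le> norm (X *v v)"
  proof (rule power2_le_imp_le)
    have "v \<in> ?U" using v by auto
    from x(4)[OF this] show "(sqrt c * norm v)\<^sup>2 \<le> (norm (X *v v))\<^sup>2"
      using c(1)
        by (simp add: f_def gram_inner power2_norm_eq_inner[of "X *v v"] power_mult_distrib)
  qed simp
  ultimately show ?thesis by (meson mult_right_mono norm_ge_zero order_trans)
qed simp

section \<open>Perturbation of low-rank fits\<close>

(* Transposes are kept as matrices, so that associativity and adjoint rules apply to them. *)
declare transpose_matrix_vector [simp del]

lemma mat_mult_distrib:
  fixes A B :: "real^'n^'m" and C D :: "real^'k^'n"
  shows "(A + B) ** C = A ** C + B ** C"
    and "A ** (C + D) = A ** C + A ** D"
    and "(A - B) ** C = A ** C - B ** C"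
    and "A ** (C - D) = A ** C - A ** D"
    and "(c *\<^sub>R A) ** C = c *\<^sub>R (A ** C)"
    and "A ** (c *\<^sub>R C) = c *\<^sub>R (A ** C)"
  by (simp_all add: matrix_matrix_mult_def vec_eq_iff sum.distrib sum_subtractf sum_distrib_left algebra_simps)

lemma transpose_zero [simp]: "transpose (0 :: real^'n^'m) = 0"
  by (simp add: transpose_def vec_eq_iff)

lemma transpose_add: "transpose (A + B) = transpose A + transpose B" for A B :: "real^'n^'m"
  by (simp add: transpose_def vec_eq_iff)

lemma inner_mult_left: "(X ** A) \<bullet> N = A \<bullet> (transpose X ** N)" for X A N :: "'q::finite mat"
  by (simp add: inner_eq_trace matrix_transpose_mul matrix_mul_assoc)

lemma inner_mult_right: "(B ** X) \<bullet> N = B \<bullet> (N ** transpose X)" for X B N :: "'q::finite mat"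
  using trace_mul_sym[of "transpose X" "transpose B ** N"]
  by (simp add: inner_eq_trace matrix_transpose_mul matrix_mul_assoc)

lemma inner_transpose_vector: "(transpose A *v x) \<bullet> y = x \<bullet> (A *v y)" for A :: "real^'n^'m"
  by (metis dot_lmul_matrix inner_commute vector_transpose_matrix)

lemma subspace_tangent_space: "subspace (tangent_space X)"
  unfolding subspace_def tangent_space_def
proof (safe)
  show "\<exists>A B. 0 = X ** A + B ** X \<and> True" by (intro exI[of _ 0]) simp
  fix A B A' B' and c :: real
  show "\<exists>A'' B''. X ** A + B ** X + (X ** A' + B' ** X) = X ** A'' + B'' ** X \<and> True"
    by (intro exI[of _ "A + A'"] exI[of _ "B + B'"]) (simp add: mat_mult_distrib)
  show "\<exists>A' B'. c *\<^sub>R (X ** A + B ** X) = X ** A' + B' ** X \<and> True"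
    by (intro exI[of _ "c *\<^sub>R A"] exI[of _ "c *\<^sub>R B"])
      (simp add: mat_mult_distrib scaleR_right_distrib)
qed

lemma tangent_spaceI: "X ** A + B ** X \<in> tangent_space X"
  by (auto simp: tangent_space_def)

lemma rank_tangent_le: "T \<in> tangent_space X \<Longrightarrow> rank T \<le> 2 * rank X"
  unfolding tangent_space_def
  using rank_add_le order_trans rank_mul_le_left rank_mul_le_right
  by (fastforce intro: order_trans[OF rank_add_le] add_mono simp: mult_2)

lemma tangent_normal:
  assumes "N \<in> (tangent_space X)\<^sup>\<bottom>"
  shows "transpose X ** N = 0" "N ** transpose X = 0"
proof -
  have *: "(X ** A + B ** X) \<bullet> N = 0" for A B
    using assms tangent_spaceI[of X A B] by (auto simp: orthogonal_comp_def orthogonal_def)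
  have "A \<bullet> (transpose X ** N) = 0" for A using *[of A 0] by (simp add: inner_mult_left)
  then show "transpose X ** N = 0" by (metis inner_eq_zero_iff)
  have "B \<bullet> (N ** transpose X) = 0" for B using *[of 0 B] by (simp add: inner_mult_right)
  then show "N ** transpose X = 0" by (metis inner_eq_zero_iff)
qed

text \<open>
  Matrices whose positive singular values lie between \<open>s / 2\<close> and \<open>s\<close>, expressed through their action on
  vectors.
\<close>

locale conditioned_matrix =
  fixes X :: "'q::finite mat" and s :: real
  assumes s_pos: "0 < s"
    and norm_le: "\<And>v. norm (X *v v) \<le> s * norm v"
    and norm_ge: "\<And>v. (\<And>k. X *v k = 0 \<Longrightarrow> k \<bullet> v = 0) \<Longrightarrow> s / 2 * norm v \<le> norm (X *v v)"
begin

definition row_space :: "(real^'q) set"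
  where "row_space = {v. \<forall>k. X *v k = 0 \<longrightarrow> k \<bullet> v = 0}"

lemma subspace_row_space: "subspace row_space"
  by (auto simp: row_space_def subspace_def inner_add_right)

lemma subspace_kernel: "subspace {v. A *v v = 0}" for A :: "'q mat"
  by (auto simp: subspace_def matrix_vector_right_distrib matrix_vector_mult_scaleR)

lemma row_space_norm_ge: "v \<in> row_space \<Longrightarrow> s / 2 * norm v \<le> norm (X *v v)"
  by (rule norm_ge) (auto simp: row_space_def)

lemma decompose_kernel_row_space:
  obtains u v where "w = u + v" "X *v u = 0" "v \<in> row_space" "norm u \<le> norm w" "norm v \<le> norm w"
proof -
  let ?K = "{v. X *v v = 0}"
  note K = subspace_kernel[of X]
  have 1: "X *v proj ?K w = 0" using proj_in[OF K, of w] by simp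
  have 2: "w - proj ?K w \<in> row_space"
    using proj_orthogonal[OF K, of w]
      by (auto simp: row_space_def orthogonal_comp_def orthogonal_def)
  show thesis using that[OF _ 1 2] norm_proj_le[OF K, of w] norm_diff_proj_le[OF K, of w] by simp
qed

lemma dim_row_space: "dim row_space = rank X"
proof -
  have "row_space = {y \<in> UNIV. \<forall>x\<in>{v. X *v v = 0}. orthogonal x y}"
    by (auto simp: row_space_def orthogonal_def)
  then have "dim row_space + dim {v. X *v v = 0} = CARD('q)"
    using dim_subspace_orthogonal_to_vectors[OF subspace_kernel[of X] subspace_UNIV] by simp
  then show ?thesis using rank_nullity[of X] by simp
qed

lemma norm_frobenius_le: "norm X \<le> sqrt CARD('q) * s"
proof (rule power2_le_imp_le)
  have "(norm X)\<^sup>2 \<le> (\<Sum>k\<in>(UNIV::'q set). s\<^sup>2)"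
    unfolding norm_matrix_square_columns
    by (intro sum_mono power_mono) (use norm_le[of "axis _ 1"] in auto)
  then show "(norm X)\<^sup>2 \<le> (sqrt CARD('q) * s)\<^sup>2" by (simp add: power_mult_distrib)
qed (use s_pos in simp)

text \<open>
  The rank constraint bends the set of matrices of rank at most \<open>rank X\<close> only to second order
  away from its tangent space at \<open>X\<close>: a kernel vector of \<open>X\<close> differs from a kernel vector of \<open>Z\<close>
  by a row-space vector of size \<open>O(norm (Z - X))\<close>, on which the normal part acts through \<open>Z - X\<close>
  once more.
\<close>

lemma normal_part_quadratic:
  assumes rank: "rank Z \<le> rank X" and small: "22 * norm (Z - X) \<le> s"
  defines "N \<equiv> (Z - X) - proj (tangent_space X) (Z - X)"
  shows "norm (N *v u) \<le> 11 / 5 * (norm (Z - X))\<^sup>2 / s * norm u"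
proof -
  define D where "D = Z - X"
  define \<delta> where "\<delta> = norm D"
  have \<delta>: "0 \<le> \<delta>" "22 * \<delta> \<le> s" using small by (auto simp: \<delta>_def D_def)
  have N_perp: "N \<in> (tangent_space X)\<^sup>\<bottom>"
    unfolding N_def by (rule proj_orthogonal[OF subspace_tangent_space])
  obtain A B where AB: "proj (tangent_space X) D = X ** A + B ** X"
    using proj_in[OF subspace_tangent_space, of X D] by (auto simp: tangent_space_def)
  have NX: "(N *v u) \<bullet> (X *v w) = 0" for u w
  proof -
    have "(N *v u) \<bullet> (X *v w) = (transpose X *v (N *v u)) \<bullet> w"
      by (simp add: inner_transpose_vector)
    then show ?thesis using tangent_normal(1)[OF N_perp] by (simp add: matrix_vector_mul_assoc)
  qed
  have N_row: "N *v v = 0" if "v \<in> row_space" for v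
  proof -
    have "X ** transpose N = 0"
      using arg_cong[OF tangent_normal(2)[OF N_perp], of transpose]
        by (simp add: matrix_transpose_mul)
    then have "X *v (transpose N *v b) = 0" for b by (simp add: matrix_vector_mul_assoc)
    then have "(transpose N *v b) \<bullet> v = 0" for b using that by (auto simp: row_space_def)
    then have "b \<bullet> (N *v v) = 0" for b by (simp add: inner_transpose_vector)
    then show ?thesis by (metis inner_eq_zero_iff)
  qed
  have Z_row: "5 / 11 * s * norm v \<le> norm (Z *v v)" if "v \<in> row_space" for v
  proof -
    have "norm (D *v v) \<le> s / 22 * norm v"
      using order_trans[OF norm_matrix_vector_le mult_right_mono[of "norm D" "s / 22" "norm v"]] \<delta>
      by (simp add: \<delta>_def)
    moreover have "Z *v v = X *v v + D *v v" by (simp add: D_def matrix_vector_mult_diff_rdistrib)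
    ultimately show ?thesis
      using row_space_norm_ge[OF that] norm_triangle_ineq2[of "X *v v" "- (D *v v)"] by simp
  qed
  have sum_UNIV: "\<exists>k v. u = k + v \<and> Z *v k = 0 \<and> v \<in> row_space" for u
  proof -
    let ?S = "{x + y | x y. x \<in> {v. Z *v v = 0} \<and> y \<in> row_space}"
    have "v = 0" if "Z *v v = 0" "v \<in> row_space" for v
      using Z_row[OF that(2)] that(1) s_pos by (simp add: mult_le_0_iff)
    then have "{v. Z *v v = 0} \<inter> row_space \<subseteq> {0}" by auto
    then have "dim ({v. Z *v v = 0} \<inter> row_space) = 0" by simp
    then have "dim ?S \<ge> CARD('q)"
      using dim_sums_Int[OF subspace_kernel[of Z] subspace_row_space] rank rank_nullity[of Z] dim_row_space
      by linarith
    then have "span ?S = UNIV"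
      using dim_eq_full[of ?S] dim_subset_UNIV[of ?S] by simp
    moreover have "span ?S = ?S"
      by (intro span_eq_iff[THEN iffD2] subspace_sums subspace_kernel subspace_row_space)
    ultimately have "u \<in> ?S" by (simp only: UNIV_I)
    then show ?thesis by blast
  qed
  have ker: "norm (N *v u) \<le> 11 / 5 * \<delta>\<^sup>2 / s * norm u" if u: "X *v u = 0" for u
  proof -
    obtain k v where kv: "u = k + v" "Z *v k = 0" "v \<in> row_space" using sum_UNIV by blast
    have "Z *v v = Z *v u" using kv by (simp add: matrix_vector_right_distrib)
    also have Du: "Z *v u = D *v u" using u by (simp add: D_def matrix_vector_mult_diff_rdistrib)
    finally have Zv: "Z *v v = D *v u" .
    have "5 / 11 * s * norm v \<le> \<delta> * norm u"
      using Z_row[OF kv(3)] norm_matrix_vector_le[of D u] Zv by (simp add: \<delta>_def)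
    then have v: "norm v \<le> 11 / 5 * \<delta> / s * norm u" using s_pos by (simp add: field_simps)
    have "N *v u = D *v u - X *v (A *v u)"
      using u AB unfolding N_def D_def[symmetric]
      by (simp add: matrix_vector_mult_diff_rdistrib matrix_vector_mult_add_rdistrib matrix_vector_mul_assoc[symmetric])
    also have "D *v u = X *v v + D *v v"
      using Zv by (simp add: D_def matrix_vector_mult_diff_rdistrib)
    finally have Nu: "N *v u = X *v (v - A *v u) + D *v v"
      by (simp add: matrix_vector_mult_diff_distrib)
    have "(norm (N *v u))\<^sup>2 = (N *v u) \<bullet> (D *v v)"
      using NX[of u "v - A *v u"] by (subst (2) Nu, simp add: power2_norm_eq_inner inner_add_right)
        (metis Nu add.left_neutral inner_add_right)
    also have "\<dots> \<le> norm (N *v u) * norm (D *v v)" by (rule norm_cauchy_schwarz)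
    finally have "norm (N *v u) \<le> norm (D *v v)"
      by (cases "norm (N *v u) = 0") (auto simp: power2_eq_square)
    also have "\<dots> \<le> \<delta> * norm v" using norm_matrix_vector_le by (simp add: \<delta>_def)
    also have "\<dots> \<le> \<delta> * (11 / 5 * \<delta> / s * norm u)" using v \<delta> by (intro mult_left_mono)
    finally show ?thesis by (simp add: power2_eq_square)
  qed
  obtain u1 u2 where u: "u = u1 + u2" "X *v u1 = 0" "u2 \<in> row_space" "norm u1 \<le> norm u"
    by (rule decompose_kernel_row_space)
  have "norm (N *v u) \<le> 11 / 5 * \<delta>\<^sup>2 / s * norm u1"
    using ker[OF u(2)] N_row[OF u(3)] u(1) by (simp add: matrix_vector_right_distrib)
  also have "\<dots> \<le> 11 / 5 * \<delta>\<^sup>2 / s * norm u"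
    using u(4) s_pos by (intro mult_left_mono) auto
  finally show ?thesis by (simp add: \<delta>_def D_def)
qed

text \<open>
  A matrix and its transpose have the same positive singular values.
\<close>

lemma column_space_norm_ge:
  assumes "b \<in> range ((*v) X)"
  shows "s / 2 * norm b \<le> norm (transpose X *v b)"
proof -
  obtain w where "b = X *v w" using assms by blast
  moreover obtain u v where "w = u + v" "X *v u = 0" and v: "v \<in> row_space"
    by (rule decompose_kernel_row_space)
  ultimately have b: "b = X *v v" by (simp add: matrix_vector_right_distrib)
  have "(norm b)\<^sup>2 = (transpose X *v b) \<bullet> v"
    by (simp add: inner_transpose_vector b power2_norm_eq_inner)
  also have "\<dots> \<le> norm (transpose X *v b) * norm v" by (rule norm_cauchy_schwarz)
  finally have "norm b * norm b * (s / 2) \<le> norm (transpose X *v b) * norm v * (s / 2)"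
    using s_pos by (simp add: power2_eq_square)
  also have "\<dots> \<le> norm (transpose X *v b) * norm b"
    using mult_left_mono[OF row_space_norm_ge[OF v], of "norm (transpose X *v b)"] b
      by (simp add: mult_ac)
  finally show ?thesis by (cases "norm b = 0") (auto simp: mult_ac)
qed

text \<open>
  The coordinates of a tangent vector are not unique. Taking the columns of \<open>A\<close> in the row space
  and the rows of \<open>B\<close> in the column space makes the lower bound on the singular values apply to them.
\<close>

lemma tangent_coordinates:
  assumes T: "T \<in> tangent_space X"
  obtains A B where "T = X ** A + B ** X" "norm A \<le> 2 / s * norm T" "norm B \<le> 2 / s * norm T"
proof -
  obtain A0 B0 where T0: "T = X ** A0 + B0 ** X" using T by (auto simp: tangent_space_def)
  let ?R = "range ((*v) X)"
  have R: "subspace ?R" by (intro linear_subspace_image matrix_vector_mul_linear subspace_UNIV)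
  have "\<exists>a. X *v a = proj ?R (T *v axis k 1) \<and> norm a \<le> 2 / s * norm (T *v axis k 1)" for k
  proof -
    have "proj ?R (T *v axis k 1) \<in> ?R" by (rule proj_in[OF R])
    then obtain w where w: "proj ?R (T *v axis k 1) = X *v w" by blast
    obtain u v where uv: "w = u + v" "X *v u = 0" "v \<in> row_space"
      by (rule decompose_kernel_row_space)
    then have "X *v v = proj ?R (T *v axis k 1)" using w by (simp add: matrix_vector_right_distrib)
    moreover from this have "s / 2 * norm v \<le> norm (T *v axis k 1)"
      using row_space_norm_ge[OF uv(3)] norm_proj_le[OF R, of "T *v axis k 1"] by simp
    then have "norm v \<le> 2 / s * norm (T *v axis k 1)" using s_pos by (simp add: field_simps)
    ultimately show ?thesis by blast
  qed
  then obtain a where a: "\<And>k. X *v a k = proj ?R (T *v axis k 1)"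
      "\<And>k. norm (a k) \<le> 2 / s * norm (T *v axis k 1)" by metis
  define A where "A = (\<chi> i k. a k $ i)"
  have A_col: "A *v axis k 1 = a k" for k
    by (simp add: A_def matrix_vector_mult_basis column_def vec_lambda_eta)
  have scaled: "norm M \<le> 2 / s * norm K"
    if "\<And>k. norm (M *v axis k 1) \<le> 2 / s * norm (K *v axis k 1)" for M K :: "'q mat"
  proof (rule power2_le_imp_le)
    have "(norm M)\<^sup>2 \<le> (\<Sum>k\<in>UNIV. (2 / s * norm (K *v axis k 1))\<^sup>2)"
      unfolding norm_matrix_square_columns[of M] by (intro sum_mono power_mono that) auto
    then show "(norm M)\<^sup>2 \<le> (2 / s * norm K)\<^sup>2"
      unfolding power_mult_distrib norm_matrix_square_columns[of K] sum_distrib_left .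
  qed (use s_pos in auto)
  have A_norm: "norm A \<le> 2 / s * norm T" by (rule scaled) (use a A_col in auto)
  define T2 where "T2 = T - X ** A"
  have T2_col: "T2 *v axis k 1 = T *v axis k 1 - proj ?R (T *v axis k 1)" for k
    using a(1)[of k] A_col[of k] unfolding T2_def
    by (simp add: matrix_vector_mult_diff_rdistrib matrix_vector_mul_assoc[symmetric])
  have T2_norm: "norm T2 \<le> norm T"
  proof (rule power2_le_imp_le)
    show "(norm T2)\<^sup>2 \<le> (norm T)\<^sup>2"
      unfolding norm_matrix_square_columns T2_col
      by (intro sum_mono power_mono norm_diff_proj_le[OF R]) auto
  qed simp
  have T2_perp: "transpose T2 *v p = 0" if p: "p \<in> ?R" for p
  proof -
    have "axis k 1 \<bullet> (transpose T2 *v p) = 0" for k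
    proof -
      have "axis k 1 \<bullet> (transpose T2 *v p) = p \<bullet> (T2 *v axis k 1)"
        by (metis inner_transpose_vector inner_commute)
      also have "\<dots> = 0" unfolding T2_col
        using proj_orthogonal[OF R, of "T *v axis k 1"] p
          by (auto simp: orthogonal_comp_def orthogonal_def)
      finally show ?thesis .
    qed
    then show ?thesis by (simp add: inner_axis' vec_eq_iff)
  qed
  have "\<exists>b. transpose X *v b = transpose T2 *v axis i 1 \<and> norm b \<le> 2 / s * norm (transpose T2 *v axis i 1)"
    for i
  proof -
    let ?p = "proj ?R (axis i 1)"
    define n where "n = axis i 1 - ?p"
    have nR: "n \<bullet> (X *v w) = 0" for w
      using proj_orthogonal[OF R, of "axis i 1"] unfolding n_def
      by (auto simp: orthogonal_comp_def orthogonal_def inner_commute)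
    have Xn: "transpose X *v n = 0"
      using nR by (metis inner_transpose_vector inner_eq_zero_iff)
    have T2_eq: "transpose T2 = transpose (A0 - A) ** transpose X + transpose X ** transpose B0"
      unfolding T2_def T0
        by (simp add: matrix_transpose_mul[symmetric] transpose_add[symmetric] mat_mult_distrib)
    have "transpose T2 *v axis i 1 = transpose T2 *v ?p + transpose T2 *v n"
      by (simp add: n_def matrix_vector_right_distrib[symmetric])
    also have "\<dots> = transpose X *v (transpose B0 *v n)"
      using T2_perp[OF proj_in[OF R]] Xn
      by (simp add: T2_eq matrix_vector_mult_add_rdistrib matrix_vector_mul_assoc[symmetric])
    finally have 1: "transpose T2 *v axis i 1 = transpose X *v (transpose B0 *v n)" .
    define b where "b = proj ?R (transpose B0 *v n)"
    have "transpose X *v (transpose B0 *v n - b) = 0"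
    proof -
      have "(transpose X *v (transpose B0 *v n - b)) \<bullet> w = 0" for w
        using proj_orthogonal[OF R, of "transpose B0 *v n"] unfolding inner_transpose_vector b_def
        by (auto simp: orthogonal_comp_def orthogonal_def inner_commute)
      then show ?thesis by (metis inner_eq_zero_iff)
    qed
    then have 2: "transpose X *v b = transpose T2 *v axis i 1"
      using 1 by (simp add: matrix_vector_mult_diff_distrib)
    have "s / 2 * norm b \<le> norm (transpose T2 *v axis i 1)"
      using column_space_norm_ge[of b] 2 proj_in[OF R] by (simp add: b_def)
    then have "norm b \<le> 2 / s * norm (transpose T2 *v axis i 1)"
      using s_pos by (simp add: field_simps)
    with 2 show ?thesis by blast
  qed
  then obtain b where b: "\<And>i. transpose X *v b i = transpose T2 *v axis i 1"
     "\<And>i. norm (b i) \<le> 2 / s * norm (transpose T2 *v axis i 1)" by metis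
  define B where "B = (\<chi> i. b i)"
  have B_row: "transpose B *v axis i 1 = b i" for i
    by (simp add: B_def matrix_vector_mult_basis column_def transpose_def vec_lambda_eta)
  have "norm (transpose B) \<le> 2 / s * norm (transpose T2)" by (rule scaled) (use b B_row in auto)
  then have B_norm: "norm B \<le> 2 / s * norm T"
    using order_trans[OF _ mult_left_mono[OF T2_norm, of "2 / s"]] s_pos by simp
  have "transpose (B ** X) = transpose T2"
  proof -
    have "transpose (B ** X) *v axis i 1 = transpose T2 *v axis i 1" for i
      using b(1)[of i] B_row[of i]
        by (simp add: matrix_transpose_mul matrix_vector_mul_assoc[symmetric])
    then have "column i (transpose (B ** X)) = column i (transpose T2)" for i
      by (simp add: matrix_vector_mult_basis)
    then show ?thesis by (simp add: vec_eq_iff column_def)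
  qed
  then have "B ** X = T2" by (metis transpose_transpose)
  then have "T = X ** A + B ** X" by (simp add: T2_def)
  then show thesis using that A_norm B_norm by blast
qed


text \<open>
  The curves \<open>Z (1 + t A)\<close> and \<open>(1 + t B) Z\<close> stay within the rank constraint, so the residual is
  orthogonal to their velocities.
\<close>

lemma low_rank_fit_stationary:
  assumes fit: "low_rank_fit r (app H) y Z"
  shows "(y - app H Z) \<bullet> app H (Z ** A) = 0" "(y - app H Z) \<bullet> app H (B ** Z) = 0"
proof -
  have gen: "(y - app H Z) \<bullet> app H V = 0" if V: "\<And>t. rank (Z + t *\<^sub>R V) \<le> r" for V
  proof -
    let ?\<rho> = "y - app H Z"
    have "0 \<le> t * (- 2 * (?\<rho> \<bullet> app H V)) + t\<^sup>2 * (app H V \<bullet> app H V)" for t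
    proof -
      have "(norm ?\<rho>)\<^sup>2 \<le> (norm (y - app H (Z + t *\<^sub>R V)))\<^sup>2"
        using fit V by (auto simp: low_rank_fit_def)
      also have "y - app H (Z + t *\<^sub>R V) = ?\<rho> - t *\<^sub>R app H V"
        by (simp add: app_add_arg app_scale_arg)
      finally show ?thesis
        unfolding power2_norm_eq_inner by (simp add: inner_diff_left inner_diff_right inner_commute
            algebra_simps power2_eq_square)
    qed
    from quadratic_minimum_zero[OF this] show ?thesis by simp
  qed
  have Z: "rank Z \<le> r" using fit by (simp add: low_rank_fit_def)
  have "Z + t *\<^sub>R (Z ** A) = Z ** (mat 1 + t *\<^sub>R A)" for t
    by (simp add: mat_mult_distrib)
  then have "rank (Z + t *\<^sub>R (Z ** A)) \<le> r" for t
    using Z rank_mul_le_left[of Z "mat 1 + t *\<^sub>R A"] by simp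
  then show "(y - app H Z) \<bullet> app H (Z ** A) = 0" by (rule gen)
  have "Z + t *\<^sub>R (B ** Z) = (mat 1 + t *\<^sub>R B) ** Z" for t
    by (simp add: mat_mult_distrib)
  then have "rank (Z + t *\<^sub>R (B ** Z)) \<le> r" for t
    using Z rank_mul_le_right[of "mat 1 + t *\<^sub>R B" Z] by simp
  then show "(y - app H Z) \<bullet> app H (B ** Z) = 0" by (rule gen)
qed

context
  fixes L G :: "('q mat, real^'d::finite) linop" and Z :: "'q mat" and \<epsilon> :: real
  assumes rip: "\<And>Y. rank Y \<le> 4 * rank X \<Longrightarrow> 9/10 * norm Y \<le> norm (app L Y) \<and> norm (app L Y) \<le> 11/10 * norm Y"
    and fit: "low_rank_fit (rank X) (app (L + G)) (app L X) Z"
    and G: "norm G \<le> \<epsilon>" and eps: "\<epsilon> * (18000 * real CARD('q) ^ 3) \<le> 1" and q2: "2 \<le> CARD('q)"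
begin

lemma eps_bounds: "0 \<le> \<epsilon>" "\<epsilon> * real CARD('q) \<le> 1/72000" "\<epsilon> \<le> 1/144000"
proof -
  let ?q = "real CARD('q)"
  show e0: "0 \<le> \<epsilon>" using G norm_ge_zero order_trans by blast
  have q: "2 \<le> ?q" using q2 by simp
  then have "4 \<le> ?q * ?q" using mult_mono[OF q q] by simp
  then have "?q * 4 \<le> ?q * (?q * ?q)" by (intro mult_left_mono) auto
  then have "?q * 4 \<le> ?q ^ 3" by (simp add: power3_eq_cube mult.assoc)
  then have "\<epsilon> * (18000 * (?q * 4)) \<le> \<epsilon> * (18000 * ?q ^ 3)" using e0 by (intro mult_left_mono) auto
  then show 1: "\<epsilon> * ?q \<le> 1/72000" using eps by simp
  have "\<epsilon> * 2 \<le> \<epsilon> * ?q" using q e0 by (rule mult_left_mono)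
  then show "\<epsilon> \<le> 1/144000" using 1 by simp
qed

lemma rank_fit_diff: "rank (Z - X) \<le> 2 * rank X"
  using fit rank_diff_le[of Z X] by (simp add: low_rank_fit_def)

lemma fit_residual: "norm (app L X - app (L + G) Z) \<le> \<epsilon> * norm X"
proof (rule power2_le_imp_le)
  have "(norm (app L X - app (L + G) Z))\<^sup>2 \<le> (norm (app L X - app (L + G) X))\<^sup>2"
    using fit unfolding low_rank_fit_def by blast
  also have "\<dots> \<le> (\<epsilon> * norm X)\<^sup>2"
    using order_trans[OF norm_app_le[of G X] mult_right_mono[OF G norm_ge_zero]]
      by (simp add: power_mono)
  finally show "(norm (app L X - app (L + G) Z))\<^sup>2 \<le> (\<epsilon> * norm X)\<^sup>2" .
qed (use eps_bounds in simp)

text \<open>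
  Compare with the competitor \<open>X\<close>. The restricted isometry applies to \<open>Z - X\<close>, a matrix of rank at most
  \<open>2 * rank X\<close>.
\<close>

lemma fit_distance: "norm (Z - X) \<le> 23/10 * \<epsilon> * norm X"
proof -
  have "9/10 * norm (Z - X) \<le> norm (app L (Z - X))"
    using rip rank_fit_diff by simp
  also have "app L (Z - X) = - (app L X - app (L + G) Z) - app G Z"
    by (simp add: app_diff_arg)
  also have "norm \<dots> \<le> norm (app L X - app (L + G) Z) + norm (app G Z)"
    by (metis norm_minus_cancel norm_triangle_ineq4)
  also have "\<dots> \<le> \<epsilon> * norm X + \<epsilon> * norm Z"
    using fit_residual order_trans[OF norm_app_le[of G Z] mult_right_mono[OF G norm_ge_zero]]
      by simp
  also have "\<dots> \<le> \<epsilon> * norm X + \<epsilon> * (norm X + norm (Z - X))"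
    using norm_triangle_sub[of Z X] eps_bounds(1) by (intro add_left_mono mult_left_mono) auto
  finally have "9/10 * norm (Z - X) \<le> 2 * (\<epsilon> * norm X) + \<epsilon> * norm (Z - X)"
    by (simp add: algebra_simps)
  moreover have "\<epsilon> * norm (Z - X) \<le> 1/144000 * norm (Z - X)"
    using eps_bounds(3) by (intro mult_right_mono) auto
  moreover have "0 \<le> \<epsilon> * norm X" using eps_bounds(1) by simp
  ultimately show ?thesis by simp
qed

lemma fit_relative_distance: "norm (Z - X) \<le> 23/10 * \<epsilon> * sqrt CARD('q) * s" "22 * norm (Z - X) \<le> s"
proof -
  have "23/10 * \<epsilon> * norm X \<le> 23/10 * \<epsilon> * (sqrt CARD('q) * s)"
    using norm_frobenius_le eps_bounds(1) by (intro mult_left_mono) auto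
  then show 1: "norm (Z - X) \<le> 23/10 * \<epsilon> * sqrt CARD('q) * s"
    using fit_distance by (simp add: mult.assoc)
  have "sqrt CARD('q) \<le> real CARD('q)"
    using q2 by (simp add: sqrt_le_D real_le_lsqrt power2_eq_square)
  then have "\<epsilon> * sqrt CARD('q) \<le> 1/72000"
    using eps_bounds(1,2) by (meson mult_left_mono order_trans)
  then have "(\<epsilon> * sqrt CARD('q)) * s \<le> 1/72000 * s" using s_pos by (intro mult_right_mono) auto
  moreover have "norm (Z - X) \<le> 23/10 * ((\<epsilon> * sqrt CARD('q)) * s)"
    using 1 by (simp only: mult.assoc)
  ultimately show "22 * norm (Z - X) \<le> s" using s_pos by linarith
qed

lemma fit_normal_part:
  defines "N \<equiv> (Z - X) - proj (tangent_space X) (Z - X)"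
  shows "norm N \<le> 117/10 * CARD('q) * \<epsilon>\<^sup>2 * norm X"
proof -
  define \<delta> where "\<delta> = norm (Z - X)"
  let ?y = "sqrt CARD('q)"
  define c where "c = 11 / 5 * \<delta>\<^sup>2 / s"
  have "norm N \<le> ?y * c"
  proof (rule power2_le_imp_le)
    have "(norm N)\<^sup>2 \<le> (\<Sum>k\<in>(UNIV::'q set). c\<^sup>2)"
      unfolding norm_matrix_square_columns
    proof (intro sum_mono power_mono)
      fix k :: 'q
      have "rank Z \<le> rank X" using fit by (simp add: low_rank_fit_def)
      from normal_part_quadratic[OF this fit_relative_distance(2), of "axis k 1"]
      show "norm (N *v axis k 1) \<le> c" by (simp add: N_def \<delta>_def c_def)
    qed simp
    then show "(norm N)\<^sup>2 \<le> (?y * c)\<^sup>2" by (simp add: power_mult_distrib)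
  qed (use s_pos in \<open>simp add: c_def\<close>)
  also have "?y * c \<le> ?y * (11 / 5 * ((23/10 * \<epsilon> * norm X) * (23/10 * \<epsilon> * ?y * s)) / s)"
  proof -
    have "\<delta>\<^sup>2 \<le> (23/10 * \<epsilon> * norm X) * (23/10 * \<epsilon> * ?y * s)"
    unfolding power2_eq_square \<delta>_def
    using fit_distance fit_relative_distance(1) eps_bounds(1) by (intro mult_mono) auto
    then show ?thesis
      unfolding c_def using s_pos by (intro mult_left_mono divide_right_mono) auto
  qed
  also have "\<dots> = (?y * ?y) * (11638/1000 * \<epsilon>\<^sup>2 * norm X)"
    using s_pos by (simp add: field_simps power2_eq_square)
  also have "\<dots> = 11638/1000 * (CARD('q) * \<epsilon>\<^sup>2 * norm X)" by simp
  also have "\<dots> \<le> 117/10 * (CARD('q) * \<epsilon>\<^sup>2 * norm X)" by (intro mult_right_mono) auto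
  finally show ?thesis by (simp add: mult.assoc)
qed

text \<open>
  The residual is \<open>O(\<epsilon>)\<close> and exactly orthogonal to the image under \<open>L + G\<close> of the tangent space at \<open>Z\<close>.
  Passing to the tangent space at \<open>X\<close> costs a factor \<open>norm (Z - X) / s\<close>, passing to \<open>L\<close> a factor \<open>\<epsilon>\<close>. The
  correction \<open>R\<close> has rank at most \<open>4 * rank X\<close>: this is where the order of the restricted isometry
  comes from.
\<close>

lemma fit_residual_tangent:
  assumes T: "T \<in> tangent_space X"
  shows "\<bar>(app L X - app (L + G) Z) \<bullet> app L T\<bar> \<le> 78/10 * CARD('q) * \<epsilon>\<^sup>2 * norm X * norm T"
proof -
  define \<rho> where "\<rho> = app L X - app (L + G) Z"
  define D where "D = Z - X"
  let ?y = "sqrt CARD('q)"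
  obtain A B where AB: "T = X ** A + B ** X" "norm A \<le> 2 / s * norm T" "norm B \<le> 2 / s * norm T"
    using tangent_coordinates[OF T] .
  define R where "R = D ** A + B ** D"
  have ZAB: "Z ** A + B ** Z = T + R" unfolding R_def D_def AB(1) by (simp add: mat_mult_distrib)
  have "norm R \<le> norm D * norm A + norm B * norm D"
    unfolding R_def by (rule norm_triangle_le) (intro add_mono norm_matrix_mult_le)
  also have "\<dots> \<le> norm D * (2 / s * norm T) + (2 / s * norm T) * norm D"
    using AB by (intro add_mono mult_left_mono mult_right_mono) auto
  also have "\<dots> = norm D * (4 / s * norm T)" by simp
  also have "\<dots> \<le> (23/10 * \<epsilon> * ?y * s) * (4 / s * norm T)"
    using fit_relative_distance(1) s_pos by (intro mult_right_mono) (auto simp: D_def)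
  also have "\<dots> = 92/10 * (\<epsilon> * ?y) * norm T" using s_pos by simp
  finally have R: "norm R \<le> 92/10 * (\<epsilon> * ?y) * norm T" .
  have "rank R \<le> rank D + rank D"
    unfolding R_def using rank_mul_le_left[of D A] rank_mul_le_right[of B D]
    by (meson add_mono order_trans rank_add_le)
  then have "rank R \<le> 4 * rank X" using rank_fit_diff by (simp add: D_def)
  then have "norm (app L R) \<le> 11/10 * norm R" using rip by blast
  also have "\<dots> \<le> 11/10 * (92/10 * (\<epsilon> * ?y) * norm T)" by (intro mult_left_mono R) simp
  finally have LR: "norm (app L R) \<le> 11/10 * (92/10 * (\<epsilon> * ?y) * norm T)" .
  have y: "7/5 \<le> ?y" "?y * 7/5 \<le> CARD('q)"
  proof -
    have "(7/5)\<^sup>2 \<le> real CARD('q)" using q2 by (simp add: power2_eq_square)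
    then show "7/5 \<le> ?y" by (rule real_le_rsqrt)
    then have "?y * (7/5) \<le> ?y * ?y" by (intro mult_left_mono) auto
    then show "?y * 7/5 \<le> CARD('q)" by simp
  qed
  have "92/10 * (\<epsilon> * ?y) \<le> 1/100"
  proof -
    have "\<epsilon> * ?y \<le> \<epsilon> * CARD('q)" using y eps_bounds(1) by (intro mult_left_mono) auto
    then show ?thesis using eps_bounds(2) by simp
  qed
  then have "92/10 * (\<epsilon> * ?y) * norm T \<le> 1/100 * norm T" by (rule mult_right_mono) simp
  then have "norm (T + R) \<le> 101/100 * norm T" using R norm_triangle_ineq[of T R] by linarith
  then have GT: "norm (app G (T + R)) \<le> \<epsilon> * (101/100 * norm T)"
    using eps_bounds(1) by (intro order_trans[OF norm_app_le mult_mono[OF G]]) auto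
  have "\<rho> \<bullet> app (L + G) (T + R) = 0"
    using low_rank_fit_stationary[OF fit, of A] low_rank_fit_stationary[OF fit, of B]
    unfolding ZAB[symmetric] \<rho>_def by (simp only: app_add_arg inner_add_right)
  then have "\<rho> \<bullet> app L T = - (\<rho> \<bullet> app L R) - \<rho> \<bullet> app G (T + R)"
    by (simp add: app_add_arg inner_add_right)
  then have "\<bar>\<rho> \<bullet> app L T\<bar> \<le> \<bar>\<rho> \<bullet> app L R\<bar> + \<bar>\<rho> \<bullet> app G (T + R)\<bar>" by linarith
  also have "\<dots> \<le> norm \<rho> * norm (app L R) + norm \<rho> * norm (app G (T + R))"
    by (intro add_mono Cauchy_Schwarz_ineq2)
  also have "\<dots> \<le> norm \<rho> * (11/10 * (92/10 * (\<epsilon> * ?y) * norm T) + \<epsilon> * (101/100 * norm T))"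
    unfolding distrib_left[symmetric] using LR GT by (intro mult_left_mono add_mono) auto
  also have "\<dots> \<le> (\<epsilon> * norm X) * (11/10 * (92/10 * (\<epsilon> * ?y) * norm T) + \<epsilon> * (101/100 * norm T))"
    using fit_residual eps_bounds(1) by (intro mult_right_mono) (auto simp: \<rho>_def)
  also have "\<dots> = (1012/100 * ?y + 101/100) * (\<epsilon>\<^sup>2 * norm X * norm T)"
    by (simp add: algebra_simps power2_eq_square)
  also have "\<dots> \<le> (78/10 * CARD('q)) * (\<epsilon>\<^sup>2 * norm X * norm T)"
    using y by (intro mult_right_mono) auto
  finally show ?thesis by (simp add: \<rho>_def mult.assoc)
qed

text \<open>
  To first order the fit moves by the tangent vector whose image under \<open>L\<close> cancels the part of
  \<open>app G X\<close> that lies in the image of the tangent space.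
\<close>

lemma fit_first_order:
  "norm (app L (Z - X) + proj (app L ` tangent_space X) (app G X)) \<le> 23 * CARD('q) * \<epsilon>\<^sup>2 * norm X"
proof -
  define \<rho> where "\<rho> = app L X - app (L + G) Z"
  define D where "D = Z - X"
  define T where "T = proj (tangent_space X) D"
  define N where "N = D - T"
  let ?V = "app L ` tangent_space X"
  let ?P = "proj ?V"
  let ?e = "real CARD('q) * \<epsilon>\<^sup>2 * norm X"
  have e0: "0 \<le> ?e" by simp
  have V: "subspace ?V" by (intro linear_subspace_image linear_app subspace_tangent_space)
  note lin = linear_proj[OF V]
  have T: "T \<in> tangent_space X" unfolding T_def by (rule proj_in[OF subspace_tangent_space])
  have P\<rho>: "norm (?P \<rho>) \<le> 87/10 * ?e"
  proof -
    obtain S where S: "S \<in> tangent_space X" "?P \<rho> = app L S" using proj_in[OF V, of \<rho>] by blast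
    have "(norm (?P \<rho>))\<^sup>2 = \<rho> \<bullet> ?P \<rho>"
      by (simp add: power2_norm_eq_inner proj_inner_proj[OF V])
    also have "\<dots> = \<rho> \<bullet> app L S" by (simp only: S(2))
    also have "\<dots> \<le> 78/10 * ?e * norm S"
      using fit_residual_tangent[OF S(1)] by (simp add: \<rho>_def mult.assoc)
    also have "\<dots> \<le> 78/10 * ?e * (10/9 * norm (?P \<rho>))"
      using rip[of S] rank_tangent_le[OF S(1)] S(2) e0 by (intro mult_left_mono) auto
    finally have "norm (?P \<rho>) * norm (?P \<rho>) \<le> (78/9 * ?e) * norm (?P \<rho>)"
      by (simp add: power2_eq_square mult_ac)
    then have "norm (?P \<rho>) \<le> 78/9 * ?e" using e0
      by (cases "norm (?P \<rho>) = 0") (simp_all only: mult_le_cancel_right, auto)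
    then show ?thesis using e0 by linarith
  qed
  have "rank N \<le> rank D + rank T" unfolding N_def by (rule rank_diff_le)
  then have "rank N \<le> 4 * rank X" using rank_fit_diff rank_tangent_le[OF T] by (simp add: D_def)
  then have "norm (app L N) \<le> 11/10 * norm N" using rip by blast
  then have LN: "norm (app L N) \<le> 11/10 * (117/10 * ?e)"
    using fit_normal_part by (simp add: N_def T_def D_def mult.assoc)
  have PT: "?P (app L T) = app L T" using T by (intro proj_of_mem V) auto
  have D: "D = T + N" by (simp add: N_def)
  have "\<rho> = - app L D - app G X - app G D"
    by (simp add: \<rho>_def D_def app_diff_arg)
  then have "?P \<rho> = - app L T - ?P (app L N) - ?P (app G X) - ?P (app G D)"
    using PT by (simp add: linear_diff[OF lin] linear_add[OF lin] linear_neg[OF lin] D app_add_arg)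
  then have split: "app L D + ?P (app G X) = (app L N - ?P (app L N)) - ?P \<rho> - ?P (app G D)"
    by (simp add: D app_add_arg)
  have "norm (app L D + ?P (app G X)) \<le> norm (app L N - ?P (app L N)) + norm (?P \<rho>) + norm (?P (app G D))"
    unfolding split using norm_triangle_ineq4[of "app L N - ?P (app L N) - ?P \<rho>" "?P (app G D)"]
      norm_triangle_ineq4[of "app L N - ?P (app L N)" "?P \<rho>"] by linarith
  also have "\<dots> \<le> 11/10 * (117/10 * ?e) + 87/10 * ?e + 23/20 * ?e"
  proof (intro add_mono P\<rho>)
    show "norm (app L N - ?P (app L N)) \<le> 11/10 * (117/10 * ?e)"
      using norm_diff_proj_le[OF V] LN by (rule order_trans)
    have "norm (?P (app G D)) \<le> norm G * norm D"
      using norm_proj_le[OF V] norm_app_le by (rule order_trans)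
    also have "\<dots> \<le> \<epsilon> * (23/10 * \<epsilon> * norm X)"
      using G fit_distance eps_bounds(1) by (intro mult_mono) (auto simp: D_def)
    also have "\<dots> = 23/20 * (2 * (\<epsilon>\<^sup>2 * norm X))" by (simp add: power2_eq_square)
    also have "\<dots> \<le> 23/20 * (CARD('q) * (\<epsilon>\<^sup>2 * norm X))"
      using q2 by (intro mult_left_mono mult_right_mono) auto
    finally show "norm (?P (app G D)) \<le> 23/20 * ?e" by (simp add: mult.assoc)
  qed
  also have "\<dots> \<le> 23 * ?e" using e0 by simp
  finally show ?thesis by (simp add: D_def mult.assoc)
qed

end

end

section \<open>Perturbed power iteration\<close>

lemma semidefinite_Cauchy_Schwarz:
  fixes q :: "'a::real_vector \<Rightarrow> 'a \<Rightarrow> real"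
  assumes q: "bilinear q" "\<And>x y. q x y = q y x" "\<And>x. 0 \<le> q x x"
  shows "(q x y)\<^sup>2 \<le> q x x * q y y"
proof -
  have expand: "0 \<le> q x x + 2 * t * q x y + t\<^sup>2 * q y y" for t
  proof -
    have "q (x + t *\<^sub>R y) (x + t *\<^sub>R y) = q x x + 2 * t * q x y + t\<^sup>2 * q y y"
      using q(2)[of y x]
        by (simp add: bilinear_ladd[OF q(1)] bilinear_radd[OF q(1)] bilinear_lmul[OF q(1)]
          bilinear_rmul[OF q(1)] power2_eq_square algebra_simps)
    then show ?thesis using q(3)[of "x + t *\<^sub>R y"] by simp
  qed
  show ?thesis
  proof (cases "q y y = 0")
    case True
    have "q x y = 0"
    proof (rule ccontr)
      assume "q x y \<noteq> 0"
      then have "2 * (- (q x x + 1) / (2 * q x y)) * q x y = - (q x x + 1)" by simp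
      then show False using expand[of "- (q x x + 1) / (2 * q x y)"] True by simp
    qed
    then show ?thesis using True by simp
  next
    case False
    then have pos: "q y y > 0" using q(3)[of y] by simp
    have "0 \<le> (q x x + 2 * (- q x y / q y y) * q x y + (- q x y / q y y)\<^sup>2 * q y y) * q y y"
      by (rule mult_nonneg_nonneg[OF expand]) (use pos in simp)
    also have "\<dots> = q x x * q y y - (q x y)\<^sup>2"
      using pos by (simp add: field_simps power2_eq_square)
    finally show ?thesis by simp
  qed
qed

text \<open>
  One exact step of the iteration is \<open>T\<close>, self-adjoint and semidefinite for the definite form \<open>B\<close>; its
  Rayleigh quotient is bounded by \<open>\<beta>\<close> on the invariant subspace \<open>U\<close> in which the iterates stay.
\<close>

locale semidefinite_operator =
  fixes B :: "'a::euclidean_space \<Rightarrow> 'a \<Rightarrow> real" and T :: "'a \<Rightarrow> 'a" and U :: "'a set"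
    and lo hi \<beta> :: real
  assumes bil: "bilinear B" and sym: "\<And>x y. B x y = B y x"
    and lo: "0 < lo" and form_ge: "\<And>x. lo * (norm x)\<^sup>2 \<le> B x x"
      and form_le: "\<And>x. B x x \<le> hi * (norm x)\<^sup>2"
    and lin: "linear T" and self_adjoint: "\<And>x y. B (T x) y = B x (T y)"
    and psd: "\<And>x. 0 \<le> B (T x) x"
    and U: "subspace U" "\<And>x. x \<in> U \<Longrightarrow> T x \<in> U"
    and \<beta>: "0 < \<beta>" "\<And>x. x \<in> U \<Longrightarrow> B (T x) x \<le> \<beta> * B x x"
begin

lemma form_pos: "x \<noteq> 0 \<Longrightarrow> 0 < B x x"
  using form_ge[of x] lo by (smt (verit, best) mult_pos_pos zero_less_norm_iff zero_less_power)

lemma form_nonneg: "0 \<le> B x x"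
  using form_ge[of x] lo by (meson dual_order.trans less_imp_le mult_nonneg_nonneg zero_le_power2)

lemma hi_pos: "0 < hi"
proof -
  obtain b :: 'a where "b \<in> Basis" using nonempty_Basis by blast
  then show ?thesis using form_ge[of b] form_le[of b] lo by simp
qed

lemmas form_simps = bilinear_ladd[OF bil] bilinear_radd[OF bil] bilinear_lsub[OF bil] bilinear_rsub[OF bil]
  bilinear_lmul[OF bil] bilinear_rmul[OF bil]

lemma bilinear_energy: "bilinear (\<lambda>x y. B (T x) y)"
  using bil linear_compose[OF lin] unfolding bilinear_def comp_def
    by (auto simp: linear_iff form_simps linear_add[OF lin] linear_cmul[OF lin])

lemma energy_Cauchy_Schwarz: "(B (T x) y)\<^sup>2 \<le> B (T x) x * B (T y) y"
  by (rule semidefinite_Cauchy_Schwarz[of "\<lambda>x y. B (T x) y", OF bilinear_energy _ psd])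
    (metis self_adjoint sym)

lemma form_Cauchy_Schwarz: "(B x y)\<^sup>2 \<le> B x x * B y y"
  by (rule semidefinite_Cauchy_Schwarz[OF bil sym form_nonneg])

lemma image_le_energy:
  assumes "x \<in> U"
  shows "B (T x) (T x) \<le> \<beta> * B (T x) x"
proof -
  have "(B (T x) (T x))\<^sup>2 \<le> B (T x) x * B (T (T x)) (T x)" by (rule energy_Cauchy_Schwarz)
  also have "\<dots> \<le> B (T x) x * (\<beta> * B (T x) (T x))"
    by (intro mult_left_mono psd \<beta> U assms)
  finally have "B (T x) (T x) * B (T x) (T x) \<le> \<beta> * B (T x) x * B (T x) (T x)"
    by (simp add: power2_eq_square mult_ac)
  then show ?thesis
    using form_nonneg[of "T x"] psd[of x] \<beta>(1) by (cases "B (T x) (T x) = 0") auto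
qed

lemma form_image_le:
  assumes "x \<in> U" shows "B (T x) (T x) \<le> \<beta>\<^sup>2 * B x x"
  using order_trans[OF image_le_energy mult_left_mono[OF \<beta>(2)]] assms \<beta>(1)
    by (simp add: power2_eq_square mult.assoc)

definition quotient :: "'a \<Rightarrow> real" where "quotient x = B (T x) x / B x x"
definition var :: "'a \<Rightarrow> real" where "var x = B (T x) (T x) / B x x - (quotient x)\<^sup>2"

lemma quotient_nonneg: "0 \<le> quotient x"
  unfolding quotient_def by (intro divide_nonneg_nonneg psd form_nonneg)

lemma quotient_le: "x \<in> U \<Longrightarrow> x \<noteq> 0 \<Longrightarrow> quotient x \<le> \<beta>"
  unfolding quotient_def using \<beta>(2)[of x] form_pos[of x] by (simp add: field_simps)

lemma var_nonneg:
  assumes "x \<noteq> 0" shows "0 \<le> var x"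
  using form_Cauchy_Schwarz[of "T x" x] form_pos[OF assms]
  by (simp add: var_def quotient_def power_divide field_simps power2_eq_square)

lemma form_shift:
  assumes "x \<noteq> 0"
  shows "B (T x - c *\<^sub>R x) (T x - c *\<^sub>R x) = (var x + (quotient x - c)\<^sup>2) * B x x"
  using form_pos[OF assms] sym[of x "T x"]
  by (simp add: var_def quotient_def form_simps field_simps power2_eq_square)

text \<open>
  Log-convexity of the moments \<open>B (T\<^sup>k x) x\<close> makes the Rayleigh quotient grow along an exact
  step by a multiple of the variance; the perturbation costs \<open>O(e)\<close>.
\<close>

lemma quotient_step:
  assumes x: "x \<in> U" "x \<noteq> 0" and x': "x' \<in> U" "x' \<noteq> 0" and b: "0 < b" "b\<^sup>2 * B x x \<le> B (T x) (T x)"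
    and e: "0 \<le> e" "B (x' - T x) (x' - T x) \<le> e\<^sup>2 * B x x"
  shows "quotient x + var x / \<beta> - (4 * \<beta>\<^sup>2 * e + \<beta> * e\<^sup>2) / b\<^sup>2 \<le> quotient x'"
proof -
  define n where "n = B x x"
  define m1 where "m1 = B (T x) x / n"
  define m2 where "m2 = B (T x) (T x) / n"
  define m3 where "m3 = B (T (T x)) (T x) / n"
  define w where "w = x' - T x"
  have n: "0 < n" using form_pos[OF x(2)] by (simp add: n_def)
  have m2: "b\<^sup>2 \<le> m2" using b n by (simp add: m2_def n_def field_simps)
  have m2_pos: "0 < m2" using m2 b(1) by (meson less_le_trans zero_less_power)
  have m2_le: "m2 \<le> \<beta> * m1"
    using image_le_energy[OF x(1)] n by (simp add: m1_def m2_def field_simps)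
  have m1_pos: "0 < m1" using m2_pos m2_le \<beta>(1) by (smt (verit) zero_less_mult_pos)
  have m1_le: "m1 \<le> \<beta>" using quotient_le[OF x] by (simp add: m1_def n_def quotient_def)
  have m2_le2: "m2 \<le> \<beta>\<^sup>2"
    using order_trans[OF m2_le mult_left_mono[OF m1_le]] \<beta>(1) by (simp add: power2_eq_square)
  have "B (T x) (T x) * B (T x) (T x) \<le> B (T x) x * B (T (T x)) (T x)"
    using energy_Cauchy_Schwarz[of x "T x"] by (simp add: power2_eq_square)
  then have "m2 * m2 \<le> m1 * m3"
    using n by (simp add: m1_def m2_def m3_def divide_right_mono)
  then have "m2 / m1 \<le> m3 / m2" using m1_pos m2_pos by (simp add: field_simps)
  moreover have "quotient x + var x / \<beta> \<le> m2 / m1"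
  proof -
    have v: "var x = m2 - m1\<^sup>2" "quotient x = m1"
      by (simp_all add: var_def quotient_def m1_def m2_def n_def)
    have "var x / \<beta> \<le> var x / m1"
      using var_nonneg[OF x(2)] m1_pos m1_le by (intro divide_left_mono) auto
    also have "\<dots> = m2 / m1 - m1" using m1_pos by (simp add: v power2_eq_square diff_divide_distrib)
    finally show ?thesis by (simp add: v)
  qed
  ultimately have exact: "quotient x + var x / \<beta> \<le> m3 / m2" by simp
  have m3: "m3 \<le> \<beta> * m2" "0 \<le> m3"
    using \<beta>(2)[of "T x"] U(2)[OF x(1)] psd[of "T x"] n by (simp_all add: m2_def m3_def field_simps)
  have wU: "w \<in> U" unfolding w_def using U x x' by (simp add: subspace_diff)
  have Bw: "B w w \<le> e\<^sup>2 * n" using e by (simp add: w_def n_def)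
  have qw: "B (T w) w \<le> \<beta> * (e\<^sup>2 * n)"
    using \<beta>(2)[OF wU] Bw \<beta>(1) by (meson dual_order.trans less_imp_le mult_left_mono)
  have cross_q: "\<bar>B (T (T x)) w\<bar> \<le> \<beta>\<^sup>2 * e * n"
  proof (rule power2_le_imp_le)
    have "\<bar>B (T (T x)) w\<bar>\<^sup>2 \<le> B (T (T x)) (T x) * B (T w) w"
      using energy_Cauchy_Schwarz[of "T x" w] by simp
    also have "B (T (T x)) (T x) = m3 * n" using n by (simp add: m3_def)
    also have "m3 * n * B (T w) w \<le> (\<beta> * \<beta>\<^sup>2 * n) * (\<beta> * (e\<^sup>2 * n))"
      using m3 m2_le2 \<beta>(1) n qw psd[of w]
        by (intro mult_mono) (auto intro: order_trans mult_left_mono)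
    also have "\<dots> = (\<beta>\<^sup>2 * e * n)\<^sup>2" by (simp add: power2_eq_square)
    finally show "\<bar>B (T (T x)) w\<bar>\<^sup>2 \<le> (\<beta>\<^sup>2 * e * n)\<^sup>2" .
  qed (use e n in simp)
  have cross_B: "B (T x) w \<le> \<beta> * e * n"
  proof (rule power2_le_imp_le)
    have "(B (T x) w)\<^sup>2 \<le> B (T x) (T x) * B w w" by (rule form_Cauchy_Schwarz)
    also have "B (T x) (T x) = m2 * n" using n by (simp add: m2_def)
    also have "m2 * n * B w w \<le> (\<beta>\<^sup>2 * n) * (e\<^sup>2 * n)"
      using m2_le2 n Bw form_nonneg[of w] by (intro mult_mono) auto
    finally show "(B (T x) w)\<^sup>2 \<le> (\<beta> * e * n)\<^sup>2" by (simp add: power2_eq_square mult_ac)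
  qed (use e n \<beta>(1) in simp)
  have x'_eq: "x' = T x + w" by (simp add: w_def)
  have sym': "B (T w) (T x) = B (T (T x)) w" "B w (T x) = B (T x) w"
    using self_adjoint[of w "T x"] sym by auto
  have num: "(m3 - 2 * \<beta>\<^sup>2 * e) * n \<le> B (T x') x'"
  proof -
    have "B (T x') x' = m3 * n + 2 * B (T (T x)) w + B (T w) w"
      using n sym' by (simp add: x'_eq linear_add[OF lin] form_simps m3_def)
    then show ?thesis using cross_q psd[of w] by (simp add: algebra_simps)
  qed
  have den: "B x' x' \<le> (m2 + 2 * \<beta> * e + e\<^sup>2) * n"
  proof -
    have "B x' x' = m2 * n + 2 * B (T x) w + B w w"
      using n sym' by (simp add: x'_eq form_simps m2_def)
    then show ?thesis using cross_B Bw by (simp add: algebra_simps)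
  qed
  have pos': "0 < B x' x'" by (rule form_pos[OF x'(2)])
  show ?thesis
  proof (rule order_trans[OF diff_right_mono[OF exact]])
    define d where "d = 2 * \<beta> * e + e\<^sup>2"
    have d: "0 \<le> d" using e \<beta> by (simp add: d_def)
    have r3: "m3 / m2 \<le> \<beta>" "0 \<le> m3 / m2" using m3 m2_pos by (simp_all add: field_simps)
    have "m3 / m2 * (m2 + d) = m3 + m3 / m2 * d" using m2_pos by (simp add: field_simps)
    also have "\<dots> \<le> m3 + \<beta> * d" by (intro add_left_mono mult_right_mono r3 d)
    finally have 1: "m3 / m2 * (m2 + d) - (2 * \<beta>\<^sup>2 * e + \<beta> * d) \<le> m3 - 2 * \<beta>\<^sup>2 * e" by simp
    define g where "g = (2 * \<beta>\<^sup>2 * e + \<beta> * d) / b\<^sup>2"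
    have g: "0 \<le> g" unfolding g_def using d e \<beta> by simp
    have "2 * \<beta>\<^sup>2 * e + \<beta> * d = g * b\<^sup>2" using b by (simp add: g_def)
    also have "\<dots> \<le> g * (m2 + d)" using m2 d g by (intro mult_left_mono) auto
    finally have "(m3 / m2 - g) * (m2 + d) \<le> m3 - 2 * \<beta>\<^sup>2 * e" using 1 by (simp add: algebra_simps)
    then have "(m3 / m2 - g) * (m2 + d) * n \<le> B (T x') x'"
      using num n by (meson less_imp_le mult_right_mono order_trans)
    moreover have "(m3 / m2 - g) * B x' x' \<le> B (T x') x'"
    proof (cases "0 \<le> m3 / m2 - g")
      case True
      then have "(m3 / m2 - g) * B x' x' \<le> (m3 / m2 - g) * ((m2 + d) * n)"
        using den by (intro mult_left_mono) (auto simp: d_def add.assoc)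
      then show ?thesis using calculation by (simp add: mult.assoc)
    next
      case False
      then have "(m3 / m2 - g) * B x' x' \<le> 0" using pos' by (simp add: mult_le_0_iff)
      then show ?thesis using psd[of x'] by simp
    qed
    then have "m3 / m2 - g \<le> quotient x'" using pos' by (simp add: quotient_def field_simps)
    moreover have "g = (4 * \<beta>\<^sup>2 * e + \<beta> * e\<^sup>2) / b\<^sup>2"
      by (simp add: g_def d_def power2_eq_square algebra_simps)
    ultimately show "m3 / m2 - (4 * \<beta>\<^sup>2 * e + \<beta> * e\<^sup>2) / b\<^sup>2 \<le> quotient x'" by simp
  qed
qed

lemma shift_bounded_below:
  assumes "b \<notin> eigenvalues T"
  obtains c where "0 < c" "\<And>x. c\<^sup>2 * B x x \<le> B (T x - b *\<^sub>R x) (T x - b *\<^sub>R x)"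
proof -
  let ?f = "\<lambda>x. T x - b *\<^sub>R x"
  have linf: "linear ?f" by (intro linear_compose_sub lin linear_scale_self)
  have "inj ?f" unfolding linear_injective_0[OF linf] using assms by (auto simp: eigenvalues_def)
  then obtain k where k: "k > 0" "\<And>x. k * norm x \<le> norm (?f x)"
    using linear_inj_bounded_below_pos[OF linf] by metis
  let ?c = "k * sqrt (lo / hi)"
  have "?c\<^sup>2 * B x x \<le> B (?f x) (?f x)" for x
  proof -
    have "?c\<^sup>2 * B x x = k\<^sup>2 * (lo / hi) * B x x" using lo hi_pos by (simp add: power_mult_distrib)
    also have "\<dots> \<le> k\<^sup>2 * (lo / hi) * (hi * (norm x)\<^sup>2)"
      using lo hi_pos form_le by (intro mult_left_mono) auto
    also have "\<dots> = lo * (k * norm x)\<^sup>2" using hi_pos by (simp add: power_mult_distrib)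
    also have "\<dots> \<le> lo * (norm (?f x))\<^sup>2" using k lo by (intro mult_left_mono power_mono) auto
    also have "\<dots> \<le> B (?f x) (?f x)" by (rule form_ge)
    finally show ?thesis .
  qed
  moreover have "0 < ?c" using k lo hi_pos by simp
  ultimately show thesis using that by blast
qed

lemma quotient_le_image:
  assumes "0 < b" "b \<le> quotient x" "x \<noteq> 0"
  shows "b\<^sup>2 * B x x \<le> B (T x) (T x)"
proof -
  have "b\<^sup>2 \<le> (quotient x)\<^sup>2" using assms by (intro power_mono) auto
  also have "\<dots> \<le> B (T x) (T x) / B x x" using var_nonneg[OF assms(3)] by (simp add: var_def)
  finally show ?thesis using form_pos[OF assms(3)] by (simp add: field_simps)
qed

context
  fixes x :: "nat \<Rightarrow> 'a" and e :: "nat \<Rightarrow> real"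
  assumes xU: "\<And>t. x t \<in> U" and x0: "\<And>t. x t \<noteq> 0"
    and e_nonneg: "\<And>t. 0 \<le> e t" and e_lim: "e \<longlonglongrightarrow> 0"
    and step: "\<And>t. B (x (Suc t) - T (x t)) (x (Suc t) - T (x t)) \<le> (e t)\<^sup>2 * B (x t) (x t)"
begin

lemma eventually_quotient_step:
  assumes "0 < b" "0 < \<kappa>"
  shows "\<forall>\<^sub>F t in sequentially. b \<le> quotient (x t) \<longrightarrow>
    quotient (x t) + var (x t) / \<beta> - \<kappa> \<le> quotient (x (Suc t))"
proof -
  have "(\<lambda>t. (4 * \<beta>\<^sup>2 * e t + \<beta> * (e t)\<^sup>2) / b\<^sup>2) \<longlonglongrightarrow> (4 * \<beta>\<^sup>2 * 0 + \<beta> * 0\<^sup>2) / b\<^sup>2"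
    by (intro tendsto_intros e_lim) (use assms in auto)
  then have "\<forall>\<^sub>F t in sequentially. (4 * \<beta>\<^sup>2 * e t + \<beta> * (e t)\<^sup>2) / b\<^sup>2 < \<kappa>"
    using assms by (intro order_tendstoD(2)[of _ 0]) auto
  then show ?thesis
  proof eventually_elim
    case (elim t)
    show ?case
    proof
      assume "b \<le> quotient (x t)"
      from quotient_step[OF xU x0 xU x0 assms(1) quotient_le_image[OF assms(1) this x0] e_nonneg step] elim
      show "quotient (x t) + var (x t) / \<beta> - \<kappa> \<le> quotient (x (Suc t))" by linarith
    qed
  qed
qed

text \<open>
  Near a value \<open>b\<close> that is not an eigenvalue the variance is bounded below, so the Rayleigh
  quotient cannot descend through \<open>b\<close> once the perturbation is small.
\<close>

lemma eventually_barrier: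
  assumes b: "0 < b" "b \<notin> eigenvalues T"
  obtains t0 where "\<And>t u. t0 \<le> t \<Longrightarrow> b \<le> quotient (x t) \<Longrightarrow> t \<le> u \<Longrightarrow> b \<le> quotient (x u)"
proof -
  obtain c where c: "0 < c" "\<And>x. c\<^sup>2 * B x x \<le> B (T x - b *\<^sub>R x) (T x - b *\<^sub>R x)"
    using shift_bounded_below[OF b(2)] by blast
  define \<kappa> where "\<kappa> = min (c / 2) (3 * c\<^sup>2 / (4 * \<beta>))"
  have \<kappa>: "0 < \<kappa>" using c \<beta> by (simp add: \<kappa>_def)
  obtain t0 where t0: "\<And>t. t0 \<le> t \<Longrightarrow> b \<le> quotient (x t) \<Longrightarrow>
      quotient (x t) + var (x t) / \<beta> - \<kappa> \<le> quotient (x (Suc t))"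
    using eventually_quotient_step[OF b(1) \<kappa>] unfolding eventually_sequentially by blast
  have one: "b \<le> quotient (x (Suc t))" if t: "t0 \<le> t" "b \<le> quotient (x t)" for t
  proof (cases "quotient (x t) \<le> b + c / 2")
    case True
    have "c\<^sup>2 * B (x t) (x t) \<le> (var (x t) + (quotient (x t) - b)\<^sup>2) * B (x t) (x t)"
      using c(2) form_shift[OF x0] by metis
    then have "c\<^sup>2 \<le> var (x t) + (quotient (x t) - b)\<^sup>2" using form_pos[OF x0] by simp
    moreover have "(quotient (x t) - b)\<^sup>2 \<le> (c / 2)\<^sup>2" using True t by (intro power_mono) auto
    ultimately have "3 * c\<^sup>2 / 4 \<le> var (x t)" by (simp add: power_divide)
    then have "3 * c\<^sup>2 / 4 / \<beta> \<le> var (x t) / \<beta>" using \<beta>(1) by (intro divide_right_mono) auto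
    then have "\<kappa> \<le> var (x t) / \<beta>" by (simp add: \<kappa>_def)
    then show ?thesis using t0[OF t] t by linarith
  next
    case False
    have "0 \<le> var (x t) / \<beta>" using var_nonneg[OF x0] \<beta>(1) by simp
    moreover have "\<kappa> \<le> c / 2" by (simp add: \<kappa>_def)
    ultimately show ?thesis using t0[OF t] False by linarith
  qed
  have "b \<le> quotient (x u)" if "t0 \<le> t" "b \<le> quotient (x t)" "t \<le> u" for t u
    using that(3,1,2) by (induction u rule: dec_induct) (auto intro: one)
  then show thesis using that by blast
qed

lemma non_eigenvalue_between:
  assumes "a < (b :: real)"
  obtains c where "a < c" "c < b" "c \<notin> eigenvalues T"
proof -
  have "finite (eigenvalues T)"
    by (rule finite_form_eigenvalues[OF bil form_pos self_adjoint])
  then have "\<not> {a<..<b} \<subseteq> eigenvalues T" using infinite_Ioo[OF assms] finite_subset by blast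
  then obtain c where "c \<in> {a<..<b}" "c \<notin> eigenvalues T" by blast
  then show thesis using that by auto
qed

text \<open>
  A limit point of the quotients is their limit, because there are barriers arbitrarily close to it
  on both sides.
\<close>

lemma quotient_convergent:
  obtains \<rho> where "0 \<le> \<rho>" "\<rho> \<le> \<beta>" "(\<lambda>t. quotient (x t)) \<longlonglongrightarrow> \<rho>"
proof -
  have range: "quotient (x t) \<in> {0..\<beta>}" for t using quotient_nonneg quotient_le[OF xU x0] by simp
  then obtain \<rho> \<phi> where \<rho>: "\<rho> \<in> {0..\<beta>}" "strict_mono (\<phi> :: nat \<Rightarrow> nat)"
    "((\<lambda>t. quotient (x t)) \<circ> \<phi>) \<longlonglongrightarrow> \<rho>"
    using compact_Icc[of 0 \<beta>] unfolding compact_def by metis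
  have "(\<lambda>t. quotient (x t)) \<longlonglongrightarrow> \<rho>"
  proof (rule order_tendstoI)
    fix a assume a: "a < \<rho>"
    show "\<forall>\<^sub>F t in sequentially. a < quotient (x t)"
    proof (cases "a < 0")
      case True
      then show ?thesis
        using quotient_nonneg by (intro always_eventually allI) (meson less_le_trans)
    next
      case False
      obtain b where b: "a < b" "b < \<rho>" "b \<notin> eigenvalues T"
        using non_eigenvalue_between[OF a] by blast
      then obtain t0 where t0: "\<And>t u. t0 \<le> t \<Longrightarrow> b \<le> quotient (x t) \<Longrightarrow> t \<le> u \<Longrightarrow> b \<le> quotient (x u)"
        using eventually_barrier[of b] False by (metis le_less_trans not_less)
      have "\<forall>\<^sub>F k in sequentially. b < quotient (x (\<phi> k))"
        using order_tendstoD(1)[OF \<rho>(3) b(2)] by (simp add: comp_def)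
      then have "\<forall>\<^sub>F k in sequentially. t0 \<le> k \<and> b < quotient (x (\<phi> k))"
        using eventually_ge_at_top[of t0] by (rule eventually_conj[rotated])
      then obtain k where k: "t0 \<le> k" "b < quotient (x (\<phi> k))"
        using eventually_happens'[OF sequentially_bot] by blast
      then have "t0 \<le> \<phi> k" using seq_suble[OF \<rho>(2), of k] by simp
      then have "b \<le> quotient (x u)" if "\<phi> k \<le> u" for u using t0 k that by auto
      then show ?thesis unfolding eventually_sequentially using b(1) by (meson less_le_trans)
    qed
  next
    fix a assume a: "\<rho> < a"
    obtain b where b: "\<rho> < b" "b < a" "b \<notin> eigenvalues T"
      using non_eigenvalue_between[OF a] by blast
    have "0 < b" using b \<rho>(1) by auto
    then obtain t0 where t0: "\<And>t u. t0 \<le> t \<Longrightarrow> b \<le> quotient (x t) \<Longrightarrow> t \<le> u \<Longrightarrow> b \<le> quotient (x u)"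
      using eventually_barrier[of b] b by metis
    have small: "\<forall>\<^sub>F k in sequentially. quotient (x (\<phi> k)) < b"
      using order_tendstoD(2)[OF \<rho>(3) b(1)] by (simp add: comp_def)
    have "quotient (x t) < b" if t: "t0 \<le> t" for t
    proof (rule ccontr)
      assume "\<not> quotient (x t) < b"
      then have all: "\<And>u. t \<le> u \<Longrightarrow> b \<le> quotient (x u)" using t0[OF t] by simp
      have "\<forall>\<^sub>F k in sequentially. t \<le> k \<and> quotient (x (\<phi> k)) < b"
        using eventually_ge_at_top[of t] small by (rule eventually_conj)
      then obtain k where "t \<le> k" "quotient (x (\<phi> k)) < b"
        using eventually_happens'[OF sequentially_bot] by blast
      then show False using all[of "\<phi> k"] seq_suble[OF \<rho>(2), of k] by simp
    qed
    then show "\<forall>\<^sub>F t in sequentially. quotient (x t) < a"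
      unfolding eventually_sequentially using b(2) by (meson less_trans)
  qed
  then show thesis using that \<rho>(1) by auto
qed

text \<open>
  If the quotients have a positive limit, their increments tend to zero and dominate the variance; if
  the limit is zero, the variance is at most \<open>\<beta>\<close> times the quotient.
\<close>

lemma var_tendsto_0: "(\<lambda>t. var (x t)) \<longlonglongrightarrow> 0"
proof -
  obtain \<rho> where \<rho>: "0 \<le> \<rho>" "(\<lambda>t. quotient (x t)) \<longlonglongrightarrow> \<rho>" using quotient_convergent by metis
  show ?thesis
  proof (cases "\<rho> = 0")
    case True
    have le: "var (x t) \<le> \<beta> * quotient (x t)" for t
    proof -
      have "var (x t) \<le> B (T (x t)) (T (x t)) / B (x t) (x t)" by (simp add: var_def)
      also have "\<dots> \<le> \<beta> * B (T (x t)) (x t) / B (x t) (x t)"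
        by (intro divide_right_mono image_le_energy xU form_nonneg)
      finally show ?thesis by (simp add: quotient_def)
    qed
    have lim: "(\<lambda>t. \<beta> * quotient (x t)) \<longlonglongrightarrow> 0" using tendsto_mult_left[OF \<rho>(2), of \<beta>] True by simp
    show ?thesis
      by (rule tendsto_sandwich[OF _ _ tendsto_const lim])
        (intro always_eventually allI var_nonneg x0 le)+
  next
    case False
    then have half: "0 < \<rho> / 2" "\<rho> / 2 < \<rho>" using \<rho>(1) by auto
    show ?thesis
    proof (rule order_tendstoI)
      fix a :: real assume "a < 0"
      then show "\<forall>\<^sub>F t in sequentially. a < var (x t)"
        using var_nonneg[OF x0] by (intro always_eventually allI) (meson less_le_trans)
    next
      fix a :: real assume a: "0 < a"
      define \<kappa> where "\<kappa> = a / (3 * \<beta>)"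
      have \<kappa>: "0 < \<kappa>" using a \<beta> by (simp add: \<kappa>_def)
      have "(\<lambda>t. quotient (x (Suc t)) - quotient (x t)) \<longlonglongrightarrow> \<rho> - \<rho>"
        by (intro tendsto_diff \<rho>(2) LIMSEQ_Suc)
      then have "\<forall>\<^sub>F t in sequentially. quotient (x (Suc t)) - quotient (x t) < \<kappa>"
        using \<kappa> by (intro order_tendstoD(2)) auto
      moreover have "\<forall>\<^sub>F t in sequentially. \<rho> / 2 < quotient (x t)"
        using \<rho>(2) half(2) by (rule order_tendstoD)
      moreover note eventually_quotient_step[OF half(1) \<kappa>]
      ultimately show "\<forall>\<^sub>F t in sequentially. var (x t) < a"
      proof eventually_elim
        case (elim t)
        then have "var (x t) / \<beta> < 2 * \<kappa>" by auto
        then have "var (x t) < 2 * \<kappa> * \<beta>" using \<beta>(1) by (simp add: field_simps)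
        also have "\<dots> < a" using a \<beta>(1) by (simp add: \<kappa>_def)
        finally show ?case .
      qed
    qed
  qed
qed

text \<open>
  The variance measures the distance of an iterate from being an eigenvector. As it vanishes in the
  limit, consecutive iterates become proportional.
\<close>

theorem power_iteration:
  obtains \<rho> where "0 \<le> \<rho>" "\<rho> \<le> \<beta>"
    "(\<lambda>t. B (x (Suc t) - \<rho> *\<^sub>R x t) (x (Suc t) - \<rho> *\<^sub>R x t) / B (x t) (x t)) \<longlonglongrightarrow> 0"
proof -
  obtain \<rho> where \<rho>: "0 \<le> \<rho>" "\<rho> \<le> \<beta>" "(\<lambda>t. quotient (x t)) \<longlonglongrightarrow> \<rho>" using quotient_convergent by metis
  let ?f = "\<lambda>t. B (x (Suc t) - \<rho> *\<^sub>R x t) (x (Suc t) - \<rho> *\<^sub>R x t) / B (x t) (x t)"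
  let ?g = "\<lambda>t. 2 * (e t)\<^sup>2 + 2 * (var (x t) + (quotient (x t) - \<rho>)\<^sup>2)"
  have "?g \<longlonglongrightarrow> 2 * 0\<^sup>2 + 2 * (0 + (\<rho> - \<rho>)\<^sup>2)"
    by (intro tendsto_intros e_lim var_tendsto_0 \<rho>(3))
  then have g: "?g \<longlonglongrightarrow> 0" by simp
  have le: "?f t \<le> ?g t" for t
  proof -
    define u where "u = x (Suc t) - T (x t)"
    define v where "v = T (x t) - \<rho> *\<^sub>R x t"
    have "x (Suc t) - \<rho> *\<^sub>R x t = u + v" by (simp add: u_def v_def)
    moreover have "B (u + v) (u + v) + B (u - v) (u - v) = 2 * B u u + 2 * B v v"
      by (simp add: form_simps)
    ultimately have "B (x (Suc t) - \<rho> *\<^sub>R x t) (x (Suc t) - \<rho> *\<^sub>R x t) \<le> 2 * B u u + 2 * B v v"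
      using form_nonneg[of "u - v"] by simp
    also have "\<dots> \<le> ?g t * B (x t) (x t)"
      using step[of t] form_shift[OF x0[of t], of \<rho>]
        unfolding u_def v_def by (simp add: algebra_simps)
    finally show ?thesis using form_pos[OF x0[of t]] by (simp add: field_simps)
  qed
  have "?f \<longlonglongrightarrow> 0"
    by (rule tendsto_sandwich[OF _ _ tendsto_const g])
      (intro always_eventually allI divide_nonneg_nonneg form_nonneg le)+
  then show thesis using that \<rho> by blast
qed

end

end

section \<open>Rank preservers near the identity\<close>

lemma rank_preserver_inverse:
  assumes M: "rank_preserver M"
  obtains M' where "rank_preserver M'" "\<And>x. M (M' x) = x" "\<And>x. M' (M x) = x"
proof -
  have lin: "linear M" and rk: "\<And>X. rank (M X) = rank X" using M by (auto simp: rank_preserver_def)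
  have "inj M" unfolding linear_injective_0[OF lin] using rk by (metis rank_eq_0)
  then obtain M' where M': "linear M'" "M' \<circ> M = id"
    using linear_injective_left_inverse[OF lin] by blast
  then have "M \<circ> M' = id" using linear_inverse_left[OF M'(1) lin] by blast
  then have 1: "M (M' x) = x" for x by (metis comp_apply id_apply)
  moreover have "M' (M x) = x" for x using M'(2) by (metis comp_apply id_apply)
  moreover have "rank_preserver M'" unfolding rank_preserver_def using M'(1) rk 1 by metis
  ultimately show thesis using that by blast
qed

lemma rank_preserver_compose:
  "rank_preserver M \<Longrightarrow> rank_preserver M' \<Longrightarrow> rank_preserver (\<lambda>X. M (M' X))"
  unfolding rank_preserver_def using linear_compose[of M' M] by (auto simp: comp_def)

lemma rank_invertible_mult:
  fixes P Q X :: "'q::finite mat"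
  assumes "invertible P" "invertible Q"
  shows "rank (P ** X ** Q) = rank X"
proof (rule antisym)
  show "rank (P ** X ** Q) \<le> rank X"
    using rank_mul_le_left[of "P ** X" Q] rank_mul_le_right[of P X] by linarith
  obtain P' where P': "P' ** P = mat 1" using assms(1) by (auto simp: invertible_def)
  obtain Q' where Q': "Q ** Q' = mat 1" using assms(2) by (auto simp: invertible_def)
  have "P' ** (P ** X ** Q) ** Q' = (P' ** P) ** X ** (Q ** Q')" by (simp only: matrix_mul_assoc)
  then have "X = P' ** (P ** X ** Q) ** Q'" by (simp add: P' Q')
  then show "rank X \<le> rank (P ** X ** Q)"
    using rank_mul_le_left[of "P' ** (P ** X ** Q)" Q'] rank_mul_le_right[of P' "P ** X ** Q"]
      by simp
qed

lemma invertible_one_plus: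
  fixes A :: "'q::finite mat"
  assumes "norm A < 1"
  shows "invertible (mat 1 + A)"
proof -
  have "v = 0" if "(mat 1 + A) *v v = 0" for v
  proof (rule ccontr)
    assume "v \<noteq> 0"
    have "v + A *v v = 0" using that by (simp add: matrix_vector_mult_add_rdistrib)
    then have "norm v = norm (A *v v)" by (metis add_eq_0_iff2 norm_minus_cancel)
    also have "\<dots> \<le> norm A * norm v" by (rule norm_matrix_vector_le)
    also have "\<dots> < norm v" using assms \<open>v \<noteq> 0\<close> by simp
    finally show False by simp
  qed
  then show ?thesis
    unfolding invertible_left_inverse matrix_left_invertible_ker by blast
qed

lemma outer_add_left: "outer (x + y) z = outer x z + outer y z"
  and outer_add_right: "outer x (y + z) = outer x y + outer x z"
  by (simp_all add: outer_def vec_eq_iff algebra_simps)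

lemma mat_mult_outer: "A ** outer u v = outer (A *v u) v"
  by (simp add: matrix_eq outer_mult_vector matrix_vector_mul_assoc[symmetric] matrix_vector_mult_scaleR)

lemma outer_mult_mat: "outer u v ** B = outer u (transpose B *v v)"
  by (simp add: matrix_eq outer_mult_vector matrix_vector_mul_assoc[symmetric] inner_transpose_vector)

lemma tangent_entry:
  fixes A B :: "'q::finite mat"
  shows "(A ** outer (axis i 1) (axis j 1) + outer (axis i 1) (axis j 1) ** B) $ k $ l
    = A $ k $ i * (if l = j then 1 else 0) + (if k = i then 1 else 0) * B $ j $ l"
  unfolding mat_mult_outer outer_mult_mat matrix_vector_mult_basis
  by (simp add: outer_def column_def transpose_def axis_def)

lemma norm_outer: "norm (outer u v) = norm u * norm v"
proof -
  have "(norm (outer u v))\<^sup>2 = (norm u * norm v)\<^sup>2"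
    unfolding norm_matrix_square power_mult_distrib
    unfolding power2_norm_eq_inner inner_vec_def
      by (simp add: outer_def power2_eq_square sum_product mult_ac) (rule sum.swap)
  then show ?thesis by (simp add: power2_eq_iff_nonneg)
qed

lemma abs_entry_le_norm: "\<bar>Y $ k $ l\<bar> \<le> norm Y" for Y :: "real^'n^'m"
  using component_le_norm_cart[of "Y $ k" l] Finite_Cartesian_Product.norm_nth_le[of Y k]
    by linarith

lemma norm_le_entries:
  fixes Y :: "'q::finite mat"
  assumes "\<And>k l. \<bar>Y $ k $ l\<bar> \<le> c" "0 \<le> c"
  shows "norm Y \<le> real CARD('q) * c"
proof (rule power2_le_imp_le)
  have "(Y $ i $ j)\<^sup>2 \<le> c\<^sup>2" for i j using assms power_mono[OF assms(1)[of i j], of 2] by simp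
  then have "(norm Y)\<^sup>2 \<le> (\<Sum>i\<in>(UNIV::'q set). \<Sum>j\<in>(UNIV::'q set). c\<^sup>2)"
    unfolding norm_matrix_square by (intro sum_mono)
  then show "(norm Y)\<^sup>2 \<le> (real CARD('q) * c)\<^sup>2" by (simp add: power2_eq_square mult_ac)
qed (use assms in simp)

lemma norm_linop_mat_le:
  fixes E :: "('q::finite mat, 'b::euclidean_space) linop"
  assumes "\<And>Y. rank Y \<le> 1 \<Longrightarrow> norm (app E Y) \<le> c * norm Y" "0 \<le> c"
  shows "norm E \<le> real CARD('q) * c"
proof (rule power2_le_imp_le)
  have "norm (app E b) \<le> c" if "b \<in> Basis" for b
    using that assms(1)[of b]
      by (metis Basis_matrix_outer mult.right_neutral norm_Basis rank_outer_le)
  then have "(norm E)\<^sup>2 \<le> real DIM('q mat) * c\<^sup>2" by (rule norm_linop_le_basis)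
  then show "(norm E)\<^sup>2 \<le> (real CARD('q) * c)\<^sup>2" by (simp add: power2_eq_square mult_ac)
qed (use assms in simp)

lemma W_space_iff:
  fixes w :: "('q::finite mat, 'q mat) linop"
  shows "w \<in> W_space \<longleftrightarrow> (\<exists>A B. \<forall>Y. app w Y = A ** Y + Y ** B)"
proof
  have lin: "linear (\<lambda>Y. A ** Y + Y ** B)" for A B :: "'q mat"
    by (rule linearI) (simp_all add: mat_mult_distrib scaleR_right_distrib)
  have form: "mat_kron (mat 1) W1 Y + mat_kron W2 (mat 1) Y = W1 ** Y + Y ** transpose W2"
    for W1 W2 Y :: "'q mat"
    by (simp add: mat_kron_def)
  {
    assume "w \<in> W_space"
    then show "\<exists>A B. \<forall>Y. app w Y = A ** Y + Y ** B"
      unfolding W_space_def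
    proof (induction rule: span_induct)
      case base
      show ?case unfolding subspace_def
      proof safe
        show "\<exists>A B. \<forall>Y. app (0 :: ('q mat, 'q mat) linop) Y = A ** Y + Y ** B"
          by (intro exI[of _ 0]) simp
        fix u v :: "('q mat, 'q mat) linop" and A B A' B' and c :: real
        assume *: "\<forall>Y. app u Y = A ** Y + Y ** B"
        show "\<exists>A B. \<forall>Y. app (c *\<^sub>R u) Y = A ** Y + Y ** B"
          by (intro exI[of _ "c *\<^sub>R A"] exI[of _ "c *\<^sub>R B"]) (simp add: * mat_mult_distrib scaleR_right_distrib)
        assume "\<forall>Y. app v Y = A' ** Y + Y ** B'"
        then show "\<exists>A B. \<forall>Y. app (u + v) Y = A ** Y + Y ** B"
          by (intro exI[of _ "A + A'"] exI[of _ "B + B'"]) (simp add: * mat_mult_distrib)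
      qed
    next
      case (step u)
      then obtain W1 W2 :: "'q mat" where "u = Linop (\<lambda>Y. W1 ** Y + Y ** transpose W2)"
        unfolding form by blast
      then have "\<forall>Y. app u Y = W1 ** Y + Y ** transpose W2" by (simp add: app_Linop[OF lin])
      then show ?case by blast
    qed
  next
    assume "\<exists>A B. \<forall>Y. app w Y = A ** Y + Y ** B"
    then obtain A B where AB: "\<And>Y. app w Y = A ** Y + Y ** B" by blast
    then have "w = Linop (\<lambda>Y. A ** Y + Y ** transpose (transpose B))"
      by (intro linop_eqI) (simp add: app_Linop[OF lin])
    then show "w \<in> W_space"
      unfolding W_space_def form by (intro span_base) blast
  }
qed

lemma subspace_W_space: "subspace W_space"
  unfolding W_space_def by (rule subspace_span)

lemma rank_app_W_space: "w \<in> W_space \<Longrightarrow> rank (app w Y) \<le> 2 * rank Y"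
proof -
  assume "w \<in> W_space"
  then obtain A B where "app w Y = A ** Y + Y ** B" by (auto simp: W_space_iff)
  then show ?thesis
    using rank_add_le[of "A ** Y" "Y ** B"] rank_mul_le_right[of A Y] rank_mul_le_left[of Y B]
      by simp
qed

lemma app_W_space_tangent: "w \<in> W_space \<Longrightarrow> app w Y \<in> tangent_space Y"
  unfolding W_space_iff tangent_space_def by (auto simp: add.commute)

lemma W_space_coordinates:
  fixes w :: "('q::finite mat, 'q mat) linop"
  assumes "w \<in> W_space"
  obtains A B where "\<And>Y. app w Y = A ** Y + Y ** B"
    "norm A \<le> 2 * real CARD('q) * norm w" "norm B \<le> 2 * real CARD('q) * norm w"
proof -
  obtain A0 B0 where w0: "\<And>Y. app w Y = A0 ** Y + Y ** B0" using assms by (auto simp: W_space_iff)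
  obtain o' :: 'q where True by blast
  \<comment> \<open>The pair is unique up to a multiple of the identity, fixed here by making one diagonal entry of \<open>B\<close> vanish.\<close>
  define A where "A = A0 + mat (B0 $ o' $ o')"
  define B where "B = B0 - mat (B0 $ o' $ o')"
  have mat: "mat c ** Y = c *\<^sub>R Y" "Y ** mat c = c *\<^sub>R Y" for c and Y :: "'q mat"
    by (simp_all add: matrix_matrix_mult_def mat_def vec_eq_iff if_distrib if_distribR sum.delta' cong: if_cong)
  have w: "app w Y = A ** Y + Y ** B" for Y
    by (simp add: w0 A_def B_def mat_mult_distrib mat)
  have B0: "B $ o' $ o' = 0" by (simp add: B_def mat_def)
  let ?E = "\<lambda>i j. outer (axis i 1) (axis j 1) :: 'q mat"
  have ent: "app w (?E i j) $ k $ l = A $ k $ i * (if l = j then 1 else 0) + (if k = i then 1 else 0) * B $ j $ l"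
    for i j k l
    unfolding w by (rule tangent_entry)
  have bd: "\<bar>app w (?E i j) $ k $ l\<bar> \<le> norm w" for i j k l
  proof -
    have "\<bar>app w (?E i j) $ k $ l\<bar> \<le> norm (app w (?E i j))" by (rule abs_entry_le_norm)
    also have "\<dots> \<le> norm w * norm (?E i j)" by (rule norm_app_le)
    finally show ?thesis by (simp add: norm_outer)
  qed
  have Abd: "\<bar>A $ k $ i\<bar> \<le> norm w" for k i
    using bd[of i o' k o'] ent[of i o' k o'] B0 by (auto split: if_splits)
  have Bbd: "\<bar>B $ j $ l\<bar> \<le> 2 * norm w" for j l
    using bd[of o' j o' l] ent[of o' j o' l] Abd[of o' o'] by (auto split: if_splits)
  have "norm A \<le> real CARD('q) * (2 * norm w)"
    by (rule norm_le_entries) (auto intro: order_trans[OF Abd])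
  moreover have "norm B \<le> real CARD('q) * (2 * norm w)"
    by (rule norm_le_entries) (use Bbd in auto)
  ultimately show thesis using that[OF w] by (simp add: mult_ac)
qed

text \<open>
  Moving along \<open>W_space\<close> is undone by the rank preserver \<open>Y \<mapsto> (1 + A) Y (1 + B)\<close> up to second order.
\<close>

lemma absorb_W_space:
  fixes L G :: "('q::finite mat, real^'d::finite) linop" and w :: "('q mat, 'q mat) linop"
  assumes w: "\<And>Y. app w Y = A ** Y + Y ** B" and A: "norm A \<le> a" and B: "norm B \<le> a"
    and a: "6 * real CARD('q) * a \<le> 1"
  obtains M G' where "rank_preserver M" "\<And>Y. app (L + lcomp L w + G) Y = app (L + G') (M Y)"
    "norm (G' - G) \<le> real CARD('q) * onorm (app L) * a\<^sup>2 + 3 * real CARD('q) * a * norm G'"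
proof -
  have a0: "0 \<le> a" using A norm_ge_zero order_trans by blast
  have q1: "1 \<le> real CARD('q)" by (simp add: Suc_leI)
  have "6 * a \<le> 6 * real CARD('q) * a" using a0 q1 mult_right_mono[OF q1 a0] by simp
  then have a1: "6 * a \<le> 1" using a by linarith
  define M where "M Y = (mat 1 + A) ** Y ** (mat 1 + B)" for Y
  have M_eq: "M Y = Y + (app w Y + A ** Y ** B)" for Y
    by (simp add: M_def w mat_mult_distrib matrix_mul_assoc)
  have linM: "linear M"
    unfolding M_def by (rule linearI) (simp_all add: mat_mult_distrib scaleR_right_distrib)
  have "invertible (mat 1 + A)" "invertible (mat 1 + B)"
    using A B a1 by (auto intro!: invertible_one_plus)
  then have M: "rank_preserver M"
    unfolding rank_preserver_def using linM by (simp add: M_def rank_invertible_mult)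
  then obtain M' where M': "rank_preserver M'" "\<And>x. M (M' x) = x" "\<And>x. M' (M x) = x"
    using rank_preserver_inverse by blast
  define G' where "G' = Linop (app (L + lcomp L w + G) \<circ> M') - L"
  have "linear (app (L + lcomp L w + G) \<circ> M')"
    using M'(1) by (intro linear_compose linear_app) (simp add: rank_preserver_def)
  then have rep: "app (L + lcomp L w + G) Y = app (L + G') (M Y)" for Y
    by (simp add: G'_def app_Linop M'(3))
  define K where "K = Linop (\<lambda>Y. app L (A ** Y ** B))"
  have "linear (\<lambda>Y. app L (A ** Y ** B))"
    by (rule linearI) (simp_all add: mat_mult_distrib app_add_arg app_scale_arg)
  then have K: "app K Y = app L (A ** Y ** B)" for Y by (simp add: K_def app_Linop)
  define H where "H = Linop (\<lambda>Y. app G' (app w Y + A ** Y ** B))"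
  have "linear (\<lambda>Y. app G' (app w Y + A ** Y ** B))"
    by (rule linearI) (simp_all add: mat_mult_distrib app_add_arg app_scale_arg scaleR_right_distrib)
  then have H: "app H Y = app G' (app w Y + A ** Y ** B)" for Y by (simp add: H_def app_Linop)
  have "G' - G = - K - H"
  proof (rule linop_eqI)
    fix Y
    show "app (G' - G) Y = app (- K - H) Y"
      using rep[of Y] by (simp add: K H M_eq app_add_arg algebra_simps)
  qed
  then have "norm (G' - G) \<le> norm K + norm H" using norm_triangle_ineq4[of "- K" H] by simp
  have AYB: "norm (A ** Y ** B) \<le> a\<^sup>2 * norm Y" for Y
  proof -
    have "norm (A ** Y ** B) \<le> norm (A ** Y) * norm B" by (rule norm_matrix_mult_le)
    also have "\<dots> \<le> (norm A * norm Y) * norm B" by (intro mult_right_mono norm_matrix_mult_le) simp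
    also have "\<dots> \<le> (a * norm Y) * a" using A B a0 by (intro mult_mono) auto
    finally show ?thesis by (simp add: power2_eq_square mult_ac)
  qed
  have wY: "norm (app w Y) \<le> 2 * a * norm Y" for Y
  proof -
    have "norm (app w Y) \<le> norm A * norm Y + norm Y * norm B"
      unfolding w by (intro norm_triangle_le add_mono norm_matrix_mult_le)
    also have "\<dots> \<le> a * norm Y + norm Y * a"
      using A B by (intro add_mono mult_right_mono mult_left_mono) auto
    finally show ?thesis by simp
  qed
  have "norm K \<le> real CARD('q) * (onorm (app L) * a\<^sup>2)"
  proof (rule norm_linop_mat_le)
    fix Y :: "'q mat"
    have "norm (app K Y) \<le> onorm (app L) * norm (A ** Y ** B)"
      unfolding K by (rule onorm[OF bounded_linear_app])
    also have "\<dots> \<le> onorm (app L) * (a\<^sup>2 * norm Y)"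
      by (intro mult_left_mono AYB onorm_pos_le bounded_linear_app)
    finally show "norm (app K Y) \<le> onorm (app L) * a\<^sup>2 * norm Y" by simp
  qed (simp add: onorm_pos_le bounded_linear_app)
  moreover have "norm H \<le> real CARD('q) * (3 * a * norm G')"
  proof (rule norm_linop_mat_le)
    fix Y :: "'q mat"
    have "a\<^sup>2 \<le> a" using a0 a1 by (simp add: power2_eq_square mult_left_le)
    then have "a\<^sup>2 * norm Y \<le> a * norm Y" by (rule mult_right_mono) simp
    then have "norm (app w Y + A ** Y ** B) \<le> 3 * a * norm Y"
      using norm_triangle_ineq[of "app w Y" "A ** Y ** B"] wY[of Y] AYB[of Y] by linarith
    then have "norm (app H Y) \<le> norm G' * (3 * a * norm Y)"
      unfolding H by (rule order_trans[OF norm_app_le mult_left_mono]) simp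
    then show "norm (app H Y) \<le> 3 * a * norm G' * norm Y" by (simp add: mult_ac)
  qed (use a0 in simp)
  ultimately have "norm (G' - G) \<le> real CARD('q) * onorm (app L) * a\<^sup>2 + 3 * real CARD('q) * a * norm G'"
    using \<open>norm (G' - G) \<le> norm K + norm H\<close> by (simp add: mult_ac)
  then show thesis using that M rep by blast
qed

lemma rank_le_1_outer:
  fixes Y :: "real^'n^'m"
  assumes "rank Y \<le> 1"
  obtains x z where "Y = outer x z"
proof (cases "Y = 0")
  case True
  then have "Y = outer 0 0" by (simp add: outer_def vec_eq_iff)
  then show thesis by (rule that)
next
  case False
  then obtain v where v: "Y *v v \<noteq> 0" by (auto simp: matrix_eq)
  define x where "x = Y *v v"
  have "span {x} = range ((*v) Y)"
  proof (rule subspace_dim_equal)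
    show "subspace (range ((*v) Y))"
      by (intro linear_subspace_image matrix_vector_mul_linear subspace_UNIV)
    then show "span {x} \<subseteq> range ((*v) Y)" by (intro span_minimal) (auto simp: x_def)
    show "dim (range ((*v) Y)) \<le> dim (span {x})"
      using assms v by (simp add: rank_dim_range dim_eq_card_independent x_def)
  qed simp
  then have "Y *v w \<in> span {x}" for w by blast
  then have "\<forall>w. \<exists>k. Y *v w = k *\<^sub>R x" unfolding span_singleton by blast
  then obtain k where k: "\<And>w. Y *v w = k w *\<^sub>R x" by metis
  have "Y = outer x ((1 / (x \<bullet> x)) *\<^sub>R (transpose Y *v x))"
  proof (subst matrix_eq, rule allI)
    fix w
    have "x \<bullet> (Y *v w) = k w * (x \<bullet> x)" by (simp add: k)
    then have "k w = (x \<bullet> (Y *v w)) / (x \<bullet> x)" using v by (simp add: x_def)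
    then show "Y *v w = outer x ((1 / (x \<bullet> x)) *\<^sub>R (transpose Y *v x)) *v w"
      by (simp add: outer_mult_vector inner_transpose_vector k[of w])
  qed
  then show thesis by (rule that)
qed

text \<open>
  If \<open>a\<close> is orthogonal to \<open>u\<close> and \<open>b\<close> to \<open>v\<close>, then \<open>outer a b\<close> is normal to the tangent space at
  \<open>outer u v\<close>, and this is the component of \<open>app D (outer u v)\<close> along it.
\<close>

definition normal_entry :: "('q::finite mat, 'q mat) linop \<Rightarrow> ((real^'q) \<times> (real^'q)) \<times> ((real^'q) \<times> (real^'q)) \<Rightarrow> real"
  where "normal_entry D = (\<lambda>((u, v), (a, b)). a \<bullet> (app D (outer u v) *v b))"

text \<open>
  A finite family of vectors whose normal entries already detect \<open>W_space\<close>; finiteness makes the sum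
  over all tests a continuous function.
\<close>

definition test_vectors :: "(real^'q::finite) set"
  where "test_vectors = (\<lambda>(i, k, c). axis i 1 + c *\<^sub>R axis k 1) ` (UNIV \<times> UNIV \<times> {-1, 0, 1})"

definition normal_tests :: "(((real^'q::finite) \<times> (real^'q)) \<times> ((real^'q) \<times> (real^'q))) set"
  where "normal_tests = {((u, v), (a, b)) | u v a b. {u, v, a, b} \<subseteq> test_vectors \<and> u \<bullet> a = 0 \<and> v \<bullet> b = 0}"

lemma test_vectors: "axis i 1 \<in> test_vectors" "axis i 1 + axis k 1 \<in> test_vectors"
  "axis i 1 - axis k 1 \<in> test_vectors"
proof -
  show "axis i 1 \<in> test_vectors"
    unfolding test_vectors_def by (rule image_eqI[of _ _ "(i, i, 0)"]) auto
  show "axis i 1 + axis k 1 \<in> test_vectors"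
    unfolding test_vectors_def by (rule image_eqI[of _ _ "(i, k, 1)"]) auto
  show "axis i 1 - axis k 1 \<in> test_vectors"
    unfolding test_vectors_def by (rule image_eqI[of _ _ "(i, k, -1)"]) auto
qed

lemma finite_normal_tests: "finite (normal_tests :: (((real^'q::finite) \<times> (real^'q)) \<times> ((real^'q) \<times> (real^'q))) set)"
proof -
  have "finite (test_vectors :: (real^'q) set)" by (simp add: test_vectors_def)
  then have "finite ((test_vectors \<times> test_vectors) \<times> (test_vectors \<times> test_vectors) :: (((real^'q) \<times> (real^'q)) \<times> ((real^'q) \<times> (real^'q))) set)"
    by (intro finite_cartesian_product)
  then show ?thesis by (rule rev_finite_subset) (auto simp: normal_tests_def)
qed

lemma linear_normal_entry: "linear (\<lambda>D. normal_entry D \<tau>)"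
  by (cases \<tau> rule: prod.exhaust, rule linearI)
    (auto simp: normal_entry_def split_beta matrix_vector_mult_add_rdistrib inner_add_right scaleR_matrix_vector_assoc[symmetric])

lemma normal_entry_W_space: "w \<in> W_space \<Longrightarrow> \<tau> \<in> normal_tests \<Longrightarrow> normal_entry w \<tau> = 0"
  unfolding W_space_iff normal_tests_def normal_entry_def
  by (auto simp: mat_mult_outer outer_mult_mat matrix_vector_mult_add_rdistrib outer_mult_vector inner_add_right
      inner_commute)

text \<open>
  Vanishing normal entries say that \<open>D\<close> maps rank-one matrices into their tangent spaces. Tested on
  matrix units and their sums, this determines \<open>A\<close> and \<open>B\<close> with \<open>app D Y = A Y + Y B\<close> entry by entry.
\<close>

lemma W_space_if_normal_entries_vanish:
  fixes D :: "('q::finite mat, 'q mat) linop"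
  assumes D: "\<And>\<tau>. \<tau> \<in> normal_tests \<Longrightarrow> normal_entry D \<tau> = 0"
  shows "D \<in> W_space"
proof -
  let ?e = "\<lambda>i. axis i 1 :: real^'q"
  define h where "h u v a b = a \<bullet> (app D (outer u v) *v b)" for u v a b
  have h0: "h u v a b = 0" if "u \<in> test_vectors" "v \<in> test_vectors" "a \<in> test_vectors"
    "b \<in> test_vectors"
     "u \<bullet> a = 0" "v \<bullet> b = 0" for u v a b
  proof -
    have "((u, v), (a, b)) \<in> normal_tests" using that by (auto simp: normal_tests_def)
    from D[OF this] show ?thesis by (simp add: normal_entry_def h_def)
  qed
  define d where "d i j k l = h (?e i) (?e j) (?e k) (?e l)" for i j k l
  have ent: "app D (outer (?e i) (?e j)) $ k $ l = d i j k l" for i j k l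
    by (simp add: d_def h_def inner_axis' matrix_vector_mult_basis column_def)
  have h_lin: "h (u + u') v a b = h u v a b + h u' v a b"
    "h u (v + v') a b = h u v a b + h u v' a b"
    "h u v (a - a') b = h u v a b - h u v a' b" "h u v a (b - b') = h u v a b - h u v a b'"
      for u u' v v' a a' b b'
    by (simp_all add: h_def outer_add_left outer_add_right app_add_arg matrix_vector_mult_add_rdistrib
        inner_add_right inner_diff_left inner_diff_right matrix_vector_mult_diff_distrib)
  \<comment> \<open>Outside row \<open>i\<close> and column \<open>j\<close> the image of the \<open>(i, j)\<close> matrix unit vanishes; the entries in its
    column depend only on \<open>i, k\<close>, those in its row only on \<open>j, l\<close>, and the entry at \<open>(i, j)\<close> is a
    function of \<open>i\<close> plus a function of \<open>j\<close>.\<close>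
  have Z1: "d i j k l = 0" if "k \<noteq> i" "l \<noteq> j" for i j k l
    unfolding d_def by (rule h0) (use that in \<open>auto simp: test_vectors inner_axis_axis\<close>)
  have Z2: "d i j k j = d i l k l" if "k \<noteq> i" for i j k l
  proof (cases "l = j")
    case False
    have "h (?e i) (?e j + ?e l) (?e k) (?e j - ?e l) = 0"
      by (rule h0) (use that in \<open>auto simp: test_vectors inner_axis_axis inner_add_left inner_diff_right\<close>)
    then show ?thesis
      using Z1[of k i l j] Z1[of k i j l] that False by (simp add: h_lin d_def[symmetric])
  qed simp
  have Z3: "d i j i l = d k j k l" if "l \<noteq> j" for i j k l
  proof (cases "k = i")
    case False
    have "h (?e i + ?e k) (?e j) (?e i - ?e k) (?e l) = 0"
      by (rule h0) (use that in \<open>auto simp: test_vectors inner_axis_axis inner_add_left inner_diff_right\<close>)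
    then show ?thesis
      using Z1[of k i l j] Z1[of i k l j] that False by (simp add: h_lin d_def[symmetric])
  qed simp
  have Z4: "d i j i j - d i l i l - d k j k j + d k l k l = 0" for i j k l
  proof (cases "k = i \<or> l = j")
    case False
    have "h (?e i + ?e k) (?e j + ?e l) (?e i - ?e k) (?e j - ?e l) = 0"
      by (rule h0) (auto simp: test_vectors inner_axis_axis inner_add_left inner_diff_right)
    moreover have ne: "k \<noteq> i" "i \<noteq> k" "l \<noteq> j" "j \<noteq> l" using False by auto
    moreover note Z1[OF ne(1,3)] Z1[OF ne(2,3)] Z1[OF ne(1,4)] Z1[OF ne(2,4)]
        Z2[OF ne(1), of j l] Z2[OF ne(2), of j l] Z3[OF ne(3), of i k] Z3[OF ne(4), of i k]
    ultimately show ?thesis by (simp add: h_lin d_def[symmetric])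
  qed auto
  obtain o' :: 'q where True by blast
  define A :: "'q mat" where "A = (\<chi> k i. d i o' k o' - (if k = i then d o' o' o' o' else 0))"
  define B :: "'q mat" where "B = (\<chi> j l. d o' j o' l)"
  have lin: "linear (\<lambda>Y. A ** Y + Y ** B)"
    by (rule linearI) (simp_all add: mat_mult_distrib scaleR_right_distrib)
  have "app D Y = A ** Y + Y ** B" for Y
  proof (rule fun_cong[OF linear_eq_stdbasis[OF linear_app lin]])
    fix b :: "'q mat" assume "b \<in> Basis"
    then obtain i j where b: "b = outer (?e i) (?e j)" by (rule Basis_matrix_outer)
    have rhs: "(A ** b + b ** B) $ k $ l = A $ k $ i * (if l = j then 1 else 0) + (if k = i then 1 else 0) * B $ j $ l"
      for k l
      unfolding b by (rule tangent_entry)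
    have "app D b $ k $ l = (A ** b + b ** B) $ k $ l" for k l
      unfolding rhs unfolding b ent
      using Z1[of k i l j] Z2[of k i j o'] Z3[of l j i o'] Z4[of i j o' o']
      by (cases "k = i"; cases "l = j") (simp_all add: A_def B_def)
    then show "app D b = A ** b + b ** B" by (simp add: vec_eq_iff)
  qed
  then show ?thesis unfolding W_space_iff by blast
qed

text \<open>
  The sum of all normal entries is a norm on the orthogonal complement of \<open>W_space\<close>, hence bounded
  below on its unit sphere by compactness, and it does not change when an element of \<open>W_space\<close> is
  subtracted.
\<close>

lemma distance_W_space:
  obtains c where "0 \<le> c"
    "\<And>D :: ('q::finite mat, 'q mat) linop. norm (D - proj W_space D) \<le> c * (\<Sum>\<tau>\<in>normal_tests. \<bar>normal_entry D \<tau>\<bar>)"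
proof -
  let ?W = "W_space :: ('q mat, 'q mat) linop set"
  define p where "p D = (\<Sum>\<tau>\<in>normal_tests. \<bar>normal_entry D \<tau>\<bar>)" for D :: "('q mat, 'q mat) linop"
  let ?S = "sphere 0 1 \<inter> ?W\<^sup>\<bottom>"
  have comp: "compact ?S"
    by (intro compact_Int_closed closed_subspace subspace_orthogonal_comp) auto
  have cont: "continuous_on ?S p" unfolding p_def
    by (intro continuous_intros linear_continuous_on linear_conv_bounded_linear[THEN iffD1] linear_normal_entry)
  have p_diff: "p (D - w) = p D" if "w \<in> ?W" for D w
    unfolding p_def using normal_entry_W_space[OF that]
      by (intro sum.cong) (auto simp: linear_diff[OF linear_normal_entry])
  have p_scale: "p (c *\<^sub>R D) = \<bar>c\<bar> * p D" for c D
    unfolding p_def by (simp add: linear_cmul[OF linear_normal_entry] abs_mult sum_distrib_left)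
  have p_nonneg: "0 \<le> p D" for D unfolding p_def by (simp add: sum_nonneg)
  have p_0: "D \<in> ?W" if "p D = 0" for D
    using that unfolding p_def by (intro W_space_if_normal_entries_vanish)
      (simp add: sum_nonneg_eq_0_iff finite_normal_tests)
  show thesis
  proof (cases "?S = {}")
    case True
    have "D - proj ?W D = 0" for D
    proof (rule ccontr)
      assume n: "D - proj ?W D \<noteq> 0"
      have "(1 / norm (D - proj ?W D)) *\<^sub>R (D - proj ?W D) \<in> ?S"
        using n proj_orthogonal[OF subspace_W_space, of D]
        by (auto intro: subspace_scale[OF subspace_orthogonal_comp])
      then show False using True by blast
    qed
    then show thesis using that[of 0] by simp
  next
    case False
    then obtain E where E: "E \<in> ?S" "\<And>F. F \<in> ?S \<Longrightarrow> p E \<le> p F"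
      using continuous_attains_inf[OF comp _ cont] by blast
    have "p E \<noteq> 0"
    proof
      assume "p E = 0"
      then have "E \<in> ?W" by (rule p_0)
      then have "E \<bullet> E = 0" using E(1) by (auto simp: orthogonal_comp_def orthogonal_def)
      then show False using E(1) by auto
    qed
    then have pos: "0 < p E" using p_nonneg[of E] by simp
    have "norm (D - proj ?W D) \<le> 1 / p E * p D" for D
    proof (cases "D - proj ?W D = 0")
      case True
      then show ?thesis using p_nonneg pos by simp
    next
      case n: False
      let ?F = "D - proj ?W D"
      have "(1 / norm ?F) *\<^sub>R ?F \<in> ?S"
        using n proj_orthogonal[OF subspace_W_space, of D]
        by (auto intro: subspace_scale[OF subspace_orthogonal_comp])
      from E(2)[OF this] have "p E \<le> 1 / norm ?F * p D"
        by (simp add: p_scale p_diff proj_in subspace_W_space)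
      then show ?thesis using n pos by (simp add: field_simps)
    qed
    then show thesis using that[of "1 / p E"] pos unfolding p_def by simp
  qed
qed

text \<open>
  The \<open>2 \<times> 2\<close> minors of \<open>outer u v + E\<close> vanish. One of them pairs the normal entry of \<open>E\<close> with an entry
  close to \<open>(norm u * norm v)\<^sup>2\<close> against a product of two entries of \<open>E\<close>.
\<close>

lemma normal_entry_quadratic:
  fixes E :: "'q::finite mat"
  assumes rank: "rank (outer u v + E) \<le> 1" and orth: "u \<bullet> a = 0" "v \<bullet> b = 0"
    and E: "norm E \<le> t * (norm u * norm v)" and t: "0 \<le> t" "t \<le> 1 / 2" and nz: "u \<noteq> 0" "v \<noteq> 0"
  shows "\<bar>a \<bullet> (E *v b)\<bar> \<le> 2 * t\<^sup>2 * (norm u * norm v * norm a * norm b)"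
proof -
  obtain x z where xz: "outer u v + E = outer x z" using rank_le_1_outer[OF rank] .
  have minor: "(u \<bullet> (outer x z *v v)) * (a \<bullet> (outer x z *v b)) = (u \<bullet> (outer x z *v b)) * (a \<bullet> (outer x z *v v))"
    by (simp add: outer_mult_vector)
  have ab: "a \<bullet> (outer x z *v b) = a \<bullet> (E *v b)" "u \<bullet> (outer x z *v b) = u \<bullet> (E *v b)"
    "a \<bullet> (outer x z *v v) = a \<bullet> (E *v v)"
      "u \<bullet> (outer x z *v v) = (norm u)\<^sup>2 * (norm v)\<^sup>2 + u \<bullet> (E *v v)"
    unfolding xz[symmetric] matrix_vector_mult_add_rdistrib outer_mult_vector
    using orth by (simp_all add: inner_add_right inner_commute power2_norm_eq_inner)
  have cs: "\<bar>y \<bullet> (E *v y')\<bar> \<le> t * (norm u * norm v) * (norm y * norm y')" for y y'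
  proof -
    have "\<bar>y \<bullet> (E *v y')\<bar> \<le> norm y * norm (E *v y')" by (rule Cauchy_Schwarz_ineq2)
    also have "\<dots> \<le> norm y * (norm E * norm y')" by (intro mult_left_mono norm_matrix_vector_le) simp
    also have "\<dots> = norm E * (norm y * norm y')" by simp
    also have "\<dots> \<le> t * (norm u * norm v) * (norm y * norm y')" by (intro mult_right_mono E) simp
    finally show ?thesis .
  qed
  define m where "m = norm u * norm v"
  have m: "0 < m" using nz by (simp add: m_def)
  have "\<bar>u \<bullet> (E *v v)\<bar> \<le> t * m * m" using cs[of u v] by (simp add: m_def)
  also have "\<dots> \<le> 1 / 2 * m * m" using t m by (intro mult_right_mono) auto
  finally have "\<bar>u \<bullet> (E *v v)\<bar> \<le> 1 / 2 * m\<^sup>2" by (simp add: power2_eq_square)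
  then have low: "1 / 2 * m\<^sup>2 \<le> u \<bullet> (outer x z *v v)"
    unfolding ab m_def power_mult_distrib by linarith
  have "1 / 2 * m\<^sup>2 * \<bar>a \<bullet> (E *v b)\<bar> \<le> \<bar>(u \<bullet> (outer x z *v v)) * (a \<bullet> (outer x z *v b))\<bar>"
    unfolding abs_mult ab(1) using low by (intro mult_right_mono) auto
  also have "\<dots> = \<bar>(u \<bullet> (outer x z *v b)) * (a \<bullet> (outer x z *v v))\<bar>" by (simp only: minor)
  also have "\<dots> = \<bar>u \<bullet> (E *v b)\<bar> * \<bar>a \<bullet> (E *v v)\<bar>" by (simp only: ab abs_mult)
  also have "\<dots> \<le> (t * m * (norm u * norm b)) * (t * m * (norm a * norm v))"
    using cs[of u b] cs[of a v] t m by (intro mult_mono) (auto simp: m_def)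
  also have "\<dots> = (1 / 2 * m\<^sup>2) * (2 * t\<^sup>2 * (m * norm a * norm b))"
    by (simp add: power2_eq_square m_def)
  finally have "1 / 2 * m\<^sup>2 * \<bar>a \<bullet> (E *v b)\<bar> \<le> 1 / 2 * m\<^sup>2 * (2 * t\<^sup>2 * (m * norm a * norm b))" .
  moreover have "0 < 1 / 2 * m\<^sup>2" using m by simp
  ultimately show ?thesis unfolding m_def[symmetric] using mult_le_cancel_left_pos by blast
qed

text \<open>
  Applied to \<open>M Y - Y\<close> with \<open>Y\<close> of rank one, the restricted isometry of order two shows that the rank
  preserver \<open>M\<close> is within \<open>O(\<eta>)\<close> of the identity. Its normal entries are then \<open>O(\<eta>\<^sup>2)\<close>, so \<open>M - 1\<close> is that
  close to \<open>W_space\<close>.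
\<close>

lemma equivalent_maps_agree_mod_W_space:
  fixes L :: "('q::finite mat, real^'d::finite) linop"
  assumes rip: "\<And>Y. rank Y \<le> 2 \<Longrightarrow> 9/10 * norm Y \<le> norm (app L Y)"
  obtains C where "0 \<le> C"
    "\<And>G1 G2 M \<eta>. rank_preserver M \<Longrightarrow> (\<And>Y. app (L + G1) Y = app (L + G2) (M Y)) \<Longrightarrow>
      norm G1 \<le> \<eta> \<Longrightarrow> norm G2 \<le> \<eta> \<Longrightarrow> \<eta> \<le> 1/10 \<Longrightarrow>
      \<exists>w\<in>W_space. norm (G1 - G2 - lcomp L w) \<le> C * \<eta>\<^sup>2"
proof -
  obtain c where c: "0 \<le> c" "\<And>D :: ('q mat, 'q mat) linop.
      norm (D - proj W_space D) \<le> c * (\<Sum>\<tau>\<in>normal_tests. \<bar>normal_entry D \<tau>\<bar>)"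
    using distance_W_space by blast
  define k
    where "k = (\<Sum>((u, v), (a, b))\<in>(normal_tests :: (((real^'q) \<times> (real^'q)) \<times> ((real^'q) \<times> (real^'q))) set).
      norm u * norm v * norm a * norm b)"
  have k0: "0 \<le> k" unfolding k_def by (auto intro!: sum_nonneg)
  define C where "C = norm L * (c * (25/2 * k)) + 5/2 * real CARD('q)"
  have "\<exists>w\<in>W_space. norm (G1 - G2 - lcomp L w) \<le> C * \<eta>\<^sup>2"
    if M: "rank_preserver M" and eq: "\<And>Y. app (L + G1) Y = app (L + G2) (M Y)"
      and G: "norm G1 \<le> \<eta>" "norm G2 \<le> \<eta>" and \<eta>: "\<eta> \<le> 1/10" for G1 G2 M \<eta>
  proof -
    have \<eta>0: "0 \<le> \<eta>" using G(1) norm_ge_zero order_trans by blast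
    have linM: "linear M" and rkM: "\<And>Y. rank (M Y) = rank Y"
      using M by (auto simp: rank_preserver_def)
    define \<mu> where "\<mu> = Linop (\<lambda>Y. M Y - Y)"
    have \<mu>: "app \<mu> Y = M Y - Y" for Y
      unfolding \<mu>_def by (subst app_Linop) (auto intro: linear_compose_sub linM linear_ident)
    have small: "norm (app \<mu> Y) \<le> 5/2 * \<eta> * norm Y" if Y: "rank Y \<le> 1" for Y
    proof -
      have "rank (app \<mu> Y) \<le> 2" using rank_diff_le[of "M Y" Y] rkM[of Y] Y by (simp add: \<mu>)
      then have "9/10 * norm (app \<mu> Y) \<le> norm (app L (app \<mu> Y))" by (rule rip)
      also have "app L (app \<mu> Y) = app G1 Y - app G2 (Y + app \<mu> Y)"
        using eq[of Y] by (simp add: \<mu> app_diff_arg algebra_simps)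
      also have "norm \<dots> \<le> norm (app G1 Y) + norm (app G2 (Y + app \<mu> Y))"
        by (rule norm_triangle_ineq4)
      also have "\<dots> \<le> \<eta> * norm Y + \<eta> * norm (Y + app \<mu> Y)"
        by (intro add_mono order_trans[OF norm_app_le] mult_right_mono G) auto
      also have "\<dots> \<le> \<eta> * norm Y + \<eta> * (norm Y + norm (app \<mu> Y))"
        using \<eta>0 by (intro add_left_mono mult_left_mono norm_triangle_ineq)
      finally have "9/10 * norm (app \<mu> Y) \<le> 2 * \<eta> * norm Y + \<eta> * norm (app \<mu> Y)"
        by (simp add: algebra_simps)
      moreover have "\<eta> * norm (app \<mu> Y) \<le> 1/10 * norm (app \<mu> Y)"
        using \<eta> by (intro mult_right_mono) auto
      ultimately show ?thesis by simp
    qed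
    have norm_\<mu>: "norm \<mu> \<le> real CARD('q) * (5/2 * \<eta>)"
      by (rule norm_linop_mat_le) (use small \<eta>0 in auto)
    have tests: "\<bar>normal_entry \<mu> ((u, v), (a, b))\<bar> \<le> 25/2 * \<eta>\<^sup>2 * (norm u * norm v * norm a * norm b)"
      if "((u, v), (a, b)) \<in> normal_tests" for u v a b
    proof (cases "u = 0 \<or> v = 0")
      case True
      then have "outer u v = 0" by (auto simp: outer_def vec_eq_iff)
      then show ?thesis by (simp add: normal_entry_def)
    next
      case False
      have "rank (outer u v + app \<mu> (outer u v)) \<le> 1"
        using rkM rank_outer_le[of u v] by (simp add: \<mu>)
      moreover have "norm (app \<mu> (outer u v)) \<le> 5/2 * \<eta> * (norm u * norm v)"
        using small[OF rank_outer_le] by (simp add: norm_outer)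
      moreover have "u \<bullet> a = 0" "v \<bullet> b = 0" using that by (auto simp: normal_tests_def)
      ultimately have "\<bar>a \<bullet> (app \<mu> (outer u v) *v b)\<bar> \<le> 2 * (5/2 * \<eta>)\<^sup>2 * (norm u * norm v * norm a * norm b)"
        using \<eta> \<eta>0 False by (intro normal_entry_quadratic) auto
      then show ?thesis by (simp add: normal_entry_def power_mult_distrib power2_eq_square)
    qed
    have "(\<Sum>\<tau>\<in>normal_tests. \<bar>normal_entry \<mu> \<tau>\<bar>) \<le> 25/2 * \<eta>\<^sup>2 * k"
      unfolding k_def sum_distrib_left by (intro sum_mono) (use tests in auto)
    then have dist: "norm (\<mu> - proj W_space \<mu>) \<le> c * (25/2 * \<eta>\<^sup>2 * k)"
      using c by (meson mult_left_mono order_trans)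
    let ?w = "proj W_space \<mu>"
    have "G1 - G2 - lcomp L ?w = lcomp L (\<mu> - ?w) + lcomp G2 \<mu>"
      using eq by (intro linop_eqI) (simp add: \<mu> app_diff_arg app_add_arg algebra_simps)
    then have "norm (G1 - G2 - lcomp L ?w) \<le> norm L * norm (\<mu> - ?w) + norm G2 * norm \<mu>"
      using norm_triangle_le[OF add_mono[OF norm_lcomp_le norm_lcomp_le]] by metis
    also have "\<dots> \<le> norm L * (c * (25/2 * \<eta>\<^sup>2 * k)) + \<eta> * (real CARD('q) * (5/2 * \<eta>))"
      using dist G norm_\<mu> \<eta>0 by (intro add_mono mult_mono) auto
    also have "\<dots> = C * \<eta>\<^sup>2" by (simp add: C_def power2_eq_square algebra_simps)
    finally show ?thesis using proj_in[OF subspace_W_space] by blast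
  qed
  moreover have "0 \<le> C" unfolding C_def using c k0 by simp
  ultimately show thesis using that by blast
qed

section \<open>One step of the alternating update\<close>

lemma least_squares_normal_equation:
  fixes H :: "('q::finite mat, real^'d::finite) linop"
  assumes fit: "least_squares_fit n y Z (app F)"
  shows "(\<Sum>j=1..n. (y j - app F (Z j)) \<bullet> app H (Z j)) = 0"
proof -
  let ?\<rho> = "\<lambda>j. y j - app F (Z j)"
  have "0 \<le> t * (- 2 * (\<Sum>j=1..n. ?\<rho> j \<bullet> app H (Z j))) + t\<^sup>2 * (\<Sum>j=1..n. (norm (app H (Z j)))\<^sup>2)"
    for t
  proof -
    have "(\<Sum>j=1..n. (norm (?\<rho> j))\<^sup>2) \<le> (\<Sum>j=1..n. (norm (y j - app (F + t *\<^sub>R H) (Z j)))\<^sup>2)"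
      using fit linear_app unfolding least_squares_fit_def by blast
    also have "\<dots> = (\<Sum>j=1..n. (norm (?\<rho> j))\<^sup>2 + t * (- 2 * (?\<rho> j \<bullet> app H (Z j))) + t\<^sup>2 * (norm (app H (Z j)))\<^sup>2)"
      unfolding power2_norm_eq_inner
      by (intro sum.cong refl) (simp add: inner_diff_left inner_diff_right inner_add_left inner_add_right inner_commute
          algebra_simps power2_eq_square)
    finally show ?thesis by (simp add: sum.distrib sum_subtractf sum_negf sum_distrib_left)
  qed
  from quadratic_minimum_zero[OF this] show ?thesis by simp
qed

text \<open>
  The hypotheses on the data in the form in which they are used: \<open>lo\<close> and \<open>hi\<close> bound the spectrum of the
  covariance, and \<open>\<Omega>\<close> bounds the quadratic form of the operator in the definition of \<open>Omega\<close>.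
\<close>

locale training_data =
  fixes L :: "('q::finite mat, real^'d::finite) linop" and X :: "nat \<Rightarrow> 'q mat"
    and n r :: nat and s lo hi \<Omega> :: real
  assumes n: "1 \<le> n" and r: "1 \<le> r" and q2: "2 \<le> CARD('q)"
    and cond: "\<And>j. j \<in> {1..n} \<Longrightarrow> conditioned_matrix (X j) s"
      and rank: "\<And>j. j \<in> {1..n} \<Longrightarrow> rank (X j) = r"
    and rip: "\<And>Y. rank Y \<le> 4 * r \<Longrightarrow> 9/10 * norm Y \<le> norm (app L Y) \<and> norm (app L Y) \<le> 11/10 * norm Y"
    and lo: "0 < lo" and hi: "hi \<le> 101/100 * lo"
    and covariance_ge: "\<And>Y. lo * (norm Y)\<^sup>2 \<le> (1 / n) * (\<Sum>j=1..n. (X j \<bullet> Y)\<^sup>2)"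
    and covariance_le: "\<And>Y. (1 / n) * (\<Sum>j=1..n. (X j \<bullet> Y)\<^sup>2) \<le> hi * (norm Y)\<^sup>2"
    and \<Omega>_nonneg: "0 \<le> \<Omega>"
    and \<Omega>: "\<And>E. E \<in> W_space\<^sup>\<bottom> \<Longrightarrow>
      (1 / n) * (\<Sum>j=1..n. (norm (proj (tangent_space (X j)) (app E (X j))))\<^sup>2) \<le> \<Omega> * (norm E)\<^sup>2"
begin

definition avg :: "(nat \<Rightarrow> real) \<Rightarrow> real" where "avg f = (1 / n) * (\<Sum>j=1..n. f j)"

lemma avg_add: "avg (\<lambda>j. f j + g j) = avg f + avg g"
  and avg_diff: "avg (\<lambda>j. f j - g j) = avg f - avg g"
  and avg_scale: "avg (\<lambda>j. c * f j) = c * avg f"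
  and avg_scale_right: "avg (\<lambda>j. f j * c) = avg f * c"
  by (simp_all add: avg_def sum.distrib sum_subtractf sum_negf sum_distrib_left sum_distrib_right algebra_simps)

lemma avg_mono: "(\<And>j. j \<in> {1..n} \<Longrightarrow> f j \<le> g j) \<Longrightarrow> avg f \<le> avg g"
  unfolding avg_def by (intro mult_left_mono sum_mono) auto

lemma avg_cong: "(\<And>j. j \<in> {1..n} \<Longrightarrow> f j = g j) \<Longrightarrow> avg f = avg g"
  unfolding avg_def by (intro arg_cong2[where f = "(*)"] sum.cong) auto

lemma avg_nonneg: "(\<And>j. j \<in> {1..n} \<Longrightarrow> 0 \<le> f j) \<Longrightarrow> 0 \<le> avg f"
  unfolding avg_def by (intro mult_nonneg_nonneg sum_nonneg) auto

lemma avg_sum: "avg (\<lambda>j. \<Sum>i\<in>I. f i j) = (\<Sum>i\<in>I. avg (f i))"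
  unfolding avg_def by (subst sum.swap) (simp add: sum_distrib_left)

lemma avg_covariance: "lo * (norm Y)\<^sup>2 \<le> avg (\<lambda>j. (X j \<bullet> Y)\<^sup>2)"
  "avg (\<lambda>j. (X j \<bullet> Y)\<^sup>2) \<le> hi * (norm Y)\<^sup>2"
  unfolding avg_def by (rule covariance_ge, rule covariance_le)

definition form :: "('q mat, 'b::euclidean_space) linop \<Rightarrow> ('q mat, 'b) linop \<Rightarrow> real"
  where "form G H = avg (\<lambda>j. app G (X j) \<bullet> app H (X j))"

lemma bilinear_form: "bilinear form"
  unfolding bilinear_def form_def linear_iff
  by (auto simp: inner_add_left inner_add_right avg_add avg_scale)

lemma form_commute: "form G H = form H G"
  by (simp add: form_def inner_commute)

lemma form_bounds: "lo * (norm G)\<^sup>2 \<le> form G G" "form G G \<le> hi * (norm G)\<^sup>2"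
proof -
  have eq: "form G G = (\<Sum>c\<in>Basis. avg (\<lambda>j. (X j \<bullet> adjoint (app G) c)\<^sup>2))"
    unfolding form_def avg_sum[symmetric] power2_norm_eq_inner[symmetric] norm_square_Basis
    by (simp add: adjoint_clauses[OF linear_app])
  show "lo * (norm G)\<^sup>2 \<le> form G G"
    unfolding eq norm_linop_square_adjoint sum_distrib_left by (intro sum_mono avg_covariance)
  show "form G G \<le> hi * (norm G)\<^sup>2"
    unfolding eq norm_linop_square_adjoint sum_distrib_left by (intro sum_mono avg_covariance)
qed

lemma hi_pos: "0 < hi" and lo_le_hi: "lo \<le> hi"
proof -
  obtain b :: "'q mat" where "b \<in> Basis" using nonempty_Basis by blast
  then have "norm b = 1" by simp
  then show "lo \<le> hi" using order_trans[OF covariance_ge[of b] covariance_le[of b]] by simp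
  then show "0 < hi" using lo by simp
qed

lemma avg_norm_square: "avg (\<lambda>j. (norm (X j))\<^sup>2) \<le> (real CARD('q))\<^sup>2 * hi"
proof -
  have "avg (\<lambda>j. (norm (X j))\<^sup>2) = (\<Sum>b\<in>Basis. avg (\<lambda>j. (X j \<bullet> b)\<^sup>2))"
    unfolding avg_sum[symmetric] norm_square_Basis ..
  also have "\<dots> \<le> (\<Sum>b\<in>(Basis :: 'q mat set). hi)"
    by (intro sum_mono order_trans[OF avg_covariance(2)]) simp
  finally show ?thesis by (simp add: power2_eq_square)
qed

abbreviation image_space :: "nat \<Rightarrow> (real^'d) set"
  where "image_space j \<equiv> app L ` tangent_space (X j)"

lemma subspace_image_space: "subspace (image_space j)"
  by (intro linear_subspace_image linear_app subspace_tangent_space)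

definition energy :: "('q mat, real^'d) linop \<Rightarrow> ('q mat, real^'d) linop \<Rightarrow> real"
  where "energy G H = avg (\<lambda>j. proj (image_space j) (app G (X j)) \<bullet> app H (X j))"

lemma bilinear_image_energy: "bilinear energy"
  unfolding bilinear_def energy_def linear_iff
  by (auto simp: inner_add_left inner_add_right avg_add avg_scale
      linear_add[OF linear_proj[OF subspace_image_space]] linear_cmul[OF linear_proj[OF subspace_image_space]])

lemma energy_commute: "energy G H = energy H G"
  unfolding energy_def
    by (intro avg_cong) (metis proj_inner_commute[OF subspace_image_space] inner_commute)

lemma energy_self: "energy G G = avg (\<lambda>j. (norm (proj (image_space j) (app G (X j))))\<^sup>2)"
  unfolding energy_def power2_norm_eq_inner proj_inner_proj[OF subspace_image_space]
  by (simp only: inner_commute)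

lemma energy_nonneg: "0 \<le> energy G G"
  unfolding energy_self by (rule avg_nonneg) simp

lemma form_pos: "G \<noteq> 0 \<Longrightarrow> 0 < form G G"
  using form_bounds(1)[of G] lo
    by (smt (verit, best) mult_pos_pos zero_less_norm_iff zero_less_power)

text \<open>
  The derivative of one alternating update step, with the parameters \<open>L + G\<close>. It is self-adjoint
  for the covariance-weighted form.
\<close>

definition update :: "('q mat, real^'d) linop \<Rightarrow> ('q mat, real^'d) linop"
  where "update = (SOME T. linear T \<and> (\<forall>G H. form (T G) H = energy G H))"

lemma linear_update: "linear update" and form_update: "form (update G) H = energy G H"
proof -
  have "\<exists>T. linear T \<and> (\<forall>G H. form (T G) H = energy G H)"
    using form_representer[OF bilinear_form form_pos bilinear_image_energy] by metis
  from someI_ex[OF this] show "linear update" "form (update G) H = energy G H"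
    unfolding update_def[symmetric] by auto
qed

text \<open>
  The directions in which \<open>L\<close> moves under rank preservers near the identity.
\<close>

definition gauge_space :: "('q mat, real^'d) linop set"
  where "gauge_space = lcomp L ` W_space"

lemma subspace_gauge_space: "subspace gauge_space"
  unfolding gauge_space_def by (intro linear_subspace_image linear_lcomp_right subspace_W_space)

definition gauge :: "('q mat, real^'d) linop \<Rightarrow> ('q mat, real^'d) linop"
  where "gauge = (SOME P. linear P \<and> (\<forall>x. P x \<in> gauge_space \<and> (\<forall>v\<in>gauge_space. form (x - P x) v = 0)))"

lemma linear_gauge: "linear gauge" and gauge_in: "gauge x \<in> gauge_space"
  and gauge_orthogonal: "v \<in> gauge_space \<Longrightarrow> form (x - gauge x) v = 0"
proof -
  have "\<exists>P. linear P \<and> (\<forall>x. P x \<in> gauge_space \<and> (\<forall>v\<in>gauge_space. form (x - P x) v = 0))"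
    using form_projection[OF bilinear_form form_pos subspace_gauge_space] by metis
  from someI_ex[OF this] show "linear gauge" "gauge x \<in> gauge_space"
    "v \<in> gauge_space \<Longrightarrow> form (x - gauge x) v = 0"
    unfolding gauge_def[symmetric] by auto
qed

definition reduced_space :: "('q mat, real^'d) linop set"
  where "reduced_space = {x. \<forall>v\<in>gauge_space. form x v = 0}"

definition reduce :: "('q mat, real^'d) linop \<Rightarrow> ('q mat, real^'d) linop"
  where "reduce x = x - gauge x"

lemma reduce_in: "reduce x \<in> reduced_space"
  using gauge_orthogonal by (simp add: reduce_def reduced_space_def)

lemma linear_reduce: "linear reduce"
  unfolding reduce_def by (intro linear_compose_sub linear_ident linear_gauge)

lemma subspace_reduced_space: "subspace reduced_space"
  unfolding subspace_def reduced_space_def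
  by (auto simp: bilinear_lzero[OF bilinear_form] bilinear_ladd[OF bilinear_form] bilinear_lmul[OF bilinear_form])

lemma reduce_unique:
  assumes "x - y \<in> gauge_space" "y \<in> reduced_space" shows "reduce x = y"
proof -
  have "(x - y) - gauge x \<in> gauge_space"
    using assms gauge_in subspace_diff[OF subspace_gauge_space] by blast
  then have 1: "reduce x - y \<in> gauge_space" by (simp add: reduce_def algebra_simps)
  have "reduce x - y \<in> reduced_space"
    using assms reduce_in subspace_diff[OF subspace_reduced_space] by blast
  then have "form (reduce x - y) (reduce x - y) = 0" using 1 by (simp add: reduced_space_def)
  then show ?thesis using form_pos by (metis eq_iff_diff_eq_0 less_irrefl)
qed

lemma reduce_of_gauge: "v \<in> gauge_space \<Longrightarrow> reduce v = 0"
  by (rule reduce_unique) (auto simp: subspace_0[OF subspace_reduced_space])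

lemma form_split: "form x x = form (gauge x) (gauge x) + form (reduce x) (reduce x)"
proof -
  have x: "x = gauge x + reduce x" by (simp add: reduce_def)
  have "form (reduce x) (gauge x) = 0" using reduce_in gauge_in by (simp add: reduced_space_def)
  then show ?thesis
    by (subst (1 2) x) (simp add: bilinear_ladd[OF bilinear_form] bilinear_radd[OF bilinear_form] form_commute)
qed

lemma form_nonneg: "0 \<le> form G G"
  using form_bounds(1)[of G] lo
    by (meson dual_order.trans less_imp_le mult_nonneg_nonneg zero_le_power2)

lemma energy_gauge:
  assumes "v \<in> gauge_space" shows "energy v G = form v G"
proof -
  obtain w where w: "v = lcomp L w" "w \<in> W_space" using assms by (auto simp: gauge_space_def)
  have "proj (image_space j) (app v (X j)) = app v (X j)" for j
    using w app_W_space_tangent by (intro proj_of_mem subspace_image_space) auto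
  then show ?thesis by (simp add: energy_def form_def)
qed

lemma update_gauge:
  assumes "v \<in> gauge_space" shows "update v = v"
proof -
  have "form (update v - v) (update v - v) = 0"
    using assms by (simp add: bilinear_lsub[OF bilinear_form] form_update energy_gauge)
  then show ?thesis using form_pos by (metis eq_iff_diff_eq_0 less_irrefl)
qed

lemma update_reduced: "x \<in> reduced_space \<Longrightarrow> update x \<in> reduced_space"
  unfolding reduced_space_def
  by (auto simp: form_update energy_commute energy_gauge) (simp add: form_commute)

lemma reduce_update: "reduce (update G) = update (reduce G)"
proof (rule reduce_unique)
  have "update G - update (reduce G) = update (gauge G)"
    by (simp add: linear_diff[OF linear_update, symmetric] reduce_def)
  then show "update G - update (reduce G) \<in> gauge_space"
    using gauge_in update_gauge by simp
  show "update (reduce G) \<in> reduced_space" by (intro update_reduced reduce_in)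
qed

lemma norm_le_of_form_le:
  assumes "form G G \<le> c * form H H" "0 \<le> c" "0 \<le> k" "c * 101/100 \<le> k\<^sup>2"
  shows "norm G \<le> k * norm H"
proof (rule power2_le_imp_le)
  have "lo * (norm G)\<^sup>2 \<le> c * form H H" using form_bounds(1)[of G] assms(1) by linarith
  also have "\<dots> \<le> c * (101/100 * lo * (norm H)\<^sup>2)"
    using form_bounds(2)[of H] hi assms(2)
    by (meson mult_left_mono mult_right_mono order_trans zero_le_power2)
  also have "\<dots> = lo * ((c * 101/100) * (norm H)\<^sup>2)" by simp
  also have "\<dots> \<le> lo * (k\<^sup>2 * (norm H)\<^sup>2)"
    using assms lo by (intro mult_left_mono mult_right_mono) auto
  finally show "(norm G)\<^sup>2 \<le> (k * norm H)\<^sup>2" using lo by (simp add: power_mult_distrib)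
qed (use assms in simp)

lemma norm_reduce_le: "norm (reduce G) \<le> 101/100 * norm G"
  by (rule norm_le_of_form_le[of _ 1]) (use form_split[of G] form_nonneg[of "gauge G"] in \<open>auto simp: power2_eq_square\<close>)

lemma norm_gauge_le: "norm (gauge G) \<le> 101/100 * norm G"
  by (rule norm_le_of_form_le[of _ 1]) (use form_split[of G] form_nonneg[of "reduce G"] in \<open>auto simp: power2_eq_square\<close>)

lemma energy_le_form: "energy G G \<le> form G G"
  unfolding energy_self form_def power2_norm_eq_inner[symmetric]
  by (intro avg_mono power_mono norm_proj_le subspace_image_space) auto

lemma update_self_adjoint: "form (update x) y = form x (update y)"
  by (metis form_update energy_commute form_commute)

lemma semidefinite_operator_update:
  assumes "subspace U" "\<And>x. x \<in> U \<Longrightarrow> update x \<in> U" "0 < \<beta>" "\<And>x. x \<in> U \<Longrightarrow> energy x x \<le> \<beta> * form x x"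
  shows "semidefinite_operator form update U lo hi \<beta>"
  by (rule semidefinite_operator.intro)
    (use assms bilinear_form form_commute lo form_bounds linear_update update_self_adjoint energy_nonneg in
      \<open>auto simp: form_update\<close>)

lemma norm_update_le: "norm (update G) \<le> 101/100 * norm G"
proof -
  interpret semidefinite_operator form update UNIV lo hi 1
    by (rule semidefinite_operator_update) (auto simp: energy_le_form)
  show ?thesis
    by (rule norm_le_of_form_le[of _ 1]) (use form_image_le[of G] in \<open>auto simp: power2_eq_square\<close>)
qed

lemma norm_le_lcomp:
  assumes "w \<in> W_space" shows "norm w \<le> 10/9 * norm (lcomp L w)"
proof (rule norm_linop_le)
  fix b :: "'q mat" assume "b \<in> Basis"
  then have "rank b \<le> 1" by (metis Basis_matrix_outer rank_outer_le)
  then have "rank (app w b) \<le> 4 * r" using rank_app_W_space[OF assms, of b] r by linarith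
  then show "norm (app w b) \<le> 10/9 * norm (app (lcomp L w) b)" using rip by fastforce
qed simp

text \<open>
  For \<open>G\<close> in the reduced space, \<open>F = L' \<circ> G\<close> is orthogonal to \<open>W_space\<close> for the covariance form. As the
  covariance is nearly a multiple of the identity, the component \<open>b\<close> of \<open>F\<close> in \<open>W_space\<close> is small, while
  the energy of the other component \<open>a\<close> is controlled by \<open>\<Omega>\<close>. The factor \<open>100/81\<close> comes from replacing the
  projection onto the image of a tangent space by the projection onto the tangent space itself.
  Splitting the square with weights \<open>3/2\<close> and \<open>3\<close> keeps the coefficient of \<open>\<Omega>\<close> below 2.
\<close>

lemma energy_le_rate:
  assumes G: "G \<in> reduced_space"
  defines "\<kappa> \<equiv> (hi - lo) / lo"
  shows "energy G G \<le> ((onorm (app L))\<^sup>2 * (100/81) * (3/2 * \<Omega> + 3 * hi * \<kappa>\<^sup>2) / lo) * form G G"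
proof -
  let ?l = "onorm (app L)"
  define F where "F = Linop (adjoint (app L) \<circ> app G)"
  have linadj: "linear (adjoint (app L))" by (intro adjoint_linear linear_app)
  have F: "app F Y = adjoint (app L) (app G Y)" for Y
    unfolding F_def by (subst app_Linop) (auto intro: linear_compose linear_app linadj)
  define b where "b = proj W_space F"
  define a where "a = F - b"
  have b: "b \<in> W_space" unfolding b_def by (rule proj_in[OF subspace_W_space])
  have a: "a \<in> W_space\<^sup>\<bottom>" unfolding a_def b_def by (rule proj_orthogonal[OF subspace_W_space])
  have \<kappa>: "0 \<le> \<kappa>" using lo lo_le_hi by (simp add: \<kappa>_def)
  have adj_norm: "norm (adjoint (app L) v) \<le> ?l * norm v" for v
  proof -
    let ?a = "adjoint (app L) v"
    have "(norm ?a)\<^sup>2 = app L ?a \<bullet> v"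
      by (simp add: power2_norm_eq_inner adjoint_clauses[OF linear_app])
    also have "\<dots> \<le> norm (app L ?a) * norm v" by (rule norm_cauchy_schwarz)
    also have "\<dots> \<le> (?l * norm ?a) * norm v" by (intro mult_right_mono onorm bounded_linear_app) simp
    finally have "norm ?a * norm ?a \<le> (?l * norm v) * norm ?a"
      by (simp add: power2_eq_square mult_ac)
    then show ?thesis
      by (cases "norm ?a = 0") (auto simp: onorm_pos_le[OF bounded_linear_app])
  qed
  have normF: "norm F \<le> ?l * norm G"
    by (rule norm_linop_le) (auto simp: F adj_norm onorm_pos_le bounded_linear_app)
  have Fw: "form F w = 0" if "w \<in> W_space" for w :: "('q mat, 'q mat) linop"
  proof -
    have "form F w = form G (lcomp L w)"
      by (simp add: form_def F adjoint_clauses[OF linear_app])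
    then show ?thesis using G that by (auto simp: reduced_space_def gauge_space_def)
  qed
  have norm_b: "norm b \<le> \<kappa> * norm F"
  proof -
    define C where "C = (\<lambda>x y :: ('q mat, 'q mat) linop. form x y - lo * (x \<bullet> y))"
    have "bilinear (form :: ('q mat, 'q mat) linop \<Rightarrow> _)" by (rule bilinear_form)
    then have C: "bilinear C"
      unfolding bilinear_def linear_iff C_def
        by (auto simp: inner_add_left inner_add_right algebra_simps)
    have C0: "0 \<le> C x x" and C1: "C x x \<le> (hi - lo) * (norm x)\<^sup>2" for x
      using form_bounds[of x] by (simp_all add: C_def power2_norm_eq_inner algebra_simps)
    have "(C F b)\<^sup>2 \<le> C F F * C b b"
      by (rule semidefinite_Cauchy_Schwarz[OF C _ C0]) (simp add: C_def form_commute inner_commute)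
    also have "\<dots> \<le> ((hi - lo) * (norm F)\<^sup>2) * ((hi - lo) * (norm b)\<^sup>2)"
      using C0 C1 lo_le_hi by (intro mult_mono) auto
    also have "\<dots> = ((hi - lo) * norm F * norm b)\<^sup>2"
      by (simp add: power_mult_distrib power2_eq_square)
    finally have "\<bar>C F b\<bar> \<le> (hi - lo) * norm F * norm b"
      using lo_le_hi
        by (metis abs_le_square_iff abs_of_nonneg diff_ge_0_iff_ge mult_nonneg_nonneg norm_ge_zero)
    moreover have "C F b = - (lo * (F \<bullet> b))" using Fw[OF b] by (simp add: C_def)
    moreover have "F \<bullet> b = (norm b)\<^sup>2"
      unfolding b_def power2_norm_eq_inner by (simp add: proj_inner_proj[OF subspace_W_space])
    ultimately have "lo * (norm b * norm b) \<le> (hi - lo) * norm F * norm b"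
      using lo by (simp add: power2_eq_square)
    then have "norm b * (lo * norm b) \<le> norm b * ((hi - lo) * norm F)" by (simp add: mult_ac)
    then have "lo * norm b \<le> (hi - lo) * norm F"
      using lo lo_le_hi by (cases "norm b = 0") auto
    then show ?thesis using lo by (simp add: \<kappa>_def field_simps)
  qed
  have norm_a: "norm a \<le> norm F"
    unfolding a_def b_def by (rule norm_diff_proj_le[OF subspace_W_space])
  have image: "norm (proj (image_space j) v) \<le> 10/9 * norm (proj (tangent_space (X j)) (adjoint (app L) v))"
    if j: "j \<in> {1..n}" for j v
  proof -
    let ?p = "proj (image_space j) v" and ?t = "proj (tangent_space (X j)) (adjoint (app L) v)"
    obtain S where S: "S \<in> tangent_space (X j)" "?p = app L S"
      using proj_in[OF subspace_image_space, of j v] by blast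
    have "(norm ?p)\<^sup>2 = v \<bullet> app L S"
      using S(2) by (metis power2_norm_eq_inner proj_inner_proj[OF subspace_image_space])
    also have "\<dots> = ?t \<bullet> S"
      using S(1) by (simp add: proj_inner[OF subspace_tangent_space] adjoint_clauses[OF linear_app])
    also have "\<dots> \<le> norm ?t * norm S" by (rule norm_cauchy_schwarz)
    also have "\<dots> \<le> norm ?t * (10/9 * norm ?p)"
      using rip[of S] rank_tangent_le[OF S(1)] rank[OF j] S(2) by (intro mult_left_mono) auto
    finally have "norm ?p * norm ?p \<le> (10/9 * norm ?t) * norm ?p"
      by (simp add: power2_eq_square mult_ac)
    then show ?thesis by (cases "norm ?p = 0") auto
  qed
  have "energy G G \<le> avg (\<lambda>j. 100/81 * (3/2 * (norm (proj (tangent_space (X j)) (app a (X j))))\<^sup>2 + 3 * (norm (app b (X j)))\<^sup>2))"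
    unfolding energy_self
  proof (rule avg_mono)
    fix j assume j: "j \<in> {1..n}"
    let ?t = "proj (tangent_space (X j))"
    have "?t (app F (X j)) = ?t (app a (X j)) + app b (X j)"
    proof -
      have "app F (X j) = app a (X j) + app b (X j)" by (simp add: a_def)
      then show ?thesis
        using proj_of_mem[OF subspace_tangent_space app_W_space_tangent[OF b]]
        by (simp add: linear_add[OF linear_proj[OF subspace_tangent_space]])
    qed
    then have "norm (proj (image_space j) (app G (X j))) \<le> 10/9 * norm (?t (app a (X j)) + app b (X j))"
      using image[OF j, of "app G (X j)"] by (simp add: F)
    also have "\<dots> \<le> 10/9 * (norm (?t (app a (X j))) + norm (app b (X j)))"
      by (intro mult_left_mono norm_triangle_ineq) simp
    finally have "(norm (proj (image_space j) (app G (X j))))\<^sup>2 \<le> (10/9 * (norm (?t (app a (X j))) + norm (app b (X j))))\<^sup>2"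
      by (rule power_mono) simp
    also have "\<dots> = 100/81 * (norm (?t (app a (X j))) + norm (app b (X j)))\<^sup>2"
      by (simp only: power_mult_distrib) (simp add: power_divide)
    also have "\<dots> \<le> 100/81 * (3/2 * (norm (?t (app a (X j))))\<^sup>2 + 3 * (norm (app b (X j)))\<^sup>2)"
    proof (rule mult_left_mono)
      have "(x + y)\<^sup>2 \<le> 3/2 * x\<^sup>2 + 3 * y\<^sup>2" for x y :: real
        using zero_le_power2[of "x - 2 * y"] by (simp add: power2_eq_square algebra_simps)
      then show "(norm (?t (app a (X j))) + norm (app b (X j)))\<^sup>2 \<le> 3/2 * (norm (?t (app a (X j))))\<^sup>2 + 3 * (norm (app b (X j)))\<^sup>2" .
    qed simp
    finally show "(norm (proj (image_space j) (app G (X j))))\<^sup>2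
      \<le> 100/81 * (3/2 * (norm (?t (app a (X j))))\<^sup>2 + 3 * (norm (app b (X j)))\<^sup>2)" .
  qed
  also have "\<dots> = 100/81 * (3/2 * avg (\<lambda>j. (norm (proj (tangent_space (X j)) (app a (X j))))\<^sup>2) + 3 * form b b)"
    by (simp only: avg_scale avg_add form_def power2_norm_eq_inner)
  also have "\<dots> \<le> 100/81 * (3/2 * (\<Omega> * (norm F)\<^sup>2) + 3 * (hi * (\<kappa> * norm F)\<^sup>2))"
  proof (intro mult_left_mono add_mono)
    have "avg (\<lambda>j. (norm (proj (tangent_space (X j)) (app a (X j))))\<^sup>2) \<le> \<Omega> * (norm a)\<^sup>2"
      unfolding avg_def by (rule \<Omega>[OF a])
    also have "\<dots> \<le> \<Omega> * (norm F)\<^sup>2" using norm_a \<Omega>_nonneg by (intro mult_left_mono power_mono) auto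
    finally show "avg (\<lambda>j. (norm (proj (tangent_space (X j)) (app a (X j))))\<^sup>2) \<le> \<Omega> * (norm F)\<^sup>2" .
    have "form b b \<le> hi * (norm b)\<^sup>2" by (rule form_bounds)
    also have "\<dots> \<le> hi * (\<kappa> * norm F)\<^sup>2"
      using norm_b hi_pos by (intro mult_left_mono power_mono) auto
    finally show "form b b \<le> hi * (\<kappa> * norm F)\<^sup>2" .
  qed auto
  also have "\<dots> = (100/81 * (3/2 * \<Omega> + 3 * hi * \<kappa>\<^sup>2)) * (norm F)\<^sup>2"
    by (simp add: power_mult_distrib algebra_simps)
  also have "\<dots> \<le> (100/81 * (3/2 * \<Omega> + 3 * hi * \<kappa>\<^sup>2)) * (?l\<^sup>2 * (form G G / lo))"
  proof (rule mult_left_mono)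
    have "(norm F)\<^sup>2 \<le> ?l\<^sup>2 * (norm G)\<^sup>2"
      using power_mono[OF normF, of 2] by (simp add: power_mult_distrib)
    also have "\<dots> \<le> ?l\<^sup>2 * (form G G / lo)"
      using form_bounds(1)[of G] lo by (intro mult_left_mono) (auto simp: field_simps)
    finally show "(norm F)\<^sup>2 \<le> ?l\<^sup>2 * (form G G / lo)" .
  qed (use \<Omega>_nonneg hi_pos in simp)
  finally show ?thesis by (simp add: mult_ac)
qed

text \<open>
  The normal equations are tested against \<open>H = G' - update G\<close> itself. By definition of \<open>update\<close> the
  first-order terms cancel, and the form of \<open>H\<close> bounds its norm; the covariance of the fitted matrices
  is never inverted.
\<close>

lemma least_squares_first_order:
  assumes fits: "\<And>j. j \<in> {1..n} \<Longrightarrow> low_rank_fit r (app (L + G)) (app L (X j)) (Z j)"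
    and lsq: "least_squares_fit n (\<lambda>j. app L (X j)) Z (app (L + G'))"
    and G: "norm G \<le> \<epsilon>" and \<epsilon>: "\<epsilon> * (18000 * real CARD('q) ^ 3) \<le> 1"
  shows "norm (G' - update G) \<le> 28 * real CARD('q) ^ 3 * \<epsilon>\<^sup>2"
proof -
  let ?q = "real CARD('q)"
  define H where "H = G' - update G"
  define D where "D j = Z j - X j" for j
  let ?\<Pi> = "\<lambda>j. proj (image_space j) (app G (X j))"
  have q: "2 \<le> ?q" using q2 by simp
  have eps: "0 \<le> \<epsilon>" "\<epsilon> * ?q \<le> 1/72000" "\<epsilon> \<le> 1/144000"
    and dist: "\<And>j. j \<in> {1..n} \<Longrightarrow> norm (D j) \<le> 23/10 * \<epsilon> * norm (X j)"
    and first: "\<And>j. j \<in> {1..n} \<Longrightarrow> norm (app L (D j) + ?\<Pi> j) \<le> 23 * ?q * \<epsilon>\<^sup>2 * norm (X j)"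
  proof -
    have j: "conditioned_matrix (X j) s" "rank (X j) = r" if "j \<in> {1..n}" for j
      using that cond rank by auto
    have one: "1 \<in> {1..n}" using n by simp
    show "0 \<le> \<epsilon>" "\<epsilon> * ?q \<le> 1/72000" "\<epsilon> \<le> 1/144000"
      using conditioned_matrix.eps_bounds[OF j(1)[OF one] _ _ G \<epsilon> q2, of L "Z 1"] fits[OF one] j(2)[OF one] rip
        by auto
    show "norm (D j) \<le> 23/10 * \<epsilon> * norm (X j)" if "j \<in> {1..n}" for j
      using conditioned_matrix.fit_distance[OF j(1)[OF that] _ _ G \<epsilon> q2, of L "Z j"] fits[OF that] j(2)[OF that] rip
      by (simp add: D_def)
    show "norm (app L (D j) + ?\<Pi> j) \<le> 23 * ?q * \<epsilon>\<^sup>2 * norm (X j)" if "j \<in> {1..n}" for j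
      using conditioned_matrix.fit_first_order[OF j(1)[OF that] _ _ G \<epsilon> q2, of L "Z j"] fits[OF that] j(2)[OF that] rip
      by (simp add: D_def)
  qed
  define h where "h = norm H"
  define g where "g = norm G'"
  have nn: "0 \<le> h" "0 \<le> g" by (simp_all add: h_def g_def)
  have split: "form H H = avg (\<lambda>j. - ((app L (D j) + ?\<Pi> j) \<bullet> app H (Z j)) + ?\<Pi> j \<bullet> app H (D j)
      - app G' (D j) \<bullet> app H (Z j) - app G' (X j) \<bullet> app H (D j))"
  proof -
    have "avg (\<lambda>j. (app L (X j) - app (L + G') (Z j)) \<bullet> app H (Z j)) = 0"
      using least_squares_normal_equation[OF lsq, of H] by (simp add: avg_def)
    then have "form H H = avg (\<lambda>j. app G' (X j) \<bullet> app H (X j)) - avg (\<lambda>j. ?\<Pi> j \<bullet> app H (X j))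
        + avg (\<lambda>j. (app L (X j) - app (L + G') (Z j)) \<bullet> app H (Z j))"
      using form_update[of G H] unfolding energy_def[symmetric] form_def[symmetric]
      by (simp add: H_def bilinear_lsub[OF bilinear_form])
    also have "\<dots> = avg (\<lambda>j. app G' (X j) \<bullet> app H (X j) - ?\<Pi> j \<bullet> app H (X j)
        + (app L (X j) - app (L + G') (Z j)) \<bullet> app H (Z j))"
      by (simp only: avg_add avg_diff)
    also have "\<dots> = avg (\<lambda>j. - ((app L (D j) + ?\<Pi> j) \<bullet> app H (Z j)) + ?\<Pi> j \<bullet> app H (D j)
      - app G' (D j) \<bullet> app H (Z j) - app G' (X j) \<bullet> app H (D j))"
      by (intro avg_cong) (simp add: D_def app_diff_arg inner_diff_left inner_diff_right inner_add_left)
    finally show ?thesis .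
  qed
  have "form H H \<le> avg (\<lambda>j. (norm (X j))\<^sup>2 * (h * (49/2 * ?q * \<epsilon>\<^sup>2 + 47/10 * \<epsilon> * g)))"
    unfolding split
  proof (rule avg_mono)
    fix j assume j: "j \<in> {1..n}"
    define x where "x = norm (X j)"
    define \<delta> where "\<delta> = norm (D j)"
    have x0: "0 \<le> x" "0 \<le> \<delta>" by (simp_all add: x_def \<delta>_def)
    have \<delta>: "\<delta> \<le> 23/10 * \<epsilon> * x" using dist[OF j] by (simp add: x_def \<delta>_def)
    have "23/10 * \<epsilon> * x \<le> 1/100 * x" using eps x0 by (intro mult_right_mono) auto
    moreover have "norm (Z j) \<le> x + \<delta>"
      using norm_triangle_sub[of "Z j" "X j"] by (simp add: x_def \<delta>_def D_def)
    ultimately have z: "norm (Z j) \<le> 101/100 * x" using \<delta> by linarith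
    have HZ: "norm (app H (Z j)) \<le> h * (101/100 * x)"
      unfolding h_def using z by (intro order_trans[OF norm_app_le] mult_left_mono) auto
    have HD: "norm (app H (D j)) \<le> h * (23/10 * \<epsilon> * x)"
      unfolding h_def
        using \<delta> by (intro order_trans[OF norm_app_le] mult_left_mono) (auto simp: \<delta>_def)
    have GD: "norm (app G' (D j)) \<le> g * (23/10 * \<epsilon> * x)"
      unfolding g_def
        using \<delta> by (intro order_trans[OF norm_app_le] mult_left_mono) (auto simp: \<delta>_def)
    have GX: "norm (app G' (X j)) \<le> g * x" unfolding g_def x_def by (rule norm_app_le)
    have \<Pi>: "norm (?\<Pi> j) \<le> \<epsilon> * x"
      using norm_proj_le[OF subspace_image_space] norm_app_le[of G "X j"] mult_right_mono[OF G, of x]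
      unfolding x_def by (meson norm_ge_zero order_trans)
    have t1: "- ((app L (D j) + ?\<Pi> j) \<bullet> app H (Z j)) \<le> (23 * ?q * \<epsilon>\<^sup>2 * x) * (h * (101/100 * x))"
    proof -
      have "- ((app L (D j) + ?\<Pi> j) \<bullet> app H (Z j)) \<le> norm (app L (D j) + ?\<Pi> j) * norm (app H (Z j))"
        using norm_cauchy_schwarz[of "- (app L (D j) + ?\<Pi> j)" "app H (Z j)"]
          by (simp only: inner_minus_left norm_minus_cancel)
      also have "\<dots> \<le> (23 * ?q * \<epsilon>\<^sup>2 * x) * (h * (101/100 * x))"
        using first[OF j] HZ x0 by (intro mult_mono) (auto simp: x_def)
      finally show ?thesis .
    qed
    have t2: "?\<Pi> j \<bullet> app H (D j) \<le> (\<epsilon> * x) * (h * (23/10 * \<epsilon> * x))"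
      using \<Pi> HD eps x0 by (intro order_trans[OF norm_cauchy_schwarz] mult_mono) auto
    have t3: "- (app G' (D j) \<bullet> app H (Z j)) \<le> (g * (23/10 * \<epsilon> * x)) * (h * (101/100 * x))"
    proof -
      have "- (app G' (D j) \<bullet> app H (Z j)) \<le> norm (app G' (D j)) * norm (app H (Z j))"
        using norm_cauchy_schwarz[of "- app G' (D j)" "app H (Z j)"] by simp
      also have "\<dots> \<le> (g * (23/10 * \<epsilon> * x)) * (h * (101/100 * x))"
        using GD HZ nn eps x0 by (intro mult_mono) auto
      finally show ?thesis .
    qed
    have t4: "- (app G' (X j) \<bullet> app H (D j)) \<le> (g * x) * (h * (23/10 * \<epsilon> * x))"
    proof -
      have "- (app G' (X j) \<bullet> app H (D j)) \<le> norm (app G' (X j)) * norm (app H (D j))"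
        using norm_cauchy_schwarz[of "- app G' (X j)" "app H (D j)"] by simp
      also have "\<dots> \<le> (g * x) * (h * (23/10 * \<epsilon> * x))"
        using GX HD nn eps x0 by (intro mult_mono) auto
      finally show ?thesis .
    qed
    define y where "y = x\<^sup>2 * h"
    have y: "0 \<le> y" using nn by (simp add: y_def)
    have "- ((app L (D j) + ?\<Pi> j) \<bullet> app H (Z j)) + ?\<Pi> j \<bullet> app H (D j)
        - app G' (D j) \<bullet> app H (Z j) - app G' (X j) \<bullet> app H (D j)
      \<le> (23 * ?q * \<epsilon>\<^sup>2 * x) * (h * (101/100 * x)) + (\<epsilon> * x) * (h * (23/10 * \<epsilon> * x))
        + (g * (23/10 * \<epsilon> * x)) * (h * (101/100 * x)) + (g * x) * (h * (23/10 * \<epsilon> * x))"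
      using t1 t2 t3 t4 by linarith
    also have "\<dots> = y * (2323/100 * (?q * \<epsilon>\<^sup>2) + 23/20 * (2 * \<epsilon>\<^sup>2) + 4623/1000 * (\<epsilon> * g))"
      by (simp add: y_def power2_eq_square algebra_simps)
    also have "\<dots> \<le> y * (2323/100 * (?q * \<epsilon>\<^sup>2) + 23/20 * (?q * \<epsilon>\<^sup>2) + 47/10 * (\<epsilon> * g))"
      using y q eps nn by (intro mult_left_mono add_mono mult_right_mono) auto
    also have "\<dots> \<le> y * (49/2 * (?q * \<epsilon>\<^sup>2) + 47/10 * (\<epsilon> * g))"
      using y by (intro mult_left_mono) auto
    finally show "- ((app L (D j) + ?\<Pi> j) \<bullet> app H (Z j)) + ?\<Pi> j \<bullet> app H (D j)
        - app G' (D j) \<bullet> app H (Z j) - app G' (X j) \<bullet> app H (D j)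
      \<le> (norm (X j))\<^sup>2 * (h * (49/2 * ?q * \<epsilon>\<^sup>2 + 47/10 * \<epsilon> * g))"
      by (simp add: y_def x_def mult_ac)
  qed
  also have "\<dots> = avg (\<lambda>j. (norm (X j))\<^sup>2) * (h * (49/2 * ?q * \<epsilon>\<^sup>2 + 47/10 * \<epsilon> * g))"
    by (rule avg_scale_right)
  also have "\<dots> \<le> (?q\<^sup>2 * (101/100 * lo)) * (h * (49/2 * ?q * \<epsilon>\<^sup>2 + 47/10 * \<epsilon> * g))"
  proof (rule mult_right_mono)
    show "avg (\<lambda>j. (norm (X j))\<^sup>2) \<le> ?q\<^sup>2 * (101/100 * lo)"
      using avg_norm_square hi by (meson mult_left_mono order_trans zero_le_power2)
  qed (use nn eps in simp)
  finally have "lo * (h * h) \<le> lo * (h * (101/100 * ?q\<^sup>2 * (49/2 * ?q * \<epsilon>\<^sup>2 + 47/10 * \<epsilon> * g)))"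
    using form_bounds(1)[of H] by (simp add: h_def power2_eq_square mult_ac)
  then have "h * h \<le> h * (101/100 * ?q\<^sup>2 * (49/2 * ?q * \<epsilon>\<^sup>2 + 47/10 * \<epsilon> * g))"
    using lo mult_le_cancel_left_pos by blast
  then have h1: "h \<le> 101/100 * ?q\<^sup>2 * (49/2 * ?q * \<epsilon>\<^sup>2 + 47/10 * \<epsilon> * g)"
    using nn eps mult_le_cancel_left_pos[of h] by (cases "h = 0") auto
  have "g \<le> norm (update G) + h"
    using norm_triangle_sub[of G' "update G"] by (simp add: g_def h_def H_def)
  also have "\<dots> \<le> 101/100 * \<epsilon> + h" using norm_update_le[of G] G by linarith
  finally have g: "g \<le> 101/100 * \<epsilon> + h" .
  define u where "u = ?q ^ 3 * \<epsilon>\<^sup>2"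
  have u0: "0 \<le> u" by (simp add: u_def)
  have q2\<epsilon>: "2 * (?q\<^sup>2 * \<epsilon>) \<le> 1/18000" "2 * (?q\<^sup>2 * \<epsilon>\<^sup>2) \<le> u"
  proof -
    have "2 * (?q\<^sup>2 * \<epsilon>) \<le> ?q * (?q\<^sup>2 * \<epsilon>)" using q eps by (intro mult_right_mono) auto
    also have "\<dots> \<le> 1/18000" using \<epsilon> by (simp add: power2_eq_square power3_eq_cube mult_ac)
    finally show "2 * (?q\<^sup>2 * \<epsilon>) \<le> 1/18000" .
    have "2 * (?q\<^sup>2 * \<epsilon>\<^sup>2) \<le> ?q * (?q\<^sup>2 * \<epsilon>\<^sup>2)" using q by (intro mult_right_mono) auto
    then show "2 * (?q\<^sup>2 * \<epsilon>\<^sup>2) \<le> u" by (simp add: u_def power2_eq_square power3_eq_cube mult_ac)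
  qed
  have "h \<le> 4949/200 * u + 4747/1000 * (?q\<^sup>2 * \<epsilon>) * g"
    using h1 by (simp add: u_def power2_eq_square power3_eq_cube algebra_simps)
  also have "\<dots> \<le> 4949/200 * u + 4747/1000 * (?q\<^sup>2 * \<epsilon>) * (101/100 * \<epsilon> + h)"
    using g eps by (intro add_left_mono mult_left_mono) auto
  also have "\<dots> = 4949/200 * u + 479447/200000 * (2 * (?q\<^sup>2 * \<epsilon>\<^sup>2)) + 4747/2000 * (2 * (?q\<^sup>2 * \<epsilon>)) * h"
    by (simp add: power2_eq_square algebra_simps)
  also have "\<dots> \<le> 4949/200 * u + 479447/200000 * u + 4747/2000 * (1/18000) * h"
    using q2\<epsilon> nn by (intro add_mono mult_left_mono mult_right_mono) auto
  finally have "h \<le> 28 * u" using u0 nn by simp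
  then show ?thesis by (simp add: h_def H_def u_def mult.assoc)
qed

text \<open>
  Maps modulo rank preservers, described by a perturbation of \<open>L\<close>.
\<close>

definition represents :: "('q mat \<Rightarrow> real^'d) \<Rightarrow> ('q mat, real^'d) linop \<Rightarrow> bool"
  where "represents F G \<longleftrightarrow> (\<exists>M. rank_preserver M \<and> F = (\<lambda>Y. app (L + G) (M Y)))"

text \<open>
  The iteration only depends on the current map up to composition with a rank preserver, which
  transports the fitted matrices and the least squares problem.
\<close>

lemma step_first_order:
  assumes F: "represents F G" and step: "alternating_update_step n r (\<lambda>j. app L (X j)) F F'"
    and G: "norm G \<le> \<epsilon>" and \<epsilon>: "\<epsilon> * (18000 * real CARD('q) ^ 3) \<le> 1"
  obtains G' where "represents F' G'" "norm (G' - update G) \<le> 28 * real CARD('q) ^ 3 * \<epsilon>\<^sup>2"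
proof -
  obtain M where M: "rank_preserver M" "F = (\<lambda>Y. app (L + G) (M Y))"
    using F by (auto simp: represents_def)
  obtain M' where M': "rank_preserver M'" "\<And>x. M (M' x) = x" "\<And>x. M' (M x) = x"
    using rank_preserver_inverse[OF M(1)] by blast
  have lin: "linear M" "linear M'" and rk: "\<And>Y. rank (M Y) = rank Y" "\<And>Y. rank (M' Y) = rank Y"
    using M(1) M'(1) by (auto simp: rank_preserver_def)
  obtain Xhat Lt N where fits: "\<And>j. j \<in> {1..n} \<Longrightarrow> low_rank_fit r F (app L (X j)) (Xhat j)"
    and lsq: "least_squares_fit n (\<lambda>j. app L (X j)) Xhat Lt" and N: "pd_rank_preserver N"
      "F' = Lt \<circ> N"
    using step unfolding alternating_update_step_def by blast
  have linLt: "linear Lt" using lsq by (simp add: least_squares_fit_def)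
  define Z where "Z j = M (Xhat j)" for j
  define G' where "G' = Linop (Lt \<circ> M') - L"
  have G': "app (L + G') Y = Lt (M' Y)" for Y
    using app_Linop[OF linear_compose[OF lin(2) linLt]] by (simp add: G'_def)
  have "low_rank_fit r (app (L + G)) (app L (X j)) (Z j)" if j: "j \<in> {1..n}" for j
    unfolding low_rank_fit_def
  proof (intro conjI allI impI)
    show "rank (Z j) \<le> r" using fits[OF j] by (simp add: low_rank_fit_def Z_def rk)
    fix Y :: "'q mat" assume "rank Y \<le> r"
    then have "(norm (app L (X j) - F (Xhat j)))\<^sup>2 \<le> (norm (app L (X j) - F (M' Y)))\<^sup>2"
      using fits[OF j] rk unfolding low_rank_fit_def by metis
    then show "(norm (app L (X j) - app (L + G) (Z j)))\<^sup>2 \<le> (norm (app L (X j) - app (L + G) Y))\<^sup>2"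
      unfolding M(2) Z_def M'(2) .
  qed
  moreover have "least_squares_fit n (\<lambda>j. app L (X j)) Z (app (L + G'))"
    unfolding least_squares_fit_def
  proof (intro conjI allI impI linear_app)
    fix L' :: "'q mat \<Rightarrow> real^'d" assume "linear L'"
    then have "linear (L' \<circ> M)" by (rule linear_compose[OF lin(1)])
    then have "(\<Sum>j=1..n. (norm (app L (X j) - Lt (Xhat j)))\<^sup>2) \<le> (\<Sum>j=1..n. (norm (app L (X j) - (L' \<circ> M) (Xhat j)))\<^sup>2)"
      using lsq unfolding least_squares_fit_def by blast
    then show "(\<Sum>j=1..n. (norm (app L (X j) - app (L + G') (Z j)))\<^sup>2) \<le> (\<Sum>j=1..n. (norm (app L (X j) - L' (Z j)))\<^sup>2)"
      unfolding G' Z_def M'(3) by simp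
  qed
  ultimately have "norm (G' - update G) \<le> 28 * real CARD('q) ^ 3 * \<epsilon>\<^sup>2"
    using G \<epsilon> by (rule least_squares_first_order)
  moreover have "represents F' G'"
  proof -
    have "rank_preserver N" using N by (simp add: pd_rank_preserver_def)
    then have "rank_preserver (\<lambda>Y. M (N Y))" by (rule rank_preserver_compose[OF M(1)])
    moreover have "F' = (\<lambda>Y. app (L + G') (M (N Y)))" unfolding G' M'(3) using N(2) by auto
    ultimately show ?thesis unfolding represents_def by blast
  qed
  ultimately show thesis using that by blast
qed

lemma represents_shift:
  assumes F: "represents F (lcomp L w + G)" and w: "w \<in> W_space"
    and a: "2 * real CARD('q) * norm w \<le> a" "6 * real CARD('q) * a \<le> 1"
  obtains G' where "represents F G'"
    "norm (G' - G) \<le> real CARD('q) * onorm (app L) * a\<^sup>2 + 3 * real CARD('q) * a * norm G'"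
proof -
  obtain M where M: "rank_preserver M" "F = (\<lambda>Y. app (L + (lcomp L w + G)) (M Y))"
    using F by (auto simp: represents_def)
  obtain A B where AB: "\<And>Y. app w Y = A ** Y + Y ** B" "norm A \<le> 2 * real CARD('q) * norm w"
    "norm B \<le> 2 * real CARD('q) * norm w"
    using W_space_coordinates[OF w] by blast
  obtain M' G' where M': "rank_preserver M'" "\<And>Y. app (L + lcomp L w + G) Y = app (L + G') (M' Y)"
    "norm (G' - G) \<le> real CARD('q) * onorm (app L) * a\<^sup>2 + 3 * real CARD('q) * a * norm G'"
    using absorb_W_space[OF AB(1) order_trans[OF AB(2) a(1)] order_trans[OF AB(3) a(1)] a(2), of L G]
      by blast
  have "represents F G'" unfolding represents_def
    using rank_preserver_compose[OF M'(1) M(1)] M(2) M'(2)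
      by (intro exI[of _ "\<lambda>Y. M' (M Y)"]) (simp add: add.assoc)
  then show thesis using that M'(3) by blast
qed

text \<open>
  The component of the new perturbation in the gauge space is of first order, but a rank preserver
  absorbs it up to second order; the reduced component is contracted by \<open>update\<close> with factor \<open>12/25\<close>.
\<close>

lemma step_contraction:
  assumes F: "represents F G" and step: "alternating_update_step n r (\<lambda>j. app L (X j)) F F'"
    and G: "norm G \<le> \<epsilon>" and \<epsilon>: "20000 * real CARD('q) ^ 3 * onorm (app L) * \<epsilon> \<le> 1"
      and l: "9/10 \<le> onorm (app L)"
    and rate: "\<And>x. x \<in> reduced_space \<Longrightarrow> energy x x \<le> 12/25 * form x x"
  obtains G' where "represents F' G'" "norm G' \<le> \<epsilon> / 2"
proof -
  let ?q = "real CARD('q)" and ?l = "onorm (app L)"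
  define k where "k = ?q ^ 3 * \<epsilon>"
  have e0: "0 \<le> \<epsilon>" using G norm_ge_zero order_trans by blast
  have q: "2 \<le> ?q" using q2 by simp
  have k0: "0 \<le> k" using e0 by (simp add: k_def)
  have kl: "k * ?l \<le> 1/20000" using \<epsilon> by (simp add: k_def mult_ac)
  have "k * (9/10) \<le> k * ?l" using l k0 by (rule mult_left_mono)
  then have k1: "k \<le> 1/18000" using kl by linarith
  have \<epsilon>': "\<epsilon> * (18000 * ?q ^ 3) \<le> 1" using k1 by (simp add: k_def mult_ac)
  have q2k: "2 * (?q\<^sup>2 * \<epsilon>) \<le> k"
  proof -
    have "2 * (?q\<^sup>2 * \<epsilon>) \<le> ?q * (?q\<^sup>2 * \<epsilon>)" using q e0 by (intro mult_right_mono) auto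
    then show ?thesis by (simp add: k_def power2_eq_square power3_eq_cube mult_ac)
  qed
  obtain Gt where Gt: "represents F' Gt" "norm (Gt - update G) \<le> 28 * ?q ^ 3 * \<epsilon>\<^sup>2"
    using step_first_order[OF F step G \<epsilon>'] .
  have err: "norm (Gt - update G) \<le> 28 * k * \<epsilon>"
    using Gt(2) by (simp add: k_def power2_eq_square mult_ac)
  also have "\<dots> \<le> 1/600 * \<epsilon>" using k1 e0 by (intro mult_right_mono) auto
  finally have err: "norm (Gt - update G) \<le> 1/600 * \<epsilon>" .
  have "norm Gt \<le> norm (update G) + norm (Gt - update G)"
    using norm_triangle_sub[of Gt "update G"] by simp
  then have normGt: "norm Gt \<le> 102/100 * \<epsilon>" using err norm_update_le[of G] G e0 by linarith
  obtain w where w: "w \<in> W_space" "gauge Gt = lcomp L w"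
    using gauge_in[of Gt] by (auto simp: gauge_space_def)
  have "norm w \<le> 10/9 * norm (gauge Gt)" using norm_le_lcomp[OF w(1)] w(2) by simp
  then have norm_w: "norm w \<le> 23/20 * \<epsilon>" using norm_gauge_le[of Gt] normGt e0 by linarith
  define a where "a = 23/10 * ?q * \<epsilon>"
  have a0: "0 \<le> a" using e0 by (simp add: a_def)
  have a1: "2 * ?q * norm w \<le> a"
  proof -
    have "2 * ?q * norm w \<le> 2 * ?q * (23/20 * \<epsilon>)" by (intro mult_left_mono norm_w) simp
    then show ?thesis by (simp add: a_def)
  qed
  have qa: "?q * a \<le> 23/20 * k" using q2k by (simp add: a_def power2_eq_square mult_ac)
  have a2: "6 * ?q * a \<le> 1" using qa k1 by simp
  have GU: "norm (reduce Gt) \<le> 97/200 * \<epsilon>"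
  proof -
    interpret semidefinite_operator form update reduced_space lo hi "12/25"
      by (rule semidefinite_operator_update[OF subspace_reduced_space update_reduced _ rate]) auto
    have "form (update (reduce G)) (update (reduce G)) \<le> (12/25)\<^sup>2 * form (reduce G) (reduce G)"
      by (rule form_image_le[OF reduce_in])
    also have "\<dots> \<le> (12/25)\<^sup>2 * form G G"
      using form_split[of G] training_data.form_nonneg[OF training_data_axioms, of "gauge G"]
        by simp
    finally have "norm (update (reduce G)) \<le> 483/1000 * norm G"
      by (rule norm_le_of_form_le) (auto simp: power2_eq_square)
    moreover have "norm (reduce (Gt - update G)) \<le> 101/100 * (1/600 * \<epsilon>)"
      using norm_reduce_le[of "Gt - update G"] err by linarith
    moreover have "reduce Gt = update (reduce G) + reduce (Gt - update G)"
      by (simp add: linear_diff[OF linear_reduce] reduce_update)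
    ultimately show ?thesis
      using norm_triangle_ineq[of "update (reduce G)" "reduce (Gt - update G)"] G e0 by simp
  qed
  have "represents F' (lcomp L w + reduce Gt)" using Gt(1) w(2) by (simp add: reduce_def flip: w(2))
  then obtain G' where G': "represents F' G'"
    "norm (G' - reduce Gt) \<le> ?q * ?l * a\<^sup>2 + 3 * ?q * a * norm G'"
    using represents_shift[OF _ w(1) a1 a2] by blast
  have "?q * ?l * a\<^sup>2 = 529/100 * (k * ?l) * \<epsilon>"
    by (simp add: a_def k_def power2_eq_square power3_eq_cube mult_ac)
  also have "\<dots> \<le> 529/100 * (1/20000) * \<epsilon>" using kl e0 by (intro mult_right_mono mult_left_mono) auto
  finally have t1: "?q * ?l * a\<^sup>2 \<le> 529/2000000 * \<epsilon>" by simp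
  have "3 * ?q * a * norm G' \<le> 1/1000 * norm G'"
    using qa k1 by (intro mult_right_mono) auto
  then have "norm G' \<le> 97/200 * \<epsilon> + 529/2000000 * \<epsilon> + 1/1000 * norm G'"
    using norm_triangle_sub[of G' "reduce Gt"] G'(2) GU t1 by linarith
  then have "norm G' \<le> \<epsilon> / 2" using e0 by simp
  then show thesis using that G'(1) by blast
qed

end

section \<open>Convergence\<close>

text \<open>
  The bound \<open>12/25\<close> on the rate leaves room, below \<open>1/2\<close>, for the second-order terms of a step.
\<close>

locale contractive_training_data = training_data L X n r s lo hi \<Omega>
  for L :: "('q::finite mat, real^'d::finite) linop" and X n r s lo hi \<Omega> +
  assumes surj: "surj (app L)" and onorm_ge: "9/10 \<le> onorm (app L)"
    and rate: "(onorm (app L))\<^sup>2 * (100/81) * (3/2 * \<Omega> + 3 * hi * ((hi - lo) / lo)\<^sup>2) / lo \<le> 12/25"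
begin

lemma energy_le: "x \<in> reduced_space \<Longrightarrow> energy x x \<le> 12/25 * form x x"
  using energy_le_rate[of x] mult_right_mono[OF rate form_nonneg] by (rule order_trans)

definition right_inverse :: "(real^'d, 'q mat) linop"
  where "right_inverse = (SOME R. \<forall>v. app L (app R v) = v)"

lemma app_right_inverse: "app L (app right_inverse v) = v"
proof -
  obtain g where "linear g" "app L \<circ> g = id"
    using linear_surjective_right_inverse[OF linear_app surj] by blast
  then have "\<forall>v. app L (app (Linop g) v) = v" by (simp add: app_Linop fun_eq_iff)
  then have "\<exists>R. \<forall>v. app L (app R v) = v" by blast
  from someI_ex[OF this] show ?thesis unfolding right_inverse_def by blast
qed

definition lift :: "('q mat, real^'d) linop \<Rightarrow> ('q mat, 'q mat) linop"
  where "lift G = lcomp right_inverse G"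

lemma lcomp_lift [simp]: "lcomp L (lift G) = G"
  by (rule linop_eqI) (simp add: lift_def app_right_inverse)

lemma norm_lift_le: "norm (lift G) \<le> norm right_inverse * norm G"
  unfolding lift_def by (rule norm_lcomp_le)

lemma linear_lift: "linear lift"
  unfolding lift_def by (rule linear_lcomp_right)

abbreviation deviation :: "('q mat \<Rightarrow> real^'d) \<Rightarrow> real"
  where "deviation F \<equiv> xi (app L) F"

lemma deviation_eq: "deviation F = Inf {norm E | E. represents F (lcomp L E)}"
proof -
  have "(\<exists>M. rank_preserver M \<and> F = app L \<circ> (\<lambda>X. X + app E X) \<circ> M) \<longleftrightarrow> represents F (lcomp L E)" for E
    by (simp add: represents_def comp_def app_add_arg)
  then show ?thesis unfolding xi_def by simp
qed

lemma deviation_le: "represents F (lcomp L E) \<Longrightarrow> deviation F \<le> norm E"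
  unfolding deviation_eq by (rule cInf_lower) (auto intro: bdd_belowI[of _ 0])

lemma deviation_le_lift: "represents F G \<Longrightarrow> deviation F \<le> norm right_inverse * norm G"
  using deviation_le[of F "lift G"] norm_lift_le[of G] by simp

lemma represents_exists:
  assumes "linear F" shows "{norm E | E. represents F (lcomp L E)} \<noteq> {}"
proof -
  have "represents F (Linop F - L)" unfolding represents_def
    by (intro exI[of _ "\<lambda>Y. Y"]) (simp add: app_Linop[OF assms] rank_preserver_def linear_ident)
  then have "represents F (lcomp L (lift (Linop F - L)))" by simp
  then show ?thesis by blast
qed

lemma deviation_nonneg: "linear F \<Longrightarrow> 0 \<le> deviation F"
  unfolding deviation_eq using represents_exists by (rule cInf_greatest) auto

lemma deviation_approx:
  assumes "linear F" "deviation F < c"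
  obtains E where "represents F (lcomp L E)" "norm E < c"
  using cInf_lessD[OF represents_exists[OF assms(1)]] assms(2) unfolding deviation_eq by blast

lemma norm_lcomp_L: "norm (lcomp L E) \<le> onorm (app L) * norm E"
  by (rule norm_lcomp_onorm)

lemma onorm_pos: "0 < onorm (app L)" using onorm_ge by linarith

text \<open>
  Within this radius the second-order terms of a step are a small fraction of the perturbation.
\<close>

definition basin :: real where "basin = 1 / (20000 * real CARD('q) ^ 3 * (onorm (app L))\<^sup>2)"

lemma basin_pos: "0 < basin"
  unfolding basin_def using onorm_pos by simp

lemma basin_small:
  assumes "0 \<le> e" "e \<le> basin"
  shows "20000 * real CARD('q) ^ 3 * onorm (app L) * (onorm (app L) * e) \<le> 1"
    "(onorm (app L) * e) * (18000 * real CARD('q) ^ 3) \<le> 1"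
proof -
  let ?l = "onorm (app L)" and ?q = "real CARD('q)"
  have q3: "0 < ?q ^ 3" by simp
  have "e * (20000 * ?q ^ 3 * ?l\<^sup>2) \<le> 1"
    using assms(2) onorm_pos q3 unfolding basin_def by (simp add: pos_le_divide_eq)
  then show 1: "20000 * ?q ^ 3 * ?l * (?l * e) \<le> 1" by (simp add: power2_eq_square mult_ac)
  have "(?l * e) * (18000 * ?q ^ 3) = (20000 * ?q ^ 3 * (?l * e)) * (9/10)" by simp
  also have "\<dots> \<le> (20000 * ?q ^ 3 * (?l * e)) * ?l"
    using onorm_ge onorm_pos assms(1) by (intro mult_left_mono) auto
  also have "\<dots> \<le> 1" using 1 by (simp add: mult_ac)
  finally show "(?l * e) * (18000 * ?q ^ 3) \<le> 1" .
qed

context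
  fixes F :: "nat \<Rightarrow> 'q mat \<Rightarrow> real^'d"
  assumes init: "linear (F 0)" "deviation (F 0) < basin"
    and step: "\<And>t. alternating_update_step n r (\<lambda>j. app L (X j)) (F t) (F (Suc t))"
begin

lemma iterates_linear: "linear (F t)"
proof (cases t)
  case (Suc u)
  then show ?thesis using step[of u] linear_compose
    unfolding alternating_update_step_def least_squares_fit_def pd_rank_preserver_def rank_preserver_def
      by metis
qed (use init in simp)

lemma iterates_geometric: "\<exists>G. represents (F t) G \<and> norm G \<le> onorm (app L) * basin / 2 ^ t"
proof (induction t)
  case 0
  obtain E where E: "represents (F 0) (lcomp L E)" "norm E < basin"
    using deviation_approx[OF init] .
  have "norm (lcomp L E) \<le> onorm (app L) * basin"
    using norm_lcomp_L[of E] E(2) onorm_pos by (meson less_imp_le mult_left_mono order_trans)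
  then show ?case using E(1) by auto
next
  case (Suc t)
  then obtain G where G: "represents (F t) G" "norm G \<le> onorm (app L) * (basin / 2 ^ t)" by auto
  have "basin / 2 ^ t \<le> basin" using basin_pos by (simp add: divide_le_eq mult_le_cancel_left1)
  then obtain G' where "represents (F (Suc t)) G'" "norm G' \<le> onorm (app L) * (basin / 2 ^ t) / 2"
    using step_contraction[OF G(1) step G(2) basin_small(1) onorm_ge energy_le] basin_pos by auto
  then show ?case by (auto simp: mult_ac)
qed

lemma deviation_tendsto_0: "(\<lambda>t. deviation (F t)) \<longlonglongrightarrow> 0"
proof (rule tendsto_sandwich[OF _ _ tendsto_const])
  let ?c = "norm right_inverse * (onorm (app L) * basin)"
  have "deviation (F t) \<le> ?c / 2 ^ t" for t
  proof -
    obtain G where G: "represents (F t) G" "norm G \<le> onorm (app L) * basin / 2 ^ t"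
      using iterates_geometric by blast
    have "deviation (F t) \<le> norm right_inverse * norm G" by (rule deviation_le_lift[OF G(1)])
    also have "\<dots> \<le> norm right_inverse * (onorm (app L) * basin / 2 ^ t)"
      using G(2) by (intro mult_left_mono) auto
    finally show ?thesis by simp
  qed
  then show "\<forall>\<^sub>F t in sequentially. deviation (F t) \<le> ?c / 2 ^ t" by simp
  show "(\<lambda>t. ?c / 2 ^ t) \<longlonglongrightarrow> 0"
    using tendsto_mult_left[OF LIMSEQ_power_zero[of "1/2 :: real"], of ?c]
      by (simp add: power_divide)
  show "\<forall>\<^sub>F t in sequentially. 0 \<le> deviation (F t)"
    using deviation_nonneg[OF iterates_linear] by simp
qed

definition growth :: real where "growth = norm right_inverse * onorm (app L)"

lemma growth_nonneg: "0 \<le> growth" using onorm_pos by (simp add: growth_def)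

text \<open>
  Besides bounding the growth, this shows that a deviation of zero persists, even though the infimum
  defining it need not be attained.
\<close>

lemma deviation_step:
  assumes "deviation (F t) < basin"
  shows "deviation (F (Suc t)) \<le> growth * deviation (F t)"
proof (rule field_le_epsilon)
  fix e :: real assume e: "0 < e"
  define c where "c = min basin (deviation (F t) + e / (growth + 1))"
  have "deviation (F t) < c" using assms e growth_nonneg by (simp add: c_def)
  then obtain E where E: "represents (F t) (lcomp L E)" "norm E < c"
    using deviation_approx[OF iterates_linear] by blast
  have small: "norm E \<le> basin" using E(2) by (simp add: c_def)
  obtain G' where G': "represents (F (Suc t)) G'" "norm G' \<le> (onorm (app L) * norm E) / 2"
    using step_contraction[OF E(1) step norm_lcomp_L basin_small(1)[OF _ small] onorm_ge energy_le]
      by auto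
  have "deviation (F (Suc t)) \<le> norm right_inverse * norm G'" by (rule deviation_le_lift[OF G'(1)])
  also have "\<dots> \<le> norm right_inverse * (onorm (app L) * norm E)"
  proof (rule mult_left_mono)
    have "0 \<le> onorm (app L) * norm E" using onorm_pos by simp
    then show "norm G' \<le> onorm (app L) * norm E" using G'(2) by linarith
  qed simp
  also have "\<dots> = growth * norm E" by (simp add: growth_def)
  also have "\<dots> \<le> growth * (deviation (F t) + e / (growth + 1))"
    using E(2) growth_nonneg by (intro mult_left_mono) (auto simp: c_def)
  also have "\<dots> \<le> growth * deviation (F t) + e"
    using growth_nonneg e by (simp add: field_simps)
  finally show "deviation (F (Suc t)) \<le> growth * deviation (F t) + e" .
qed

definition null_space :: "('q mat, 'q mat) linop set"
  where "null_space = {E. lcomp L E \<in> gauge_space}"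

lemma subspace_null_space: "subspace null_space"
  unfolding null_space_def using subspace_gauge_space
  by (auto simp: subspace_def linear_0[OF linear_lcomp_right] linear_add[OF linear_lcomp_right] linear_cmul[OF linear_lcomp_right])

text \<open>
  \<open>norm (residual G)\<close> is the least norm of an \<open>E\<close> with \<open>lcomp L E\<close> equal to \<open>G\<close> up to gauge: the
  first-order part of the deviation.
\<close>

definition residual :: "('q mat, real^'d) linop \<Rightarrow> ('q mat, 'q mat) linop"
  where "residual G = proj (null_space\<^sup>\<bottom>) (lift G)"

lemma linear_residual: "linear residual"
  unfolding residual_def
  by (rule linear_compose[OF linear_lift linear_proj[OF subspace_orthogonal_comp], unfolded comp_def])

lemma proj_null_space:
  assumes "E \<in> null_space" shows "proj (null_space\<^sup>\<bottom>) E = 0"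
  using assms orthogonal_comp_subset[of null_space]
  by (intro proj_unique subspace_orthogonal_comp) (auto intro: subspace_0[OF subspace_orthogonal_comp])

lemma residual_lcomp: "residual (lcomp L E) = proj (null_space\<^sup>\<bottom>) E"
proof -
  have "lift (lcomp L E) - E \<in> null_space"
    by (simp add: null_space_def linear_diff[OF linear_lcomp_right] subspace_0[OF subspace_gauge_space])
  from proj_null_space[OF this] show ?thesis
    by (simp add: residual_def linear_diff[OF linear_proj[OF subspace_orthogonal_comp]])
qed

lemma norm_residual_le: "norm (residual (lcomp L E)) \<le> norm E"
  unfolding residual_lcomp by (rule norm_proj_le[OF subspace_orthogonal_comp])

lemma residual_reduce: "residual (reduce G) = residual G"
proof -
  have "lift (gauge G) \<in> null_space" using gauge_in by (simp add: null_space_def)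
  from proj_null_space[OF this] show ?thesis
    by (simp add: reduce_def linear_diff[OF linear_residual]) (simp add: residual_def)
qed

text \<open>
  Up to the kernel of composition with \<open>L\<close>, the operator \<open>E\<close> differs from its residual by some \<open>w\<close> in
  \<open>W_space\<close> of size \<open>O(norm E)\<close>, which a rank preserver absorbs with a second-order error.
\<close>

lemma deviation_le_residual:
  obtains C \<tau> where "0 \<le> C" "0 < \<tau>"
    "\<And>H E. represents H (lcomp L E) \<Longrightarrow> norm E \<le> \<tau> \<Longrightarrow> deviation H \<le> norm (residual (lcomp L E)) + C * (norm E)\<^sup>2"
proof -
  let ?q = "real CARD('q)" and ?l = "onorm (app L)"
  define k where "k = 20/9 * ?q * ?l"
  have k: "0 < k" using onorm_pos by (simp add: k_def)
  define \<tau> where "\<tau> = 1 / (6 * ?q * k)"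
  define C where "C = norm right_inverse * (2 * (?q * ?l * k\<^sup>2) + 6 * ?q * k * ?l)"
  have "deviation H \<le> norm (residual (lcomp L E)) + C * (norm E)\<^sup>2"
    if H: "represents H (lcomp L E)" and E: "norm E \<le> \<tau>" for H E
  proof -
    define p where "p = proj (null_space\<^sup>\<bottom>) E"
    have "E - p \<in> null_space\<^sup>\<bottom>\<^sup>\<bottom>"
      unfolding p_def by (rule proj_orthogonal[OF subspace_orthogonal_comp])
    then have "E - p \<in> null_space" using orthogonal_comp_self[OF subspace_null_space] by simp
    then obtain w where w: "w \<in> W_space" "lcomp L (E - p) = lcomp L w"
      by (auto simp: null_space_def gauge_space_def)
    have split: "lcomp L E = lcomp L w + lcomp L p"
      using w(2) by (simp add: linear_diff[OF linear_lcomp_right] algebra_simps)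
    have "norm (E - p) \<le> norm E"
      unfolding p_def by (rule norm_diff_proj_le[OF subspace_orthogonal_comp])
    then have "norm (lcomp L w) \<le> ?l * norm E"
      unfolding w(2)[symmetric]
        using norm_lcomp_L onorm_pos by (meson less_imp_le mult_left_mono order_trans)
    then have "norm w \<le> 10/9 * (?l * norm E)" using norm_le_lcomp[OF w(1)] by linarith
    then have "2 * ?q * norm w \<le> 2 * ?q * (10/9 * (?l * norm E))" by (intro mult_left_mono) auto
    then have a1: "2 * ?q * norm w \<le> k * norm E" by (simp add: k_def)
    have a2: "6 * ?q * (k * norm E) \<le> 1"
    proof -
      have "norm E * (6 * ?q * k) \<le> 1" using E k by (simp add: \<tau>_def pos_le_divide_eq)
      then show ?thesis by (simp add: mult_ac)
    qed
    obtain G' where G': "represents H G'"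
      "norm (G' - lcomp L p) \<le> ?q * ?l * (k * norm E)\<^sup>2 + 3 * ?q * (k * norm E) * norm G'"
      using represents_shift[OF _ w(1) a1 a2, of H "lcomp L p"] H split by auto
    have Lp: "norm (lcomp L p) \<le> ?l * norm E"
    proof -
      have "norm p \<le> norm E" unfolding p_def by (rule norm_proj_le[OF subspace_orthogonal_comp])
      then show ?thesis
        using norm_lcomp_L[of p] onorm_pos by (meson less_imp_le mult_left_mono order_trans)
    qed
    define g where "g = ?q * ?l * (k * norm E)\<^sup>2"
    have g0: "0 \<le> g" using onorm_pos by (simp add: g_def)
    define T where "T = 3 * ?q * (k * norm E) * norm G'"
    have "T \<le> 1/2 * norm G'" unfolding T_def using a2 by (intro mult_right_mono) auto
    moreover have "norm (G' - lcomp L p) \<le> g + T" using G'(2) by (simp add: g_def T_def)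
    moreover have "norm G' \<le> norm (lcomp L p) + norm (G' - lcomp L p)" by (rule norm_triangle_sub)
    ultimately have "norm G' \<le> (?l * norm E + g) + 1/2 * norm G'" using Lp by linarith
    then have "norm G' \<le> 2 * (?l * norm E + g)" by simp
    then have "3 * ?q * (k * norm E) * norm G' \<le> 3 * ?q * (k * norm E) * (2 * (?l * norm E + g))"
      using k by (intro mult_left_mono) auto
    also have "\<dots> = 6 * ?q * k * ?l * (norm E)\<^sup>2 + (6 * ?q * (k * norm E)) * g"
      by (simp add: algebra_simps power2_eq_square)
    also have "\<dots> \<le> 6 * ?q * k * ?l * (norm E)\<^sup>2 + 1 * g"
      using a2 g0 by (intro add_left_mono mult_right_mono)
    finally have "norm (G' - lcomp L p) \<le> 6 * ?q * k * ?l * (norm E)\<^sup>2 + 2 * g"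
      using G'(2) by (simp add: g_def)
    also have "\<dots> = (2 * (?q * ?l * k\<^sup>2) + 6 * ?q * k * ?l) * (norm E)\<^sup>2"
      by (simp add: g_def power_mult_distrib algebra_simps)
    finally have diff: "norm (G' - lcomp L p) \<le> (2 * (?q * ?l * k\<^sup>2) + 6 * ?q * k * ?l) * (norm E)\<^sup>2" .
    have "lcomp L (p + lift (G' - lcomp L p)) = G'" by (simp add: linear_add[OF linear_lcomp_right])
    then have "deviation H \<le> norm (p + lift (G' - lcomp L p))" using deviation_le G'(1) by metis
    also have "\<dots> \<le> norm p + norm right_inverse * norm (G' - lcomp L p)"
      using norm_triangle_ineq norm_lift_le by (meson add_left_mono order_trans)
    also have "\<dots> \<le> norm p + norm right_inverse * ((2 * (?q * ?l * k\<^sup>2) + 6 * ?q * k * ?l) * (norm E)\<^sup>2)"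
      using diff by (intro add_left_mono mult_left_mono) auto
    also have "\<dots> = norm (residual (lcomp L E)) + C * (norm E)\<^sup>2"
      by (simp add: C_def p_def residual_lcomp)
    finally show ?thesis .
  qed
  moreover have "0 \<le> C" unfolding C_def using k onorm_pos by simp
  moreover have "0 < \<tau>" unfolding \<tau>_def using k by simp
  ultimately show thesis using that by blast
qed

lemma represents_same:
  obtains C where "0 \<le> C"
    "\<And>H G1 G2 \<eta>. represents H G1 \<Longrightarrow> represents H G2 \<Longrightarrow> norm G1 \<le> \<eta> \<Longrightarrow> norm G2 \<le> \<eta> \<Longrightarrow>
      \<eta> \<le> 1/10 \<Longrightarrow> norm (reduce G1 - reduce G2) \<le> C * \<eta>\<^sup>2"
proof -
  have "9/10 * norm Y \<le> norm (app L Y)" if "rank Y \<le> 2" for Y using rip[of Y] that r by linarith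
  then obtain C where C: "0 \<le> C"
    "\<And>G1 G2 M \<eta>. rank_preserver M \<Longrightarrow> (\<And>Y. app (L + G1) Y = app (L + G2) (M Y)) \<Longrightarrow>
      norm G1 \<le> \<eta> \<Longrightarrow> norm G2 \<le> \<eta> \<Longrightarrow> \<eta> \<le> 1/10 \<Longrightarrow> \<exists>w\<in>W_space. norm (G1 - G2 - lcomp L w) \<le> C * \<eta>\<^sup>2"
    using equivalent_maps_agree_mod_W_space[of L] by blast
  have "norm (reduce G1 - reduce G2) \<le> 101/100 * C * \<eta>\<^sup>2"
    if H: "represents H G1" "represents H G2" and G: "norm G1 \<le> \<eta>" "norm G2 \<le> \<eta>" "\<eta> \<le> 1/10"
      for H G1 G2 \<eta>
  proof -
    obtain M1 where M1: "rank_preserver M1" "H = (\<lambda>Y. app (L + G1) (M1 Y))"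
      using H(1) by (auto simp: represents_def)
    obtain M2 where M2: "rank_preserver M2" "H = (\<lambda>Y. app (L + G2) (M2 Y))"
      using H(2) by (auto simp: represents_def)
    obtain M1' where M1': "rank_preserver M1'" "\<And>x. M1 (M1' x) = x" "\<And>x. M1' (M1 x) = x"
      using rank_preserver_inverse[OF M1(1)] by blast
    have eq: "app (L + G1) Y = app (L + G2) (M2 (M1' Y))" for Y
    proof -
      have "app (L + G1) (M1 (M1' Y)) = app (L + G2) (M2 (M1' Y))"
        by (rule fun_cong[OF trans[OF M1(2)[symmetric] M2(2)]])
      then show ?thesis unfolding M1'(2) .
    qed
    obtain w where w: "w \<in> W_space" "norm (G1 - G2 - lcomp L w) \<le> C * \<eta>\<^sup>2"
      using C(2)[OF rank_preserver_compose[OF M2(1) M1'(1)] eq G] by blast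
    have "reduce (lcomp L w) = 0" using w(1) by (intro reduce_of_gauge) (auto simp: gauge_space_def)
    then have "reduce G1 - reduce G2 = reduce (G1 - G2 - lcomp L w)"
      by (simp add: linear_diff[OF linear_reduce])
    then have "norm (reduce G1 - reduce G2) \<le> 101/100 * norm (G1 - G2 - lcomp L w)"
      using norm_reduce_le by metis
    then show ?thesis using w(2) by simp
  qed
  then show thesis using that[of "101/100 * C"] C(1) by simp
qed

text \<open>
  Nearly optimal representatives of the iterates form, after reduction, a perturbed power iteration
  with \<open>update\<close>, and their residual norms are asymptotic to the deviations.
\<close>

lemma eventual_rate:
  assumes pos: "\<And>t. 0 < deviation (F t)"
    and \<beta>: "0 < \<beta>" "\<And>x. x \<in> reduced_space \<Longrightarrow> energy x x \<le> \<beta> * form x x" and \<gamma>: "\<beta> < \<gamma>"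
  shows "\<forall>\<^sub>F t in sequentially. deviation (F (Suc t)) \<le> \<gamma> * deviation (F t)"
proof -
  let ?q = "real CARD('q)" and ?l = "onorm (app L)"
  define \<xi> where "\<xi> t = deviation (F t)" for t
  have \<xi>: "0 < \<xi> t" for t using pos by (simp add: \<xi>_def)
  have \<xi>0: "\<xi> \<longlonglongrightarrow> 0" unfolding \<xi>_def by (rule deviation_tendsto_0)
  obtain C1 \<tau> where C1: "0 \<le> C1" "0 < \<tau>"
    "\<And>H E. represents H (lcomp L E) \<Longrightarrow> norm E \<le> \<tau> \<Longrightarrow> deviation H \<le> norm (residual (lcomp L E)) + C1 * (norm E)\<^sup>2"
    using deviation_le_residual by blast
  obtain C2 where C2: "0 \<le> C2"
    "\<And>H G1 G2 \<eta>. represents H G1 \<Longrightarrow> represents H G2 \<Longrightarrow> norm G1 \<le> \<eta> \<Longrightarrow> norm G2 \<le> \<eta> \<Longrightarrow>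
      \<eta> \<le> 1/10 \<Longrightarrow> norm (reduce G1 - reduce G2) \<le> C2 * \<eta>\<^sup>2"
    using represents_same by blast
  have "\<exists>E. represents (F t) (lcomp L E) \<and> norm E < \<xi> t + (\<xi> t)\<^sup>2" for t
  proof -
    have "deviation (F t) < \<xi> t + (\<xi> t)\<^sup>2" using \<xi>[of t] by (simp add: \<xi>_def)
    then show ?thesis using deviation_approx[OF iterates_linear] by metis
  qed
  then obtain E where E: "\<And>t. represents (F t) (lcomp L (E t))" "\<And>t. norm (E t) < \<xi> t + (\<xi> t)\<^sup>2"
    by metis
  define G where "G t = lcomp L (E t)" for t
  define x where "x t = reduce (G t)" for t
  obtain k where k: "0 < k" "\<And>v. norm (residual v) \<le> k * norm v"
    using linear_bounded_pos[OF linear_residual] by blast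
  define c where "c = 4 * ?l * (1 + growth)"
  have c: "0 < c" using onorm_pos growth_nonneg by (simp add: c_def)
  define C3 where "C3 = 101/100 * (28 * ?q ^ 3 * (2 * ?l)\<^sup>2) + C2 * c\<^sup>2"
  have C3: "0 \<le> C3" using C2(1) by (simp add: C3_def)
  \<comment> \<open>A common threshold for the smallness requirements below, reached from some time on.\<close>
  define \<theta> where "\<theta> = min (1/2) (min (basin / 2) (min (\<tau> / 2) (min (1 / (10 * c))
      (min (1 / (28 * ?q ^ 3 * 4 * ?l)) (1 / (8 * (C1 + 1)))))))"
  have \<theta>: "0 < \<theta>" unfolding \<theta>_def using basin_pos C1 c onorm_pos by simp
  obtain t0 where t0: "\<And>t. t0 \<le> t \<Longrightarrow> \<xi> t < \<theta>"
    using order_tendstoD(2)[OF \<xi>0 \<theta>] unfolding eventually_sequentially by blast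
  have small: "\<xi> t \<le> 1/2" "2 * \<xi> t \<le> basin" "2 * \<xi> t \<le> \<tau>" "c * \<xi> t \<le> 1/10"
    "28 * ?q ^ 3 * 4 * ?l * \<xi> t \<le> 1"
      "C1 * (4 * \<xi> t) \<le> 1/2" if "t0 \<le> t" for t
  proof -
    have th: "\<xi> t \<le> 1/2" "\<xi> t \<le> basin / 2" "\<xi> t \<le> \<tau> / 2" "\<xi> t \<le> 1 / (10 * c)"
      "\<xi> t \<le> 1 / (28 * ?q ^ 3 * 4 * ?l)"
       "\<xi> t \<le> 1 / (8 * (C1 + 1))"
      using t0[OF that] unfolding \<theta>_def min_less_iff_conj by (blast intro: less_imp_le)+
    show "\<xi> t \<le> 1/2" "2 * \<xi> t \<le> basin" "2 * \<xi> t \<le> \<tau>" using th by simp_all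
    show "c * \<xi> t \<le> 1/10" using th(4) c by (simp add: field_simps)
    show "28 * ?q ^ 3 * 4 * ?l * \<xi> t \<le> 1" using th(5) onorm_pos by (simp add: field_simps)
    have "8 * (C1 + 1) * \<xi> t \<le> 1" using th(6) C1(1) by (simp add: field_simps)
    then show "C1 * (4 * \<xi> t) \<le> 1/2" using \<xi>[of t] by (simp add: algebra_simps)
  qed
  have E2: "norm (E t) \<le> 2 * \<xi> t" if "t0 \<le> t" for t
  proof -
    have "(\<xi> t)\<^sup>2 \<le> \<xi> t"
      using small(1)[OF that] \<xi>[of t] by (simp add: power2_eq_square mult_left_le)
    then show ?thesis using E(2)[of t] by linarith
  qed
  have G2: "norm (G t) \<le> ?l * (2 * \<xi> t)" if "t0 \<le> t" for t
    unfolding G_def using norm_lcomp_L[of "E t"] E2[OF that] onorm_pos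
      by (meson less_imp_le mult_left_mono order_trans)
  have res_x: "residual (x t) = residual (G t)" for t by (simp add: x_def residual_reduce)
  have res_upper: "norm (residual (x t)) \<le> \<xi> t + (\<xi> t)\<^sup>2" for t
    using norm_residual_le[of "E t"] E(2)[of t] by (simp add: res_x G_def)
  have dev_upper: "\<xi> t \<le> norm (residual (x t)) + C1 * (4 * (\<xi> t)\<^sup>2)" if "t0 \<le> t" for t
  proof -
    have "\<xi> t \<le> norm (residual (x t)) + C1 * (norm (E t))\<^sup>2"
      using C1(3)[OF E(1)[of t]] E2[OF that] small(3)[OF that] by (simp add: res_x G_def \<xi>_def)
    moreover have "(norm (E t))\<^sup>2 \<le> (2 * \<xi> t)\<^sup>2" using E2[OF that] by (intro power_mono) auto
    then have "C1 * (norm (E t))\<^sup>2 \<le> C1 * (4 * (\<xi> t)\<^sup>2)"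
      using C1(1) by (intro mult_left_mono) (auto simp: power_mult_distrib)
    ultimately show ?thesis by linarith
  qed
  have x_lower: "\<xi> t / 2 \<le> k * norm (x t)" if "t0 \<le> t" for t
  proof -
    have "C1 * (4 * (\<xi> t)\<^sup>2) = (C1 * (4 * \<xi> t)) * \<xi> t" by (simp add: power2_eq_square)
    also have "\<dots> \<le> 1/2 * \<xi> t" using small(6)[OF that] \<xi>[of t] by (intro mult_right_mono) auto
    finally show ?thesis using dev_upper[OF that] k(2)[of "x t"] by linarith
  qed
  have x_upper: "norm (x t) \<le> 3 * ?l * \<xi> t" if "t0 \<le> t" for t
  proof -
    have "norm (x t) \<le> 101/100 * norm (G t)" unfolding x_def by (rule norm_reduce_le)
    also have "\<dots> \<le> 101/100 * (?l * (2 * \<xi> t))" using G2[OF that] by (intro mult_left_mono) auto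
    also have "\<dots> \<le> 3 * ?l * \<xi> t" using onorm_pos \<xi>[of t] by simp
    finally show ?thesis .
  qed
  have growth_step: "\<xi> (Suc t) \<le> growth * \<xi> t" if "t0 \<le> t" for t
    unfolding \<xi>_def by (rule deviation_step) (use small(2)[OF that] \<xi>[of t] in \<open>simp add: \<xi>_def\<close>)
  have x_step: "norm (x (Suc t) - update (x t)) \<le> C3 * (\<xi> t)\<^sup>2" if t: "t0 \<le> t" for t
  proof -
    let ?\<epsilon> = "?l * (2 * \<xi> t)"
    have \<epsilon>: "?\<epsilon> * (18000 * ?q ^ 3) \<le> 1" using small(2)[OF t] \<xi>[of t] by (intro basin_small) auto
    obtain G' where G': "represents (F (Suc t)) G'" "norm (G' - update (G t)) \<le> 28 * ?q ^ 3 * ?\<epsilon>\<^sup>2"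
      using step_first_order[OF E(1)[of t, folded G_def] step G2[OF t] \<epsilon>] .
    have "28 * ?q ^ 3 * ?\<epsilon>\<^sup>2 = (28 * ?q ^ 3 * 4 * ?l * \<xi> t) * (?l * \<xi> t)"
      by (simp add: power2_eq_square)
    also have "\<dots> \<le> 1 * (?l * \<xi> t)"
      using small(5)[OF t] onorm_pos \<xi>[of t] by (intro mult_right_mono) auto
    finally have e1: "norm (G' - update (G t)) \<le> ?l * \<xi> t" using G'(2) by linarith
    have lx: "0 \<le> ?l * \<xi> t" "0 \<le> ?l * \<xi> t * growth"
      using onorm_pos \<xi>[of t] growth_nonneg by simp_all
    have c_exp: "c * \<xi> t = 4 * (?l * \<xi> t) + 4 * (?l * \<xi> t * growth)"
      by (simp add: c_def algebra_simps)
    have "norm G' \<le> norm (update (G t)) + norm (G' - update (G t))"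
      using norm_triangle_sub[of G' "update (G t)"] by simp
    also have "\<dots> \<le> 101/100 * (?l * (2 * \<xi> t)) + ?l * \<xi> t"
      using norm_update_le[of "G t"] G2[OF t] e1 by linarith
    also have "\<dots> \<le> c * \<xi> t" unfolding c_exp using lx by linarith
    finally have n1: "norm G' \<le> c * \<xi> t" .
    have "norm (G (Suc t)) \<le> ?l * (2 * (growth * \<xi> t))"
      using G2[of "Suc t"] t growth_step[OF t] onorm_pos
      by (meson le_Suc_eq less_imp_le mult_left_mono order_trans zero_le_numeral)
    then have n2: "norm (G (Suc t)) \<le> c * \<xi> t" using lx by (simp add: c_exp mult_ac)
    have same: "norm (reduce G' - x (Suc t)) \<le> C2 * (c * \<xi> t)\<^sup>2"
      unfolding x_def using C2(2)[OF G'(1) E(1)[of "Suc t", folded G_def] n1 n2 small(4)[OF t]] .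
    have "norm (reduce G' - update (x t)) \<le> 101/100 * (28 * ?q ^ 3 * ?\<epsilon>\<^sup>2)"
    proof -
      have "reduce G' - update (x t) = reduce (G' - update (G t))"
        by (simp add: x_def reduce_update linear_diff[OF linear_reduce])
      then show ?thesis using norm_reduce_le[of "G' - update (G t)"] G'(2) by simp
    qed
    moreover have "norm (x (Suc t) - update (x t)) \<le> norm (reduce G' - update (x t)) + norm (reduce G' - x (Suc t))"
      using norm_triangle_ineq4[of "reduce G' - update (x t)" "reduce G' - x (Suc t)"] by simp
    moreover have "101/100 * (28 * ?q ^ 3 * ?\<epsilon>\<^sup>2) + C2 * (c * \<xi> t)\<^sup>2 = C3 * (\<xi> t)\<^sup>2"
      by (simp add: C3_def power_mult_distrib algebra_simps)
    ultimately show ?thesis using same by linarith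
  qed
  interpret semidefinite_operator form update reduced_space lo hi \<beta>
    by (rule semidefinite_operator_update[OF subspace_reduced_space update_reduced \<beta>])
  define e where "e t = sqrt (hi / lo) * (2 * k * C3) * \<xi> (t + t0)" for t
  have e_lim: "e \<longlonglongrightarrow> 0"
    unfolding e_def using tendsto_mult_left[OF LIMSEQ_ignore_initial_segment[OF \<xi>0, of t0]] by simp
  have e_step: "form (x (Suc t + t0) - update (x (t + t0))) (x (Suc t + t0) - update (x (t + t0))) \<le> (e t)\<^sup>2 * form (x (t + t0)) (x (t + t0))"
    for t
  proof -
    let ?t = "t + t0"
    have "C3 * (\<xi> ?t)\<^sup>2 = (2 * C3 * \<xi> ?t) * (\<xi> ?t / 2)" by (simp add: power2_eq_square)
    also have "\<dots> \<le> (2 * C3 * \<xi> ?t) * (k * norm (x ?t))"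
      using x_lower[of ?t] C3 \<xi>[of ?t] by (intro mult_left_mono) auto
    finally have "norm (x (Suc ?t) - update (x ?t)) \<le> (2 * k * C3 * \<xi> ?t) * norm (x ?t)"
      using x_step[of ?t] by (simp add: mult_ac)
    then have "(norm (x (Suc ?t) - update (x ?t)))\<^sup>2 \<le> ((2 * k * C3 * \<xi> ?t) * norm (x ?t))\<^sup>2"
      by (intro power_mono) auto
    then have "hi * (norm (x (Suc ?t) - update (x ?t)))\<^sup>2 \<le> hi * ((2 * k * C3 * \<xi> ?t) * norm (x ?t))\<^sup>2"
      using hi_pos by (intro mult_left_mono) auto
    also have "\<dots> = (e t)\<^sup>2 * (lo * (norm (x ?t))\<^sup>2)"
      using lo hi_pos by (simp add: e_def power_mult_distrib)
    also have "\<dots> \<le> (e t)\<^sup>2 * form (x ?t) (x ?t)" by (intro mult_left_mono form_bounds) simp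
    finally show ?thesis using form_bounds(2)[of "x (Suc ?t) - update (x ?t)"] by simp
  qed
  have x_nz: "x (t + t0) \<noteq> 0" for t
    using x_lower[of "t + t0"] \<xi>[of "t + t0"] by auto
  have e_nn: "0 \<le> e t" for t unfolding e_def using lo hi_pos k C3 \<xi>[of "t + t0"] by simp
  obtain \<rho> where \<rho>: "0 \<le> \<rho>" "\<rho> \<le> \<beta>"
    "(\<lambda>t. form (x (Suc t + t0) - \<rho> *\<^sub>R x (t + t0)) (x (Suc t + t0) - \<rho> *\<^sub>R x (t + t0)) / form (x (t + t0)) (x (t + t0))) \<longlonglongrightarrow> 0"
    using power_iteration[of "\<lambda>t. x (t + t0)" e, OF _ x_nz e_nn e_lim e_step] reduce_in
      unfolding x_def by blast
  define f
    where "f t = form (x (Suc t + t0) - \<rho> *\<^sub>R x (t + t0)) (x (Suc t + t0) - \<rho> *\<^sub>R x (t + t0)) / form (x (t + t0)) (x (t + t0))"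
      for t
  have f0: "0 \<le> f t" for t unfolding f_def by (intro divide_nonneg_nonneg form_nonneg)
  define \<delta> where "\<delta> t = sqrt (hi / lo * f t)" for t
  have \<delta>_lim: "\<delta> \<longlonglongrightarrow> 0"
  proof -
    have "(\<lambda>t. sqrt (hi / lo * f t)) \<longlonglongrightarrow> sqrt (hi / lo * 0)"
      by (intro tendsto_intros \<rho>(3)[folded f_def])
    then show ?thesis unfolding \<delta>_def by simp
  qed
  have \<delta>: "norm (x (Suc t + t0) - \<rho> *\<^sub>R x (t + t0)) \<le> \<delta> t * norm (x (t + t0))" for t
  proof (rule power2_le_imp_le)
    let ?d = "x (Suc t + t0) - \<rho> *\<^sub>R x (t + t0)"
    have "lo * (norm ?d)\<^sup>2 \<le> form ?d ?d" by (rule form_bounds)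
    also have "\<dots> = f t * form (x (t + t0)) (x (t + t0))"
      using form_pos[OF x_nz[of t]] by (simp add: f_def)
    also have "\<dots> \<le> f t * (hi * (norm (x (t + t0)))\<^sup>2)" by (intro mult_left_mono form_bounds f0)
    finally have "(norm ?d)\<^sup>2 \<le> hi / lo * f t * (norm (x (t + t0)))\<^sup>2"
      using lo by (simp add: field_simps)
    also have "\<dots> = (\<delta> t * norm (x (t + t0)))\<^sup>2"
      using f0[of t] hi_pos lo by (simp add: \<delta>_def power_mult_distrib)
    finally show "(norm ?d)\<^sup>2 \<le> (\<delta> t * norm (x (t + t0)))\<^sup>2" .
  qed (use f0[of t] hi_pos lo in \<open>simp add: \<delta>_def\<close>)
  define g
    where "g t = \<rho> * (1 + \<xi> (t + t0)) + k * (\<delta> t * (3 * ?l)) + C1 * 4 * growth\<^sup>2 * \<xi> (t + t0)" for t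
  have ratio: "\<xi> (Suc t + t0) \<le> g t * \<xi> (t + t0)" for t
  proof -
    let ?t = "t + t0"
    have "\<xi> (Suc ?t) \<le> norm (residual (x (Suc ?t))) + C1 * (4 * (\<xi> (Suc ?t))\<^sup>2)"
      by (rule dev_upper) simp
    also have "norm (residual (x (Suc ?t))) \<le> \<rho> * norm (residual (x ?t)) + norm (residual (x (Suc ?t) - \<rho> *\<^sub>R x ?t))"
    proof -
      have eq: "residual (x (Suc ?t)) = \<rho> *\<^sub>R residual (x ?t) + residual (x (Suc ?t) - \<rho> *\<^sub>R x ?t)"
        by (simp add: linear_diff[OF linear_residual] linear_cmul[OF linear_residual])
      have "norm (residual (x (Suc ?t))) \<le> norm (\<rho> *\<^sub>R residual (x ?t)) + norm (residual (x (Suc ?t) - \<rho> *\<^sub>R x ?t))"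
        by (subst eq) (rule norm_triangle_ineq)
      then show ?thesis using \<rho>(1) by simp
    qed
    also have "\<rho> * norm (residual (x ?t)) \<le> \<rho> * (\<xi> ?t + (\<xi> ?t)\<^sup>2)"
      using res_upper \<rho>(1) by (intro mult_left_mono)
    also have "norm (residual (x (Suc ?t) - \<rho> *\<^sub>R x ?t)) \<le> k * (\<delta> t * (3 * ?l * \<xi> ?t))"
    proof -
      have "norm (x (Suc ?t) - \<rho> *\<^sub>R x ?t) \<le> \<delta> t * norm (x ?t)" using \<delta>[of t] by simp
      also have "\<dots> \<le> \<delta> t * (3 * ?l * \<xi> ?t)"
        using x_upper[of ?t] f0[of t] hi_pos lo by (intro mult_left_mono) (auto simp: \<delta>_def)
      finally show ?thesis using k by (meson less_imp_le mult_left_mono order_trans)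
    qed
    also have "C1 * (4 * (\<xi> (Suc ?t))\<^sup>2) \<le> C1 * (4 * (growth * \<xi> ?t)\<^sup>2)"
      using growth_step[of ?t] \<xi>[of "Suc ?t"] C1(1) by (intro mult_left_mono power_mono) auto
    finally show ?thesis by (simp add: g_def power2_eq_square algebra_simps)
  qed
  have "g \<longlonglongrightarrow> \<rho> * (1 + 0) + k * (0 * (3 * ?l)) + C1 * 4 * growth\<^sup>2 * 0"
    unfolding g_def by (intro tendsto_intros \<delta>_lim LIMSEQ_ignore_initial_segment[OF \<xi>0])
  then have "g \<longlonglongrightarrow> \<rho>" by simp
  then have "\<forall>\<^sub>F t in sequentially. g t < \<gamma>"
    by (rule order_tendstoD(2)) (use \<rho>(2) \<gamma> in simp)
  then have "\<forall>\<^sub>F t in sequentially. \<xi> (Suc (t + t0)) \<le> \<gamma> * \<xi> (t + t0)"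
  proof eventually_elim
    case (elim t)
    then have "g t * \<xi> (t + t0) \<le> \<gamma> * \<xi> (t + t0)"
      using \<xi>[of "t + t0"] by (intro mult_right_mono) auto
    then show ?case using ratio[of t] by simp
  qed
  then show ?thesis
    using eventually_sequentially_seg[of "\<lambda>t. \<xi> (Suc t) \<le> \<gamma> * \<xi> t" t0] by (simp add: \<xi>_def)
qed

text \<open>
  If some deviation is zero, all later ones are, and the ratios are \<open>0 / 0 = 0\<close> in the extended reals.
\<close>

theorem deviation_limsup:
  assumes \<beta>: "0 \<le> \<beta>" "\<And>x. x \<in> reduced_space \<Longrightarrow> energy x x \<le> \<beta> * form x x"
  shows "limsup (\<lambda>t. ereal (deviation (F (Suc t))) / ereal (deviation (F t))) \<le> ereal \<beta>"
proof (rule ereal_le_epsilon2)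
  fix e :: real assume e: "0 < e"
  have nn: "0 \<le> deviation (F t)" for t by (rule deviation_nonneg[OF iterates_linear])
  have "\<forall>\<^sub>F t in sequentially. deviation (F (Suc t)) \<le> (\<beta> + e) * deviation (F t)"
  proof (cases "\<forall>t. 0 < deviation (F t)")
    case True
    have "energy x x \<le> (\<beta> + e / 2) * form x x" if "x \<in> reduced_space" for x
      using \<beta>(2)[OF that] form_nonneg[of x] e by (simp add: algebra_simps add_increasing2)
    then show ?thesis using True \<beta>(1) e by (intro eventual_rate[of "\<beta> + e / 2"]) auto
  next
    case False
    then obtain t0 where zero: "deviation (F t0) = 0" using nn by (metis less_eq_real_def)
    have "deviation (F t) = 0" if "t0 \<le> t" for t
      using that
    proof (induction t rule: dec_induct)
      case (step t)
      then show ?case using deviation_step[of t] nn[of "Suc t"] basin_pos by simp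
    qed (rule zero)
    then show ?thesis unfolding eventually_sequentially by (intro exI[of _ t0]) simp
  qed
  then have "\<forall>\<^sub>F t in sequentially. ereal (deviation (F (Suc t))) / ereal (deviation (F t)) \<le> ereal (\<beta> + e)"
  proof eventually_elim
    case (elim t)
    show ?case
    proof (cases "deviation (F t) = 0")
      case True
      then have "deviation (F (Suc t)) = 0" using elim nn[of "Suc t"] by simp
      then show ?thesis using \<beta>(1) e by (simp add: zero_ereal_def[symmetric])
    next
      case False
      then have "0 < deviation (F t)" using nn[of t] by simp
      then show ?thesis using elim by (simp add: pos_divide_le_eq)
    qed
  qed
  then show "limsup (\<lambda>t. ereal (deviation (F (Suc t))) / ereal (deviation (F t))) \<le> ereal \<beta> + ereal e"
    by (simp add: Limsup_bounded)
qed

end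

end

section \<open>The covariance operator and the constants of the data\<close>

lemma covariance_inner: "covariance n X Y \<bullet> Y' = (1 / real n) * (\<Sum>j=1..n. (X j \<bullet> Y) * (X j \<bullet> Y'))"
  by (simp add: covariance_def boxtimes_def inner_sum_left)

lemma linear_covariance: "linear (covariance n X)"
  by (rule linearI) (simp_all add: covariance_def boxtimes_def inner_add_right scaleR_add_left sum.distrib
      scaleR_add_right scaleR_sum_right add_divide_distrib mult.left_commute)

lemma covariance_symmetric: "covariance n X Y \<bullet> Y' = Y \<bullet> covariance n X Y'"
  unfolding inner_commute[of Y] covariance_inner by (simp add: mult.commute)

lemma covariance_bounds:
  "Min (eigenvalues (covariance n X)) * (norm Y)\<^sup>2 \<le> (1 / real n) * (\<Sum>j=1..n. (X j \<bullet> Y)\<^sup>2)"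
  "(1 / real n) * (\<Sum>j=1..n. (X j \<bullet> Y)\<^sup>2) \<le> Max (eigenvalues (covariance n X)) * (norm Y)\<^sup>2"
  using Min_eigenvalues_le[OF linear_covariance covariance_symmetric, of n X Y]
    Max_eigenvalues_ge[OF linear_covariance covariance_symmetric, of n X Y]
  by (simp_all add: covariance_inner power2_eq_square)

lemma op_kron_tangent:
  "op_kron (boxtimes A A) (proj (tangent_space A)) E = elem_linop A (proj (tangent_space A) (app E A))"
proof (rule linop_eqI)
  fix Y
  have lin: "linear (boxtimes A A)"
    by (rule linearI) (simp_all add: boxtimes_def inner_add_right scaleR_add_left)
  have adj: "adjoint (boxtimes A A) = boxtimes A A"
    by (rule adjoint_unique) (simp add: boxtimes_def inner_commute)
  have "linear (proj (tangent_space A) \<circ> app E \<circ> boxtimes A A)"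
    by (intro linear_compose lin linear_app linear_proj subspace_tangent_space)
  then show "app (op_kron (boxtimes A A) (proj (tangent_space A)) E) Y = app (elem_linop A (proj (tangent_space A) (app E A))) Y"
    by (simp add: op_kron_def adj app_Linop elem_linop.rep_eq)
      (simp add: boxtimes_def app_scale_arg linear_cmul[OF linear_proj[OF subspace_tangent_space]] inner_commute)
qed

lemma Omega_operator_linear:
  "linear (proj (W_space\<^sup>\<bottom>) \<circ>
    (\<lambda>E. (1 / real n) *\<^sub>R (\<Sum>j=1..n. op_kron (boxtimes (X j) (X j)) (proj (tangent_space (X j))) E)))"
proof (rule linear_compose[OF _ linear_proj[OF subspace_orthogonal_comp]])
  have "linear (op_kron (boxtimes A A) (proj (tangent_space A)))" for A :: "'a mat"
    unfolding op_kron_tangent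
    by (rule linearI; rule linop_eqI)
      (simp_all add: elem_linop.rep_eq linear_add[OF linear_proj[OF subspace_tangent_space]]
        linear_cmul[OF linear_proj[OF subspace_tangent_space]] scaleR_add_right mult.commute)
  then show "linear (\<lambda>E. (1 / real n) *\<^sub>R (\<Sum>j=1..n. op_kron (boxtimes (X j) (X j)) (proj (tangent_space (X j))) E))"
    by (intro linear_compose_scale_right linear_compose_sum) auto
qed

lemma Omega_nonneg: "0 \<le> Omega n X"
  unfolding Omega_def
  by (intro onorm_pos_le linear_conv_bounded_linear[THEN iffD1] Omega_operator_linear)

lemma Omega_bound:
  assumes E: "E \<in> W_space\<^sup>\<bottom>"
  shows "(1 / real n) * (\<Sum>j=1..n. (norm (proj (tangent_space (X j)) (app E (X j))))\<^sup>2) \<le> Omega n X * (norm E)\<^sup>2"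
proof -
  let ?Q = "\<lambda>E. (1 / real n) *\<^sub>R (\<Sum>j=1..n. op_kron (boxtimes (X j) (X j)) (proj (tangent_space (X j))) E)"
  have "(1 / real n) * (\<Sum>j=1..n. (norm (proj (tangent_space (X j)) (app E (X j))))\<^sup>2) = E \<bullet> ?Q E"
    by (simp add: op_kron_tangent inner_sum_right inner_elem_linop_general power2_norm_eq_inner
        proj_inner_proj[OF subspace_tangent_space])
  also have "\<dots> = E \<bullet> proj (W_space\<^sup>\<bottom>) (?Q E)"
    using proj_inner[OF subspace_orthogonal_comp E, of "?Q E"] by (simp add: inner_commute)
  also have "\<dots> \<le> norm E * norm (proj (W_space\<^sup>\<bottom>) (?Q E))" by (rule norm_cauchy_schwarz)
  also have "\<dots> \<le> norm E * (Omega n X * norm E)"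
    unfolding Omega_def
    using onorm[OF linear_conv_bounded_linear[THEN iffD1, OF Omega_operator_linear], of n X E]
    by (intro mult_left_mono) auto
  finally show ?thesis by (simp add: power2_eq_square mult_ac)
qed

text \<open>
  The gap between \<open>sqrt (19/20)\<close> and \<open>9/10\<close>, and likewise above 1, absorbs the passage from the
  infimum to a member of the set, which is nonempty because \<open>L\<close> is bounded.
\<close>

lemma rip_const_bounds:
  fixes L :: "'q::finite mat \<Rightarrow> real^'d::finite"
  assumes lin: "linear L" and rip: "rip_const k L \<le> 1 / 20" and Y: "rank Y \<le> k"
  shows "9/10 * norm Y \<le> norm (L Y) \<and> norm (L Y) \<le> 11/10 * norm Y"
proof (cases "Y = 0")
  case True
  then show ?thesis by (simp add: linear_0[OF lin])
next
  case False
  let ?S = "{\<delta>. \<forall>X. X \<noteq> 0 \<and> rank X \<le> k \<longrightarrow>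
    1 - \<delta> \<le> (norm (L X))\<^sup>2 / (norm X)\<^sup>2 \<and> (norm (L X))\<^sup>2 / (norm X)\<^sup>2 \<le> 1 + \<delta>}"
  have "1 + (onorm L)\<^sup>2 \<in> ?S"
  proof (intro CollectI allI impI conjI)
    fix X :: "'q mat" assume X: "X \<noteq> 0 \<and> rank X \<le> k"
    show "1 - (1 + (onorm L)\<^sup>2) \<le> (norm (L X))\<^sup>2 / (norm X)\<^sup>2"
      by (rule order_trans[of _ 0]) auto
    have "norm (L X) \<le> onorm L * norm X" by (intro onorm linear_conv_bounded_linear[THEN iffD1] lin)
    then have "(norm (L X))\<^sup>2 \<le> (onorm L * norm X)\<^sup>2" by (intro power_mono) auto
    then show "(norm (L X))\<^sup>2 / (norm X)\<^sup>2 \<le> 1 + (1 + (onorm L)\<^sup>2)"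
      using X by (simp add: power_mult_distrib divide_le_eq distrib_right add_increasing)
  qed
  then obtain \<delta> where \<delta>: "\<delta> \<in> ?S" "\<delta> < 1/10"
    using cInf_lessD[of ?S "1/10"] rip unfolding rip_const_def by fastforce
  define t where "t = (norm (L Y))\<^sup>2 / (norm Y)\<^sup>2"
  have "1 - \<delta> \<le> t" "t \<le> 1 + \<delta>" using \<delta>(1) False Y by (auto simp: t_def)
  then have *: "(9/10)\<^sup>2 \<le> (norm (L Y) / norm Y)\<^sup>2" "(norm (L Y) / norm Y)\<^sup>2 \<le> (11/10)\<^sup>2"
    using \<delta>(2) unfolding power_divide t_def[symmetric] by simp_all
  have "9/10 \<le> norm (L Y) / norm Y" by (rule power2_le_imp_le[OF *(1)]) simp
  moreover have "norm (L Y) / norm Y \<le> 11/10" by (rule power2_le_imp_le[OF *(2)]) simp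
  ultimately show ?thesis using False by (simp add: field_simps)
qed

theorem theorem10:
  fixes Lstar :: "real^'q::finite^'q \<Rightarrow> real^'d::finite"
    and X :: "nat \<Rightarrow> real^'q^'q"
    and y :: "nat \<Rightarrow> real^'d"
    and L :: "nat \<Rightarrow> real^'q^'q \<Rightarrow> real^'d"
    and n r :: nat and s :: real
  assumes "n \<ge> 1"
    and "linear Lstar"
    and data: "\<And>j. j \<in> {1..n} \<Longrightarrow> y j = Lstar (X j)"
    and X1: "1 \<le> r" "r < CARD('q)" "s > 0"
      "\<And>j. j \<in> {1..n} \<Longrightarrow> rank (X j) = r"
      "\<And>j. j \<in> {1..n} \<Longrightarrow>
        s \<ge> sing_val 1 (X j) \<and> sing_val 1 (X j) \<ge> sing_val r (X j) \<and> sing_val r (X j) \<ge> s / 2"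
    and X2: "Omega n X / Lambda n X \<le> real CARD('d) / (40 * (real CARD('q))\<^sup>2)"
    and X3: "Delta n X / Lambda n X \<le> sqrt (real CARD('d)) / (100 * real CARD('q) ^ 3)"
    and L1: "rip_const (4 * r) Lstar \<le> 1 / 20"
    and L2: "normalized Lstar" "surj Lstar"
    and L3: "(onorm Lstar)\<^sup>2 \<le> 5 * (real CARD('q))\<^sup>2 / real CARD('d)"
    and init: "linear (L 0)" "normalized (L 0)"
      "xi Lstar (L 0) <
        1 / (20000 * real CARD('q) powr (7 / 2) * (real r)\<^sup>2 * (onorm Lstar)\<^sup>2)"
    and algorithm: "\<And>t. alternating_update_step n r y (L t) (L (Suc t))"
  shows "limsup (\<lambda>t. ereal (xi Lstar (L (Suc t))) / ereal (xi Lstar (L t)))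
      \<le> ereal (2 * (onorm Lstar)\<^sup>2 * (Omega n X / Lambda n X)
          + 10 * (real CARD('q))\<^sup>2 * onorm Lstar * (Delta n X / Lambda n X))
    \<and> 2 * (onorm Lstar)\<^sup>2 * (Omega n X / Lambda n X)
          + 10 * (real CARD('q))\<^sup>2 * onorm Lstar * (Delta n X / Lambda n X) < 1
    \<and> (\<lambda>t. xi Lstar (L t)) \<longlonglongrightarrow> 0"
proof -
  let ?q = "real CARD('q)" and ?d = "real CARD('d)" and ?l = "onorm Lstar"
  define lo where "lo = Min (eigenvalues (covariance n X))"
  define hi where "hi = Max (eigenvalues (covariance n X))"
  define \<Omega> where "\<Omega> = Omega n X"
  define \<Lambda> where "\<Lambda> = Lambda n X"
  define \<eta> where "\<eta> = Delta n X / \<Lambda>"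
  define R where "R = 2 * ?l\<^sup>2 * (\<Omega> / \<Lambda>) + 10 * ?q\<^sup>2 * ?l * \<eta>"
  define LL where "LL = Linop Lstar"
  have LL: "app LL = Lstar" unfolding LL_def by (rule app_Linop[OF assms(2)])
  have q2: "2 \<le> CARD('q)" using X1 by linarith
  have q: "2 \<le> ?q" using q2 by simp
  have d_pos: "1 \<le> ?d" by (simp add: Suc_leI)
  have "CARD('d) \<le> CARD('q) * CARD('q)"
  proof -
    have "dim (range Lstar) \<le> dim (UNIV :: 'q mat set)" by (rule dim_image_le[OF assms(2)])
    then show ?thesis using L2(2) by simp
  qed
  then have "?d \<le> ?q\<^sup>2" by (simp add: power2_eq_square flip: of_nat_mult)
  then have sqrt_d: "sqrt ?d \<le> ?q" by (intro real_le_lsqrt) auto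
  have rip: "9/10 * norm Y \<le> norm (app LL Y) \<and> norm (app LL Y) \<le> 11/10 * norm Y" if "rank Y \<le> 4 * r"
    for Y
    unfolding LL by (rule rip_const_bounds[OF assms(2) L1 that])
  have l_ge: "9/10 \<le> ?l"
  proof -
    obtain b :: "'q mat" where b: "b \<in> Basis" using nonempty_Basis by blast
    then have "rank b \<le> 4 * r" using X1(1) rank_outer_le
      by (metis Basis_matrix_outer le_trans mult_le_mono1 nat_mult_1 one_le_numeral mult.commute mult_le_mono)
    then have "9/10 * norm b \<le> norm (Lstar b)" using rip LL by metis
    also have "\<dots> \<le> ?l * norm b" by (intro onorm linear_conv_bounded_linear[THEN iffD1] assms(2))
    finally show ?thesis using b by simp
  qed
  \<comment> \<open>The covariance is positive definite and nearly isotropic.\<close>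
  have fin: "finite (eigenvalues (covariance n X))"
    by (rule finite_eigenvalues_symmetric[OF covariance_symmetric])
  have one: "1 \<in> {1..n}" using assms(1) by simp
  have X_nz: "X 1 \<noteq> 0" using X1(1) X1(4)[OF one] by auto
  have hi_pos: "0 < hi"
  proof -
    have "0 < (1 / real n) * (\<Sum>j=1..n. (X j \<bullet> X 1)\<^sup>2)"
      using X_nz assms(1) one by (intro mult_pos_pos sum_pos2[OF _ one]) auto
    also have "\<dots> \<le> hi * (norm (X 1))\<^sup>2" unfolding hi_def by (rule covariance_bounds)
    finally show ?thesis by (simp add: zero_less_mult_iff)
  qed
  have ne: "eigenvalues (covariance n X) \<noteq> {}"
  proof
    assume "eigenvalues (covariance n X) = {}"
    then have "span {} = (UNIV :: 'q mat set)"
      using span_eigenvectors[OF linear_covariance covariance_symmetric, of n X] by simp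
    then show False using X_nz by (metis UNIV_I singletonD span_empty)
  qed
  have lo_nn: "0 \<le> lo"
  proof -
    obtain v where v: "v \<noteq> 0" "covariance n X v = lo *\<^sub>R v"
      using Min_in[OF fin ne] unfolding lo_def eigenvalues_def by blast
    then have "lo * (v \<bullet> v) = (1 / real n) * (\<Sum>j=1..n. (X j \<bullet> v) * (X j \<bullet> v))"
      using covariance_inner[of n X v v] by simp
    also have "\<dots> \<ge> 0" by (rule mult_nonneg_nonneg) (auto intro!: sum_nonneg)
    finally have "0 \<le> lo * (v \<bullet> v)" .
    moreover have "0 < v \<bullet> v" using v(1) by simp
    ultimately show ?thesis by (simp add: zero_le_mult_iff)
  qed
  have lo_le_hi: "lo \<le> hi" unfolding lo_def hi_def using fin ne by (meson Max_ge Min_in)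
  have \<Lambda>: "\<Lambda> = (hi + lo) / 2" by (simp add: \<Lambda>_def Lambda_def hi_def lo_def)
  have \<Lambda>_pos: "0 < \<Lambda>" using hi_pos lo_nn \<Lambda> by simp
  have \<eta>_eq: "(hi - lo) / 2 = \<eta> * \<Lambda>" using \<Lambda>_pos by (simp add: \<eta>_def Delta_def hi_def lo_def)
  have \<eta>_nn: "0 \<le> \<eta>" using \<eta>_eq lo_le_hi \<Lambda>_pos
    by (metis diff_ge_0_iff_ge divide_nonneg_nonneg zero_le_numeral zero_le_mult_iff not_le)
  have "hi = \<Lambda> + \<eta> * \<Lambda>" "lo = \<Lambda> - \<eta> * \<Lambda>"
    unfolding \<eta>_eq[symmetric] unfolding \<Lambda> by (simp_all add: field_simps)
  then have hi_eq: "hi = \<Lambda> * (1 + \<eta>)" and lo_eq: "lo = \<Lambda> * (1 - \<eta>)" by (simp_all add: algebra_simps)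
  have \<eta>_le: "\<eta> \<le> sqrt ?d / (100 * ?q ^ 3)" using X3 by (simp add: \<eta>_def \<Lambda>_def)
  have q3: "8 \<le> ?q ^ 3" using power_mono[OF q, of 3] by simp
  have q2': "4 \<le> ?q\<^sup>2" using power_mono[OF q, of 2] by simp
  have \<eta>_small: "\<eta> \<le> 1/400"
  proof -
    have "sqrt ?d / (100 * ?q ^ 3) \<le> ?q / (100 * ?q ^ 3)"
      using sqrt_d by (intro divide_right_mono) auto
    also have "\<dots> = 1 / (100 * ?q\<^sup>2)" using q by (simp add: power2_eq_square power3_eq_cube)
    also have "\<dots> \<le> 1 / (100 * 4)" using q2' by (intro divide_left_mono) auto
    finally have "\<eta> \<le> 1 / (100 * 4)" by (rule order_trans[OF \<eta>_le])
    then show ?thesis by simp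
  qed
  have \<Omega>_nn: "0 \<le> \<Omega>" unfolding \<Omega>_def by (rule Omega_nonneg)
  \<comment> \<open>The claimed rate is at most \<open>1/4 + sqrt 5 / 10\<close>, and it dominates the contraction rate of the derivative.\<close>
  have l\<Omega>: "?l\<^sup>2 * (\<Omega> / \<Lambda>) \<le> 1/8"
  proof -
    have "?l\<^sup>2 * (\<Omega> / \<Lambda>) \<le> (5 * ?q\<^sup>2 / ?d) * (?d / (40 * ?q\<^sup>2))"
      using L3 X2 \<Omega>_nn \<Lambda>_pos unfolding \<Omega>_def[symmetric] \<Lambda>_def[symmetric] by (intro mult_mono) auto
    also have "\<dots> = 1/8" using q d_pos by (simp add: field_simps)
    finally show ?thesis .
  qed
  have l\<eta>: "10 * ?q\<^sup>2 * (?l * \<eta>) \<le> 224/1000"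
  proof -
    have "?l \<le> sqrt (5 * ?q\<^sup>2 / ?d)" by (rule real_le_rsqrt[OF L3])
    also have "\<dots> = sqrt 5 * ?q / sqrt ?d" by (simp add: real_sqrt_mult real_sqrt_divide)
    finally have "?l * \<eta> \<le> (sqrt 5 * ?q / sqrt ?d) * (sqrt ?d / (100 * ?q ^ 3))"
      using \<eta>_le \<eta>_nn l_ge by (intro mult_mono) auto
    also have "\<dots> = sqrt 5 / (100 * ?q\<^sup>2)"
      using q d_pos by (simp add: power2_eq_square power3_eq_cube)
    finally have "10 * ?q\<^sup>2 * (?l * \<eta>) \<le> 10 * ?q\<^sup>2 * (sqrt 5 / (100 * ?q\<^sup>2))"
      by (intro mult_left_mono) auto
    also have "\<dots> = sqrt 5 / 10" using q by simp
    also have "sqrt 5 \<le> 224/100" by (rule real_le_lsqrt) (auto simp: power2_eq_square)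
    finally show ?thesis by simp
  qed
  have R_eq: "R = 2 * (?l\<^sup>2 * (\<Omega> / \<Lambda>)) + 10 * ?q\<^sup>2 * (?l * \<eta>)" by (simp add: R_def)
  have R_le: "R \<le> 474/1000" using l\<Omega> l\<eta> unfolding R_eq by linarith
  have R_nn: "0 \<le> R" unfolding R_def using \<Omega>_nn \<Lambda>_pos \<eta>_nn l_ge by simp
  define \<kappa> where "\<kappa> = (hi - lo) / lo"
  have lo_pos: "0 < lo" using lo_eq \<Lambda>_pos \<eta>_small by simp
  have rate_le: "?l\<^sup>2 * (100/81) * (3/2 * \<Omega> + 3 * hi * \<kappa>\<^sup>2) / lo \<le> R"
  proof -
    have lo_ge: "399/400 * \<Lambda> \<le> lo" and hi_le: "hi \<le> 401/400 * \<Lambda>"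
      unfolding lo_eq hi_eq using \<eta>_small \<Lambda>_pos by simp_all
    have "\<kappa> \<le> (2 * (\<eta> * \<Lambda>)) / (399/400 * \<Lambda>)"
      unfolding \<kappa>_def using \<eta>_eq lo_ge \<Lambda>_pos lo_le_hi lo_pos by (intro frac_le) auto
    also have "\<dots> = 800/399 * \<eta>" using \<Lambda>_pos by simp
    finally have \<kappa>: "\<kappa> \<le> 800/399 * \<eta>" .
    have \<kappa>0: "0 \<le> \<kappa>" unfolding \<kappa>_def using lo_le_hi lo_pos by simp
    have "\<kappa>\<^sup>2 \<le> (800/399 * \<eta>)\<^sup>2" using \<kappa> \<kappa>0 by (intro power_mono) auto
    also have "\<dots> \<le> 41/10 * \<eta>\<^sup>2" by (simp add: power_mult_distrib power_divide mult_right_mono)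
    finally have \<kappa>2: "\<kappa>\<^sup>2 \<le> 41/10 * \<eta>\<^sup>2" .
    have t1: "3/2 * \<Omega> / lo \<le> 151/100 * (\<Omega> / \<Lambda>)"
    proof -
      have "3/2 * \<Omega> / lo \<le> 3/2 * \<Omega> / (399/400 * \<Lambda>)"
        using lo_ge lo_pos \<Lambda>_pos \<Omega>_nn by (intro divide_left_mono) auto
      also have "\<dots> = 200/133 * (\<Omega> / \<Lambda>)" by simp
      also have "\<dots> \<le> 151/100 * (\<Omega> / \<Lambda>)" using \<Omega>_nn \<Lambda>_pos by (intro mult_right_mono) auto
      finally show ?thesis .
    qed
    have t2: "3 * hi * \<kappa>\<^sup>2 / lo \<le> 13 * \<eta>\<^sup>2"
    proof -
      have "hi / lo \<le> (401/400 * \<Lambda>) / (399/400 * \<Lambda>)"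
        using hi_le lo_ge hi_pos \<Lambda>_pos by (intro frac_le) auto
      also have "\<dots> = 401/399" using \<Lambda>_pos by simp
      finally have "3 * (hi / lo) * \<kappa>\<^sup>2 \<le> 3 * (401/399) * (41/10 * \<eta>\<^sup>2)"
        using \<kappa>2 hi_pos lo_pos by (intro mult_mono) auto
      also have "\<dots> \<le> 13 * \<eta>\<^sup>2" by (simp add: mult_right_mono)
      finally show ?thesis by simp
    qed
    have "?l * \<eta> \<le> 1"
    proof -
      have "4 * (?l * \<eta>) \<le> ?q\<^sup>2 * (?l * \<eta>)" using q2' l_ge \<eta>_nn by (intro mult_right_mono) auto
      moreover have "10 * (?q\<^sup>2 * (?l * \<eta>)) \<le> 224/1000" using l\<eta> by (simp only: mult.assoc)
      ultimately show ?thesis by linarith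
    qed
    have "?l\<^sup>2 * (100/81) * (3/2 * \<Omega> + 3 * hi * \<kappa>\<^sup>2) / lo = ?l\<^sup>2 * (100/81) * (3/2 * \<Omega> / lo + 3 * hi * \<kappa>\<^sup>2 / lo)"
      by (simp only: add_divide_distrib[symmetric] times_divide_eq_right)
    also have "\<dots> \<le> ?l\<^sup>2 * (100/81) * (151/100 * (\<Omega> / \<Lambda>) + 13 * \<eta>\<^sup>2)"
      using t1 t2 by (intro mult_left_mono add_mono) auto
    also have "\<dots> = 151/81 * (?l\<^sup>2 * (\<Omega> / \<Lambda>)) + 1300/81 * ((?l * \<eta>) * (?l * \<eta>))"
      by (simp add: power2_eq_square algebra_simps)
    also have "\<dots> \<le> 2 * (?l\<^sup>2 * (\<Omega> / \<Lambda>)) + 1300/81 * (?l * \<eta>)"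
      using \<Omega>_nn \<Lambda>_pos l_ge \<eta>_nn \<open>?l * \<eta> \<le> 1\<close>
      by (intro add_mono mult_right_mono mult_left_mono mult_left_le_one_le) auto
    also have "\<dots> \<le> 2 * (?l\<^sup>2 * (\<Omega> / \<Lambda>)) + 10 * ?q\<^sup>2 * (?l * \<eta>)"
      using q2' l_ge \<eta>_nn by (intro add_left_mono mult_right_mono) auto
    finally show ?thesis unfolding R_eq .
  qed
  interpret contractive_training_data LL X n r s lo hi \<Omega>
  proof (intro contractive_training_data.intro training_data.intro contractive_training_data_axioms.intro)
    show "1 \<le> n" "1 \<le> r" "2 \<le> CARD('q)" "0 < lo" "0 \<le> \<Omega>" by fact+
    show "hi \<le> 101/100 * lo" unfolding lo_eq hi_eq using \<eta>_small \<Lambda>_pos by simp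
    show "conditioned_matrix (X j) s" if "j \<in> {1..n}" for j
    proof (rule conditioned_matrix.intro)
      show "0 < s" by fact
      show "norm (X j *v v) \<le> s * norm v" for v
        using sing_val_1_ge_norm[of "X j" v] X1(5)[OF that]
          by (meson mult_right_mono norm_ge_zero order_trans)
      show "s / 2 * norm v \<le> norm (X j *v v)" if "\<And>k. X j *v k = 0 \<Longrightarrow> k \<bullet> v = 0" for v
        using sing_val_rank_le_norm[OF X1(4)[OF \<open>j \<in> {1..n}\<close>] that] X1(5)[OF \<open>j \<in> {1..n}\<close>]
        by (meson mult_right_mono norm_ge_zero order_trans)
    qed
    show "rank (X j) = r" if "j \<in> {1..n}" for j by (rule X1(4)[OF that])
    show "9/10 * norm Y \<le> norm (app LL Y) \<and> norm (app LL Y) \<le> 11/10 * norm Y" if "rank Y \<le> 4 * r"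
      for Y
      by (rule rip[OF that])
    show "lo * (norm Y)\<^sup>2 \<le> 1 / real n * (\<Sum>j=1..n. (X j \<bullet> Y)\<^sup>2)"
      "1 / real n * (\<Sum>j=1..n. (X j \<bullet> Y)\<^sup>2) \<le> hi * (norm Y)\<^sup>2" for Y
      unfolding lo_def hi_def by (rule covariance_bounds)+
    show "1 / real n * (\<Sum>j=1..n. (norm (proj (tangent_space (X j)) (app E (X j))))\<^sup>2) \<le> \<Omega> * (norm E)\<^sup>2"
      if "E \<in> W_space\<^sup>\<bottom>" for E unfolding \<Omega>_def by (rule Omega_bound[OF that])
    show "surj (app LL)" "9/10 \<le> onorm (app LL)" unfolding LL by fact+
    show "(onorm (app LL))\<^sup>2 * (100/81) * (3/2 * \<Omega> + 3 * hi * ((hi - lo) / lo)\<^sup>2) / lo \<le> 12/25"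
      using rate_le R_le unfolding LL \<kappa>_def by linarith
  qed
  have start: "xi (app LL) (L 0) < basin"
  proof -
    have "20000 * ?q ^ 3 * ?l\<^sup>2 \<le> 20000 * ?q powr (7/2) * (real r)\<^sup>2 * ?l\<^sup>2"
    proof (rule mult_right_mono)
      have "?q ^ 3 = ?q powr 3" using q by (simp add: powr_numeral)
      also have "\<dots> \<le> ?q powr (7/2)" using q by (intro powr_mono) auto
      finally have "?q ^ 3 * 1 \<le> ?q powr (7/2) * (real r)\<^sup>2"
        using X1(1) by (intro mult_mono) (auto simp: one_le_power)
      then show "20000 * ?q ^ 3 \<le> 20000 * ?q powr (7/2) * (real r)\<^sup>2" by simp
    qed simp
    then have "1 / (20000 * ?q powr (7/2) * (real r)\<^sup>2 * ?l\<^sup>2) \<le> 1 / (20000 * ?q ^ 3 * ?l\<^sup>2)"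
      using q l_ge X1(1) by (intro divide_left_mono mult_pos_pos) auto
    then show ?thesis using init(3) unfolding basin_def LL by linarith
  qed
  have steps: "alternating_update_step n r (\<lambda>j. app LL (X j)) (L t) (L (Suc t))" for t
  proof -
    have sums: "(\<Sum>j=1..n. (norm (y j - K (Z j)))\<^sup>2) = (\<Sum>j=1..n. (norm (Lstar (X j) - K (Z j)))\<^sup>2)"
      for K Z
      by (intro sum.cong) (auto simp: data)
    have fits: "(\<forall>j\<in>{1..n}. low_rank_fit r (L t) (y j) (Z j)) \<longleftrightarrow> (\<forall>j\<in>{1..n}. low_rank_fit r (L t) (Lstar (X j)) (Z j))"
      for Z
      by (auto simp: data)
    show ?thesis
      using algorithm[of t]
        unfolding alternating_update_step_def least_squares_fit_def LL sums fits .
  qed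
  have "energy x x \<le> R * form x x" if "x \<in> reduced_space" for x
    using energy_le_rate[OF that] mult_right_mono[OF rate_le form_nonneg[of x]]
      unfolding LL \<kappa>_def by linarith
  then have "limsup (\<lambda>t. ereal (xi Lstar (L (Suc t))) / ereal (xi Lstar (L t))) \<le> ereal R"
    using deviation_limsup[OF init(1) start steps R_nn] unfolding LL by blast
  moreover have "(\<lambda>t. xi Lstar (L t)) \<longlonglongrightarrow> 0"
    using deviation_tendsto_0[OF init(1) start steps] unfolding LL .
  ultimately show ?thesis using R_le unfolding R_def \<Omega>_def \<Lambda>_def \<eta>_def by auto
qed

end
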